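(* Let $d\ge3$, let $\mathbb{T}^d=\prod_{i=1}^d(\mathbb{R}/2\pi\alpha_i\mathbb{Z})$ with $\alpha_1,\dots,\alpha_d>0$ be a rectangular torus, and let $q_e=\frac{2d}{d-2}$. Then for every $\varepsilon>0$ there are constants $C_\varepsilon$ and $\lambda_0\ge1$ (depending only on $\varepsilon$, $d$ and the torus) such that for all $\lambda\ge\lambda_0$, all $\delta\le 1$ with $\delta\ge\lambda^{-\frac{d-2}{d(d+4)}+\varepsilon}$, and all $f\in L^2(\mathbb{T}^d)$, $$\|P_{\lambda,\delta}f\|_{L^{q_e}(\mathbb{T}^d)}\le C_\varepsilon(\lambda\delta)^{\frac12}\|f\|_{L^2(\mathbb{T}^d)}.$$
   Context: $\Delta_{\mathbb{T}^d}$ is the Laplacian of the flat metric, and $P_{\lambda,\delta}=\mathbbm{1}_{[\lambda-\delta,\lambda+\delta]}\big(\sqrt{-\Delta_{\mathbb{T}^d}}\big)$, defined by the spectral theorem, is the orthogonal projection onto the span of the eigenspaces of $\sqrt{-\Delta_{\mathbb{T}^d}}$ with eigenvalues in $[\lambda-\delta,\lambda+\delta]$. *)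

theory Defs
  imports "HOL-Analysis.Analysis"
begin

text \<open>
  The rectangular torus with side lengths \<open>2 * pi * \<alpha> $ i\<close> is represented through its universal
  cover: functions on it are functions on \<open>real ^ 'n\<close> that are periodic in each coordinate,
  its volume is Lebesgue measure on a fundamental cell (not normalised), and its flat Laplacian is
  the Euclidean one.
\<close>

definition torus_periodic :: "real ^ 'n \<Rightarrow> (real ^ 'n \<Rightarrow> complex) \<Rightarrow> bool" where
  "torus_periodic \<alpha> u \<longleftrightarrow> (\<forall>x i. u (x + axis i (2 * pi * \<alpha> $ i)) = u x)"

definition torus_measure :: "real ^ 'n \<Rightarrow> (real ^ 'n) measure" where
  "torus_measure \<alpha> = lebesgue_on (cbox 0 ((2 * pi) *\<^sub>R \<alpha>))"

definition torus_Lp :: "real ^ 'n \<Rightarrow> real \<Rightarrow> (real ^ 'n \<Rightarrow> complex) set" where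
  "torus_Lp \<alpha> p = {f. torus_periodic \<alpha> f \<and> f \<in> borel_measurable (torus_measure \<alpha>) \<and>
     integrable (torus_measure \<alpha>) (\<lambda>x. norm (f x) powr p)}"

definition torus_Lp_norm :: "real ^ 'n \<Rightarrow> real \<Rightarrow> (real ^ 'n \<Rightarrow> complex) \<Rightarrow> real" where
  "torus_Lp_norm \<alpha> p f = (LINT x|torus_measure \<alpha>. norm (f x) powr p) powr (1 / p)"

definition torus_inner ::
    "real ^ 'n \<Rightarrow> (real ^ 'n \<Rightarrow> complex) \<Rightarrow> (real ^ 'n \<Rightarrow> complex) \<Rightarrow> complex" where
  "torus_inner \<alpha> f g = (LINT x|torus_measure \<alpha>. f x * cnj (g x))"

definition partial_deriv :: "'n \<Rightarrow> (real ^ 'n \<Rightarrow> complex) \<Rightarrow> real ^ 'n \<Rightarrow> complex" where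
  "partial_deriv i u x = vector_derivative (\<lambda>t. u (x + t *\<^sub>R axis i 1)) (at 0)"

primrec C_k :: "nat \<Rightarrow> (real ^ 'n \<Rightarrow> complex) \<Rightarrow> bool" where
  "C_k 0 u \<longleftrightarrow> continuous_on UNIV u"
| "C_k (Suc k) u \<longleftrightarrow> continuous_on UNIV u \<and>
     (\<forall>i x. (\<lambda>t. u (x + t *\<^sub>R axis i 1)) differentiable (at 0)) \<and>
     (\<forall>i. C_k k (partial_deriv i u))"

definition laplacian :: "(real ^ 'n \<Rightarrow> complex) \<Rightarrow> real ^ 'n \<Rightarrow> complex" where
  "laplacian u x = (\<Sum>i\<in>UNIV. partial_deriv i (partial_deriv i u) x)"

text \<open>
  The eigenspace of the square root of minus the Laplacian for \<open>\<mu>\<close>: the square root is a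
  nonnegative operator, so it is trivial for \<open>\<mu> < 0\<close>, and for \<open>\<mu> \<ge> 0\<close> it is
  the eigenspace of minus the Laplacian for \<open>\<mu>\<^sup>2\<close>. By elliptic regularity the
  eigenfunctions in \<open>L\<^sup>2\<close> have smooth representatives.
\<close>

definition sqrt_laplacian_eigenspace :: "real ^ 'n \<Rightarrow> real \<Rightarrow> (real ^ 'n \<Rightarrow> complex) set" where
  "sqrt_laplacian_eigenspace \<alpha> \<mu> =
     (if \<mu> < 0 then {\<lambda>x. 0}
      else {u. torus_periodic \<alpha> u \<and> (\<forall>k. C_k k u) \<and>
               (\<forall>x. - laplacian u x = of_real (\<mu>\<^sup>2) * u x)})"

definition spectral_subspace :: "real ^ 'n \<Rightarrow> real set \<Rightarrow> (real ^ 'n \<Rightarrow> complex) set" where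
  "spectral_subspace \<alpha> I =
     {(\<lambda>x. \<Sum>u\<in>F. c u * u x) | F c. finite F \<and> F \<subseteq> (\<Union>\<mu>\<in>I. sqrt_laplacian_eigenspace \<alpha> \<mu>)}"

text \<open>
  The orthogonal projection of \<open>f\<close>. For bounded \<open>I\<close> the subspace is finite-dimensional
  and consists of continuous functions, so for \<open>f\<close> in \<open>L\<^sup>2\<close> the element below exists
  and is unique as a function, not merely almost everywhere.
\<close>

definition spectral_projection ::
    "real ^ 'n \<Rightarrow> real \<Rightarrow> real \<Rightarrow> (real ^ 'n \<Rightarrow> complex) \<Rightarrow> real ^ 'n \<Rightarrow> complex" where
  "spectral_projection \<alpha> l \<delta> f =
     (THE g. g \<in> spectral_subspace \<alpha> {l - \<delta>..l + \<delta>} \<and>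
        (\<forall>h\<in>spectral_subspace \<alpha> {l - \<delta>..l + \<delta>}. torus_inner \<alpha> (\<lambda>x. f x - g x) h = 0))"

end

theory Submission
  imports Defs "HOL-Probability.Characteristic_Functions" "HOL-Complex_Analysis.Conformal_Mappings"
begin

text \<open>
  Write \<open>d\<close> for the dimension, \<open>q = 2 d / (d - 2)\<close> and \<open>|n|\<^sup>2 = (\<Sum>j. (n j / \<alpha> j)\<^sup>2)\<close> for \<open>n\<close> in the
  lattice \<open>\<int>\<^sup>d\<close>. The characters \<open>exp (\<i> (\<Sum>j. n j x j / \<alpha> j))\<close> diagonalise the Laplacian, so the projection
  of \<open>f\<close> is a trigonometric polynomial \<open>F\<close> with frequencies in the shell \<open>l - \<delta> \<le> |n| \<le> l + \<delta>\<close>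
  (\<open>spectral_projection_eq\<close>). By Bessel's inequality it is enough to show that the \<open>q\<close>-th power of the
  \<open>L\<^sup>q\<close> norm of \<open>F\<close> is at most a constant times \<open>(l \<delta>) powr (q / 2)\<close> when the coefficients of \<open>F\<close> have
  square sum at most 1 (\<open>trig_poly_window_Lq\<close>).

  The argument works with the level sets \<open>A = {|F| \<ge> h}\<close>. Testing \<open>F\<close> against the phase of \<open>F\<close> on \<open>A\<close>,
  a function \<open>g\<close> with \<open>|g|\<close> the indicator of \<open>A\<close>, bounds \<open>(h |A|)\<^sup>2\<close> by the sum of \<open>|<g, e\<^sub>n>|\<^sup>2\<close> over the shell
  (\<open>trig_poly_level_duality\<close>). Up to a constant the shell is dominated by the nonnegative multiplier
  \<open>exp (-|n|\<^sup>2 / l\<^sup>2) (1/\<tau>) Re (\<integral> (1 - t/\<tau>) exp (\<i> t (|n|\<^sup>2 - l\<^sup>2)) dt)\<close>, where \<open>t\<close> runs over \<open>[0, \<tau>]\<close> and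
  \<open>\<tau> = 1 / (4 l \<delta>)\<close>; this is a Fejer kernel. Cut the time integral at some \<open>a\<close>. The early times give a
  multiplier of size \<open>a / \<tau>\<close> and hence, by Bessel, a multiple of \<open>|A| a / \<tau>\<close>. The late times are a
  convolution, and give at most the supremum of its kernel times \<open>|A|\<^sup>2\<close>
  (\<open>window_coefficients_bound\<close>).

  The kernel bound (\<open>kernel_bound\<close>) is where the torus enters. Because the torus is rectangular, the kernel at
  time \<open>t\<close> is a product of one-dimensional theta functions at the complex time \<open>z = 1/l\<^sup>2 - \<i> t\<close>, and
  Jacobi's inversion formula (\<open>theta_inversion\<close>) turns it into a sum of Gaussians over the period lattice.
  A Gaussian centred at distance \<open>r\<close> contributes an oscillatory integral with phase
  \<open>l\<^sup>2 t + r\<^sup>2 / (4 t)\<close>. This phase is convex with a single stationary point, so van der Corput's method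
  gains the factor \<open>sqrt a / l\<close> on the times in \<open>[a, 2 a]\<close>
  (\<open>schroedinger_time_integral_bound\<close>). About \<open>(1 + l a)\<^sup>d\<close> Gaussians matter at these times, and adding up
  the dyadic intervals bounds the late kernel by a multiple of
  \<open>(a powr (-(d-1)/2) + l powr d * \<tau> powr ((d+1)/2)) / l\<close>.

  Choosing \<open>a\<close> as small as \<open>h\<close> permits yields \<open>|A| \<le> C l \<delta> powr ((d+1)/(d-1)) h powr (-p)\<close> with
  \<open>p = 2 (d+1)/(d-1)\<close> as soon as \<open>h\<^sup>2 \<ge> C (l/\<delta>) powr ((d-1)/2)\<close>, and \<open>|A| = 0\<close> if moreover
  \<open>h\<^sup>2 > C \<delta> l powr (d-1)\<close> (\<open>level_set_bound\<close>). Since \<open>p < q\<close>, the sum of \<open>h powr q * |A|\<close> over dyadic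
  heights is governed by the largest one, which gives exactly \<open>(l \<delta>) powr (q/2)\<close>. For the lower heights
  the shell is enlarged to \<open>\<delta> = 1\<close>, where the same bound starts at \<open>h\<^sup>2 = C l powr ((d-1)/2)\<close>, and the
  heights below that are controlled by the \<open>L\<^sup>2\<close> norm. These two contributions are acceptable if
  \<open>l \<delta> powr (d+1) \<ge> 1\<close>, which follows from the lower bound on \<open>\<delta>\<close> (\<open>window_scale_condition\<close>).
\<close>

section \<open>Uniqueness of Fourier coefficients\<close>

text \<open>
  Stone-Weierstrass for functions on a quotient: a function that is constant on the fibres of \<open>h\<close> descends
  to the compact set \<open>h ` S\<close>. The descended function is continuous because \<open>h\<close> maps the compact preimages
  of closed sets to compact sets. In the applications \<open>h\<close> wraps a fundamental cell onto a product of
  circles, which makes periodic functions accessible to polynomial approximation.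
\<close>

lemma polynomial_approximation_factoring:
  fixes h :: "'a::metric_space \<Rightarrow> 'b::euclidean_space" and u :: "'a \<Rightarrow> real"
  assumes S: "compact S" and h: "continuous_on S h" and u: "continuous_on S u"
    and resp: "\<And>x y. x \<in> S \<Longrightarrow> y \<in> S \<Longrightarrow> h x = h y \<Longrightarrow> u x = u y" and e: "e > 0"
  obtains p where "real_polynomial_function p" "\<And>x. x \<in> S \<Longrightarrow> \<bar>u x - p (h x)\<bar> < e"
proof -
  define U where "U w = u (SOME x. x \<in> S \<and> h x = w)" for w
  have U: "U (h x) = u x" if "x \<in> S" for x
  proof -
    have "\<exists>y. y \<in> S \<and> h y = h x" using that by blast
    from someI_ex[OF this] show ?thesis using resp that unfolding U_def by blast
  qed
  have cpt: "compact (h ` S)" using S h by (rule compact_continuous_image[rotated])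
  have "continuous_on (h ` S) U"
  proof (subst continuous_on_closed_vimage)
    show "closed (h ` S)" using cpt compact_imp_closed by blast
    show "\<forall>B. closed B \<longrightarrow> closed (U -` B \<inter> h ` S)"
    proof (intro allI impI)
      fix B :: "real set" assume B: "closed B"
      have eq: "U -` B \<inter> h ` S = h ` (u -` B \<inter> S)"
        using U by auto
      have "closed (u -` B \<inter> S)"
        using u B continuous_on_closed_vimage[OF compact_imp_closed[OF S], of u] by blast
      then have "compact (u -` B \<inter> S)"
        using S by (metis closed_Int_compact inf.right_idem)
      then have "compact (h ` (u -` B \<inter> S))"
        by (intro compact_continuous_image continuous_on_subset[OF h]) auto
      then show "closed (U -` B \<inter> h ` S)" unfolding eq by (rule compact_imp_closed)
    qed
  qed
  from Stone_Weierstrass_real_polynomial_function[OF cpt this e]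
  obtain p where "real_polynomial_function p" "\<And>w. w \<in> h ` S \<Longrightarrow> \<bar>U w - p w\<bar> < e" by blast
  then show ?thesis using U by (intro that[of p]) fastforce+
qed

text \<open>
  The continuous functions orthogonal to all characters \<open>e n\<close> form a module over the polynomials in the
  coordinates of \<open>h\<close>, because by \<open>alg\<close> a coordinate times a character is a combination of characters.
  With \<open>u\<close> this module contains all products of \<open>u\<close> with such polynomials, and these are orthogonal to 1.
  Approximating the conjugate of \<open>u\<close> by polynomials shows that \<open>u\<close> is orthogonal to itself.
\<close>

lemma orthogonal_to_characters_imp_zero:
  fixes e :: "'k \<Rightarrow> 'a::euclidean_space \<Rightarrow> complex" and h :: "'a \<Rightarrow> 'b::euclidean_space"
  assumes ne: "box a b \<noteq> {}" and h: "continuous_on (cbox a b) h"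
    and e: "\<And>n. continuous_on (cbox a b) (e n)"
    and alg: "\<And>j. j \<in> Basis \<Longrightarrow> \<exists>p q c d. \<forall>n x. of_real (h x \<bullet> j) * e n x = c * e (p n) x + d * e (q n) x"
    and one: "\<And>x. e n0 x = 1"
    and u: "continuous_on (cbox a b) u"
    and resp: "\<And>x y. x \<in> cbox a b \<Longrightarrow> y \<in> cbox a b \<Longrightarrow> h x = h y \<Longrightarrow> u x = u y"
    and orth: "\<And>n. integral (cbox a b) (\<lambda>x. u x * e n x) = 0"
    and x: "x \<in> cbox a b"
  shows "u x = 0"
proof -
  let ?I = "integral (cbox a b)"
  \<comment> \<open>Functions orthogonal to every character: a polynomial module, shown by induction on the polynomial.\<close>
  define ann where "ann v \<longleftrightarrow> continuous_on (cbox a b) v \<and> (\<forall>n. ?I (\<lambda>x. v x * e n x) = 0)" for v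
  have ann_int: "(\<lambda>x. v x * e n x) integrable_on cbox a b" if "ann v" for v n
    using that e[of n] unfolding ann_def by (intro integrable_continuous continuous_on_mult) auto
  have ann_add: "ann (\<lambda>x. v x + w x)" if "ann v" "ann w" for v w
    using that ann_int[OF that(1)] ann_int[OF that(2)] unfolding ann_def
    by (simp add: distrib_right integral_add continuous_on_add)
  have ann_scale: "ann (\<lambda>x. c * v x)" if "ann v" for v c
    using that unfolding ann_def by (simp add: mult.assoc continuous_on_mult)
  have ann_basis: "ann (\<lambda>x. of_real (h x \<bullet> j) * v x)" if v: "ann v" and j: "j \<in> Basis" for v j
    unfolding ann_def
  proof (intro conjI allI)
    show "continuous_on (cbox a b) (\<lambda>x. of_real (h x \<bullet> j) * v x)"
      using v h unfolding ann_def
      by (intro continuous_on_mult continuous_on_of_real continuous_on_inner continuous_on_const) auto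
    fix n
    obtain p q c d where pq: "\<forall>n x. of_real (h x \<bullet> j) * e n x = c * e (p n) x + d * e (q n) x"
      using alg[OF j] by blast
    have "of_real (h x \<bullet> j) * v x * e n x = c * (v x * e (p n) x) + d * (v x * e (q n) x)" for x
      using pq[rule_format, of x n] by (simp add: algebra_simps)
    then have "?I (\<lambda>x. of_real (h x \<bullet> j) * v x * e n x) =
       ?I (\<lambda>x. c * (v x * e (p n) x) + d * (v x * e (q n) x))" by presburger
    also have "\<dots> = c * ?I (\<lambda>x. v x * e (p n) x) + d * ?I (\<lambda>x. v x * e (q n) x)"
      by (subst integral_add) (simp_all add: ann_int[OF v] integrable_on_mult_right)
    also have "\<dots> = 0" using v unfolding ann_def by simp
    finally show "?I (\<lambda>x. of_real (h x \<bullet> j) * v x * e n x) = 0" .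
  qed
  have ann_sum: "ann (\<lambda>x. \<Sum>j\<in>J. w j x)" if "finite J" "\<And>j. j \<in> J \<Longrightarrow> ann (w j)" for w :: "'b \<Rightarrow> 'a \<Rightarrow> complex" and J
    using that
  proof (induction J rule: finite_induct)
    case empty then show ?case by (simp add: ann_def)
  next
    case (insert j J) then show ?case using ann_add[of "w j" "\<lambda>x. \<Sum>j\<in>J. w j x"] by simp
  qed
  have poly: "\<forall>v. ann v \<longrightarrow> ann (\<lambda>x. of_real (p (h x)) * v x)" if "real_polynomial_function p" for p
    using that
  proof induction
    case (linear f)
    show ?case
    proof (intro allI impI)
      fix v assume v: "ann v"
      have "f w = (\<Sum>j\<in>Basis. (w \<bullet> j) * f j)" for w
      proof -
        interpret f: bounded_linear f by fact
        have "f w = f (\<Sum>j\<in>Basis. (w \<bullet> j) *\<^sub>R j)" by (simp add: euclidean_representation)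
        also have "\<dots> = (\<Sum>j\<in>Basis. (w \<bullet> j) * f j)" by (simp add: f.sum f.scaleR)
        finally show ?thesis .
      qed
      note fw = this
      have "(\<lambda>x. of_real (f (h x)) * v x) = (\<lambda>x. \<Sum>j\<in>Basis. of_real (f j) * (of_real (h x \<bullet> j) * v x))"
      proof
        fix x
        show "of_real (f (h x)) * v x = (\<Sum>j\<in>Basis. of_real (f j) * (of_real (h x \<bullet> j) * v x))"
          by (subst fw[of "h x"]) (simp add: sum_distrib_left sum_distrib_right mult_ac)
      qed
      moreover have "ann (\<lambda>x. \<Sum>j\<in>Basis. of_real (f j) * (of_real (h x \<bullet> j) * v x))"
        by (intro ann_sum ann_scale ann_basis v finite_Basis)
      ultimately show "ann (\<lambda>x. of_real (f (h x)) * v x)" by simp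
    qed
  next
    case (const c) then show ?case by (auto intro: ann_scale)
  next
    case (add f g)
    show ?case
    proof (intro allI impI)
      fix v assume "ann v"
      with add.IH ann_add show "ann (\<lambda>x. of_real (f (h x) + g (h x)) * v x)"
        unfolding of_real_add distrib_right by blast
    qed
  next
    case (mult f g) then show ?case by (simp add: mult.assoc)
  qed
  have ann_u: "ann u" using u orth by (simp add: ann_def)
  have orth_poly: "?I (\<lambda>x. u x * of_real (p (h x))) = 0" if "real_polynomial_function p" for p
  proof -
    have "?I (\<lambda>x. of_real (p (h x)) * u x * e n0 x) = 0"
      using poly[OF that, rule_format, OF ann_u] unfolding ann_def by blast
    then show ?thesis by (simp add: one mult.commute)
  qed
  have poly_cont: "continuous_on (cbox a b) (\<lambda>x. p (h x))" if "real_polynomial_function p" for p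
    using continuous_on_compose2[OF continuous_on_polymonial_function[of p UNIV] h] that
    by (simp add: real_polynomial_function_eq)
  obtain B where B: "\<And>x. x \<in> cbox a b \<Longrightarrow> norm (u x) \<le> B" "B > 0"
    using compact_imp_bounded[OF compact_continuous_image[OF u compact_cbox]]
    by (auto simp: bounded_pos)
  have small: "norm (?I (\<lambda>x. u x * cnj (u x))) \<le> \<eta>" if "\<eta> > 0" for \<eta>
  proof -
    define V where "V = measure lborel (cbox a b)"
    have V: "V \<ge> 0" by (simp add: V_def)
    define e' where "e' = \<eta> / (2 * B * (V + 1))"
    have e': "e' > 0" using that B V by (simp add: e'_def)
    have cont: "continuous_on (cbox a b) (\<lambda>x. Re (u x))" "continuous_on (cbox a b) (\<lambda>x. Im (u x))"
      by (rule continuous_on_Re[OF u], rule continuous_on_Im[OF u])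
    obtain p where p: "real_polynomial_function p" "\<And>x. x \<in> cbox a b \<Longrightarrow> \<bar>Re (u x) - p (h x)\<bar> < e'"
      by (rule polynomial_approximation_factoring[OF compact_cbox h cont(1) _ e']) (auto dest: resp)
    obtain q where q: "real_polynomial_function q" "\<And>x. x \<in> cbox a b \<Longrightarrow> \<bar>Im (u x) - q (h x)\<bar> < e'"
      by (rule polynomial_approximation_factoring[OF compact_cbox h cont(2) _ e']) (auto dest: resp)
    let ?g = "\<lambda>x. u x * (cnj (u x) - (of_real (p (h x)) - \<i> * of_real (q (h x))))"
    have int: "(\<lambda>x. u x * of_real (p (h x))) integrable_on cbox a b" "(\<lambda>x. u x * of_real (q (h x))) integrable_on cbox a b"
      "(\<lambda>x. u x * cnj (u x)) integrable_on cbox a b"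
      by (intro integrable_continuous continuous_intros u poly_cont p(1) q(1))+
    have "?g = (\<lambda>x. u x * cnj (u x) - (u x * of_real (p (h x)) - \<i> * (u x * of_real (q (h x)))))"
      by (rule ext) (simp only: right_diff_distrib mult.left_commute mult.assoc)
    then have "?I ?g = ?I (\<lambda>x. u x * cnj (u x) - (u x * of_real (p (h x)) - \<i> * (u x * of_real (q (h x)))))"
      by (rule arg_cong)
    also have "\<dots> = ?I (\<lambda>x. u x * cnj (u x))"
    proof (subst integral_diff)
      show "(\<lambda>x. u x * of_real (p (h x)) - \<i> * (u x * of_real (q (h x)))) integrable_on cbox a b"
        using int by (intro integrable_diff integrable_on_mult_right)
      show "?I (\<lambda>x. u x * cnj (u x)) - ?I (\<lambda>x. u x * of_real (p (h x)) - \<i> * (u x * of_real (q (h x)))) = ?I (\<lambda>x. u x * cnj (u x))"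
        using int orth_poly[OF p(1)] orth_poly[OF q(1)] by (subst integral_diff) (auto intro: integrable_on_mult_right)
    qed (use int in auto)
    finally have eq: "?I (\<lambda>x. u x * cnj (u x)) = ?I ?g" ..
    have "norm (?I ?g) \<le> B * (2 * e') * measure lborel (cbox a b)"
    proof (rule integrable_bound)
      show "?g integrable_on cbox a b"
        by (intro integrable_continuous continuous_intros u poly_cont p(1) q(1))
      fix x assume x: "x \<in> cbox a b"
      have "cnj (u x) - (of_real (p (h x)) - \<i> * of_real (q (h x))) = Complex (Re (u x) - p (h x)) (q (h x) - Im (u x))"
        by (simp add: complex_eq_iff)
      also have "norm \<dots> \<le> \<bar>Re (u x) - p (h x)\<bar> + \<bar>q (h x) - Im (u x)\<bar>"
        using cmod_le[of "Complex (Re (u x) - p (h x)) (q (h x) - Im (u x))"] by simp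
      also have "\<dots> \<le> 2 * e'" using p(2)[OF x] q(2)[OF x] by linarith
      finally show "norm (?g x) \<le> B * (2 * e')"
        using B x by (auto simp: norm_mult intro!: mult_mono)
    qed (use B e' in auto)
    also have "\<dots> = \<eta> * (V / (V + 1))"
    proof -
      have "V + 1 \<noteq> 0" using V by simp
      then show ?thesis using B(2) unfolding V_def[symmetric] e'_def by (simp add: divide_simps)
    qed
    also have "\<dots> \<le> \<eta> * 1" using that V by (intro mult_left_mono) auto
    finally show ?thesis unfolding eq by simp
  qed
  have "?I (\<lambda>x. u x * cnj (u x)) = 0"
  proof -
    have "norm (?I (\<lambda>x. u x * cnj (u x))) \<le> 0" by (rule dense_ge) (rule small)
    then show ?thesis by simp
  qed
  moreover have "(\<lambda>x. u x * cnj (u x)) integrable_on cbox a b"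
    by (intro integrable_continuous continuous_intros u)
  ultimately have "((\<lambda>x. u x * cnj (u x)) has_integral 0) (cbox a b)"
    by (simp add: has_integral_iff)
  from has_integral_linear[OF this bounded_linear_Re]
  have "((\<lambda>x. (cmod (u x))\<^sup>2) has_integral 0) (cbox a b)"
    by (simp add: o_def complex_mult_cnj cmod_power2)
  then have "(cmod (u x))\<^sup>2 = 0"
    using u by (intro has_integral_0_cbox_imp_0[of a b "\<lambda>x. (cmod (u x))\<^sup>2"] ne x) (auto intro!: continuous_on_power continuous_on_norm)
  then show ?thesis by simp
qed

lemma circle_fourier_uniqueness:
  fixes u :: "real \<Rightarrow> complex"
  assumes u: "continuous_on {0..2*pi} u" and per: "u 0 = u (2*pi)"
    and orth: "\<And>n::int. integral {0..2*pi} (\<lambda>x. u x * cis (of_int n * x)) = 0"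
    and x: "x \<in> {0..2*pi}"
  shows "u x = 0"
proof (rule orthogonal_to_characters_imp_zero[where a=0 and b="2*pi" and h=cis and e="\<lambda>n x. cis (of_int n * x)" and ?n0.0="0::int"])
  show "box 0 (2*pi) \<noteq> {}"
  proof -
    have "pi \<in> box 0 (2*pi)" by (simp add: box_real)
    then show ?thesis by blast
  qed
  show "\<exists>p q c d. \<forall>n x. complex_of_real (cis x \<bullet> j) * cis (of_int n * x) = c * cis (of_int (p n) * x) + d * cis (of_int (q n) * x)"
    if "j \<in> Basis" for j
  proof -
    have c: "complex_of_real (cos x) * cis (of_int n * x) = 1/2 * cis (of_int (n+1) * x) + 1/2 * cis (of_int (n-1) * x)"
      and s: "complex_of_real (sin x) * cis (of_int n * x) = -\<i>/2 * cis (of_int (n+1) * x) + \<i>/2 * cis (of_int (n-1) * x)" for n :: int and x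
      by (simp_all add: complex_eq_iff cos_add sin_add cos_diff sin_diff distrib_right left_diff_distrib field_simps)
    have "j = 1 \<or> j = \<i>" using that by (auto simp: Basis_complex_def)
    then show ?thesis
    proof
      assume "j = 1"
      then have *: "cis x \<bullet> j = cos x" for x by (simp add: inner_complex_def)
      show ?thesis unfolding * by (intro exI allI) (rule c)
    next
      assume "j = \<i>"
      then have *: "cis x \<bullet> j = sin x" for x by (simp add: inner_complex_def)
      show ?thesis unfolding * by (intro exI allI) (rule s)
    qed
  qed
  show "u x = u y" if xy: "x \<in> cbox 0 (2*pi)" "y \<in> cbox 0 (2*pi)" "cis x = cis y" for x y
  proof -
    have "sin y = sin x \<and> cos y = cos x" using xy(3) by (simp add: complex_eq_iff)
    then obtain n :: int where n: "y = x + 2 * pi * of_int n" by (metis sin_cos_eq_iff mult.commute)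
    have "\<bar>2 * pi * of_int n\<bar> \<le> 2 * pi" using xy n by auto
    then have "\<bar>real_of_int n\<bar> \<le> 1" by (simp add: abs_mult)
    then have "n = 0 \<or> n = 1 \<or> n = -1" by linarith
    then show ?thesis
    proof (elim disjE)
      assume "n = 1" then have "x = 0" "y = 2*pi" using n xy by auto
      then show ?thesis using per by simp
    next
      assume "n = -1" then have "y = 0" "x = 2*pi" using n xy by auto
      then show ?thesis using per by simp
    qed (use n in simp)
  qed
qed (use assms in \<open>auto intro!: continuous_intros\<close>)

section \<open>Theta functions and Jacobi inversion\<close>

definition sym_term :: "(int \<Rightarrow> 'a::comm_monoid_add) \<Rightarrow> nat \<Rightarrow> 'a" where
  "sym_term f m = (if m = 0 then f 0 else f (int m) + f (- int m))"

text \<open>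
  Summing symmetrically over the integers turns doubly infinite series into ordinary series, for
  which the Weierstrass M-test is available.
\<close>

lemma sum_sym_term: "(\<Sum>m<Suc M. sym_term f m) = (\<Sum>n\<in>{- int M..int M}. f n)"
proof (induction M)
  case (Suc M)
  have "{- int (Suc M)..int (Suc M)} = insert (int (Suc M)) (insert (- int (Suc M)) {- int M..int M})"
    by auto
  then have "(\<Sum>n\<in>{- int (Suc M)..int (Suc M)}. f n) = f (int (Suc M)) + (f (- int (Suc M)) + (\<Sum>n\<in>{- int M..int M}. f n))"
    by simp
  then show ?case using Suc.IH by (simp add: sym_term_def add_ac)
qed (simp add: sym_term_def)

text \<open>
  The two sides of Jacobi's formula: \<open>theta_fourier\<close> are the terms of the series
  \<open>\<Sum> exp (- w n\<^sup>2 + \<i> n x)\<close>, and \<open>theta_gauss\<close> those of the sum of Gaussians over the translates of \<open>x\<close> by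
  multiples of \<open>2 \<pi>\<close>.
\<close>

definition theta_fourier :: "complex \<Rightarrow> real \<Rightarrow> int \<Rightarrow> complex" where
  "theta_fourier w x n = exp (- w * of_int n ^ 2 + \<i> * of_int n * of_real x)"

definition theta_gauss :: "complex \<Rightarrow> real \<Rightarrow> int \<Rightarrow> complex" where
  "theta_gauss w x k = exp (- (of_real (x + 2 * pi * of_int k))\<^sup>2 / (4 * w))"

definition theta :: "complex \<Rightarrow> real \<Rightarrow> complex" where
  "theta w x = (\<Sum>m. sym_term (theta_fourier w x) m)"

definition theta_dual :: "complex \<Rightarrow> real \<Rightarrow> complex" where
  "theta_dual w x = (\<Sum>m. sym_term (theta_gauss w x) m)"

lemma norm_theta_fourier: "norm (theta_fourier w x n) = exp (- Re w * of_int n ^ 2)"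
  by (simp add: theta_fourier_def power2_eq_square)

lemma theta_fourier_eq: "theta_fourier w x n = exp (- w * of_int n ^ 2) * cis (of_int n * x)"
  by (simp add: theta_fourier_def cis_conv_exp mult.assoc flip: exp_add)

lemma norm_theta_gauss:
  "norm (theta_gauss w x k) = exp (- ((x + 2 * pi * of_int k)\<^sup>2 * Re (1 / (4 * w))))"
proof -
  have "- (of_real (x + 2 * pi * of_int k))\<^sup>2 / (4 * w) = of_real (- (x + 2 * pi * of_int k)\<^sup>2) * (1 / (4 * w))"
    by simp
  then show ?thesis unfolding theta_gauss_def norm_exp_eq_Re by (simp only: Re_complex_of_real times_complex.sel Im_complex_of_real) simp
qed

lemma norm_sym_term_le:
  assumes "\<And>n. norm (f n) \<le> g (nat \<bar>n\<bar>)" "\<And>m. g m \<ge> 0"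
  shows "norm (sym_term f m) \<le> 2 * g m"
  using assms(1)[of 0] assms(1)[of "int m"] assms(1)[of "- int m"] assms(2)[of m] norm_triangle_ineq[of "f (int m)" "f (- int m)"]
  by (auto simp: sym_term_def simp del: assms)

lemma uniform_limit_symmetric_sums:
  fixes f :: "'a \<Rightarrow> int \<Rightarrow> complex"
  assumes "\<And>p n. p \<in> A \<Longrightarrow> norm (f p n) \<le> g (nat \<bar>n\<bar>)" "\<And>m. g m \<ge> 0" "summable g"
  shows "uniform_limit A (\<lambda>M p. \<Sum>n\<in>{- int M..int M}. f p n) (\<lambda>p. \<Sum>m. sym_term (f p) m) sequentially"
proof -
  have "uniform_limit A (\<lambda>M p. \<Sum>m<M. sym_term (f p) m) (\<lambda>p. \<Sum>m. sym_term (f p) m) sequentially"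
    by (rule Weierstrass_m_test[where M="\<lambda>m. 2 * g m"]) (auto intro!: norm_sym_term_le assms summable_mult)
  from filterlim_compose[OF this filterlim_Suc] show ?thesis
    unfolding sum_sym_term by (simp add: o_def)
qed

lemma summable_exp_neg: "c > 0 \<Longrightarrow> summable (\<lambda>m. exp (- c * real m))"
  using summable_geometric[of "exp (-c)"] by (simp add: exp_of_nat_mult[symmetric] mult.commute)

lemma int_abs_le_square: "\<bar>real_of_int n\<bar> \<le> (real_of_int n)\<^sup>2"
proof (cases "n = 0")
  case False
  then have "1 \<le> \<bar>real_of_int n\<bar>" by linarith
  then have "1 * \<bar>real_of_int n\<bar> \<le> \<bar>real_of_int n\<bar> * \<bar>real_of_int n\<bar>" by (intro mult_right_mono) auto
  then show ?thesis by (simp add: power2_eq_square)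
qed simp

lemma uniform_limit_theta:
  assumes "c > 0"
  shows "uniform_limit {(w, x). c \<le> Re w} (\<lambda>M (w, x). \<Sum>n\<in>{- int M..int M}. theta_fourier w x n) (\<lambda>(w, x). theta w x) sequentially"
proof -
  have "uniform_limit {(w, x). c \<le> Re w} (\<lambda>M p. \<Sum>n\<in>{- int M..int M}. theta_fourier (fst p) (snd p) n)
     (\<lambda>p. \<Sum>m. sym_term (theta_fourier (fst p) (snd p)) m) sequentially"
  proof (rule uniform_limit_symmetric_sums[where g="\<lambda>m. exp (- c * real m)"])
    fix p :: "complex \<times> real" and n :: int assume "p \<in> {(w, x). c \<le> Re w}"
    then have "c * \<bar>real_of_int n\<bar> \<le> Re (fst p) * (real_of_int n)\<^sup>2"
      using int_abs_le_square[of n] assms by (intro mult_mono) auto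
    then show "norm (theta_fourier (fst p) (snd p) n) \<le> exp (- c * real (nat \<bar>n\<bar>))"
      by (simp add: norm_theta_fourier)
  qed (use assms summable_exp_neg in auto)
  then show ?thesis by (simp add: theta_def case_prod_unfold)
qed

text \<open>
  Uniformity is needed for \<open>w\<close> in compact parts of the right half plane and bounded \<open>x\<close>; there
  \<open>(x + 2 \<pi> k)\<^sup>2 \<ge> 2 \<pi>\<^sup>2 k\<^sup>2 - x\<^sup>2 \<ge> |k| - X\<^sup>2\<close>, so that a geometric series dominates.
\<close>

lemma uniform_limit_theta_dual:
  assumes "c > 0"
  shows "uniform_limit {(w, x). c \<le> Re (1 / (4 * w)) \<and> Re (1 / (4 * w)) \<le> c' \<and> \<bar>x\<bar> \<le> X}
    (\<lambda>M (w, x). \<Sum>n\<in>{- int M..int M}. theta_gauss w x n) (\<lambda>(w, x). theta_dual w x) sequentially"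
    (is "uniform_limit ?A _ _ _")
proof -
  have "uniform_limit ?A (\<lambda>M p. \<Sum>n\<in>{- int M..int M}. theta_gauss (fst p) (snd p) n)
     (\<lambda>p. \<Sum>m. sym_term (theta_gauss (fst p) (snd p)) m) sequentially"
  proof (rule uniform_limit_symmetric_sums[where g="\<lambda>m. exp (c' * X\<^sup>2) * exp (- c * real m)"])
    fix p :: "complex \<times> real" and k :: int assume p: "p \<in> ?A"
    define x where "x = snd p"
    define \<kappa> where "\<kappa> = Re (1 / (4 * fst p))"
    have \<kappa>: "c \<le> \<kappa>" "\<kappa> \<le> c'" "\<bar>x\<bar> \<le> X" using p by (auto simp: \<kappa>_def x_def)
    have "1 * \<bar>real_of_int k\<bar> \<le> (2 * pi\<^sup>2) * (real_of_int k)\<^sup>2"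
      using int_abs_le_square[of k] pi_ge_two power_mono[of 2 pi 2] by (intro mult_mono) auto
    moreover have "0 \<le> (2 * x + 2 * pi * of_int k)\<^sup>2 / 2" by simp
    then have "(x + 2 * pi * of_int k)\<^sup>2 \<ge> (2 * pi\<^sup>2) * (real_of_int k)\<^sup>2 - x\<^sup>2"
      by (simp add: power2_eq_square algebra_simps)
    moreover have "x\<^sup>2 \<le> X\<^sup>2" using power_mono[OF \<kappa>(3), of 2] by simp
    ultimately have "\<bar>real_of_int k\<bar> - X\<^sup>2 \<le> (x + 2 * pi * of_int k)\<^sup>2" by linarith
    then have "\<kappa> * (\<bar>real_of_int k\<bar> - X\<^sup>2) \<le> \<kappa> * (x + 2 * pi * of_int k)\<^sup>2"
      using \<kappa> assms by (intro mult_left_mono) auto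
    moreover have "c * \<bar>real_of_int k\<bar> \<le> \<kappa> * \<bar>real_of_int k\<bar>" "\<kappa> * X\<^sup>2 \<le> c' * X\<^sup>2"
      using \<kappa> by (auto intro: mult_right_mono)
    ultimately have "- ((x + 2 * pi * of_int k)\<^sup>2 * \<kappa>) \<le> c' * X\<^sup>2 + (- c * \<bar>real_of_int k\<bar>)"
      by (simp add: algebra_simps)
    then show "norm (theta_gauss (fst p) (snd p) k) \<le> exp (c' * X\<^sup>2) * exp (- c * real (nat \<bar>k\<bar>))"
      unfolding norm_theta_gauss \<kappa>_def[symmetric] x_def[symmetric] exp_add[symmetric] by simp
  qed (use assms summable_exp_neg in \<open>auto intro!: summable_mult\<close>)
  then show ?thesis by (simp add: theta_dual_def case_prod_unfold)
qed

lemma integral_uniform_limit: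
  fixes f :: "nat \<Rightarrow> real \<Rightarrow> complex"
  assumes "uniform_limit {a..b} f g sequentially" "\<And>n. continuous_on {a..b} (f n)"
  shows "(\<lambda>n. integral {a..b} (f n)) \<longlonglongrightarrow> integral {a..b} g"
proof -
  obtain I J where "\<And>n. (f n has_integral I n) {a..b}" "(g has_integral J) {a..b}" "I \<longlonglongrightarrow> J"
    using uniform_limit_integral[OF assms] by auto
  moreover have "integral {a..b} (f n) = I n" for n using calculation(1) by (rule integral_unique)
  moreover have "integral {a..b} g = J" using calculation(2) by (rule integral_unique)
  ultimately show ?thesis by simp
qed

lemma uniform_limit_mult_unit:
  fixes f :: "nat \<Rightarrow> 'a \<Rightarrow> complex"
  assumes "uniform_limit S f g F" "\<And>x. x \<in> S \<Longrightarrow> norm (h x) \<le> 1"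
  shows "uniform_limit S (\<lambda>n x. f n x * h x) (\<lambda>x. g x * h x) F"
proof (rule uniform_limitI)
  fix e :: real assume "e > 0"
  have *: "dist (f n x * h x) (g x * h x) \<le> dist (f n x) (g x) * 1" if "x \<in> S" for n x
    unfolding dist_norm left_diff_distrib[symmetric] norm_mult by (intro mult_left_mono assms that) auto
  show "\<forall>\<^sub>F n in F. \<forall>x\<in>S. dist (f n x * h x) (g x * h x) < e"
    using uniform_limitD[OF assms(1) \<open>e > 0\<close>]
  proof (rule eventually_mono)
    fix n assume "\<forall>x\<in>S. dist (f n x) (g x) < e"
    then show "\<forall>x\<in>S. dist (f n x * h x) (g x * h x) < e"
      using *[of _ n] by fastforce
  qed
qed

lemma integral_cis: "integral {0..2*pi} (\<lambda>x. cis (of_int n * x)) = (if n = 0 then 2 * pi else 0)"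
proof (cases "n = 0")
  case False
  have "((\<lambda>x. cis (of_int n * x)) has_integral (cis (of_int n * (2*pi)) / (\<i> * of_int n) - cis (of_int n * 0) / (\<i> * of_int n))) {0..2*pi}"
  proof (rule fundamental_theorem_of_calculus)
    fix x assume "x \<in> {0..2*pi}"
    have "((\<lambda>x. exp (\<i> * of_int n * x) / (\<i> * of_int n)) has_field_derivative exp (\<i> * of_int n * of_real x)) (at (of_real x))"
      using False by (auto intro!: derivative_eq_intros)
    from has_vector_derivative_real_field[OF this]
    show "((\<lambda>x. cis (of_int n * x) / (\<i> * of_int n)) has_vector_derivative cis (of_int n * x)) (at x within {0..2*pi})"
      by (simp add: cis_conv_exp mult.assoc)
  qed simp
  moreover have "cis (of_int n * (2*pi)) = 1"
    by (metis cis_multiple_2pi Ints_of_int mult.commute)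
  ultimately show ?thesis using False by (simp add: integral_unique)
qed (simp add: scaleR_conv_of_real)

text \<open>
  The characteristic function of the standard normal distribution, rescaled by \<open>sqrt (2 r)\<close>.
\<close>

lemma gaussian_fourier_integral:
  assumes r: "r > 0"
  shows "((\<lambda>y. exp (- (of_real y)\<^sup>2 / (4 * of_real r)) * cis (t * y)) has_integral
     of_real (2 * sqrt (pi * r) * exp (- r * t\<^sup>2))) UNIV"
proof -
  define s where "s = sqrt (2 * r)"
  have s: "s > 0" "s\<^sup>2 = 2 * r" using r by (auto simp: s_def)
  let ?G = "\<lambda>y::real. exp (- (of_real y)\<^sup>2 / (4 * of_real r)) * cis (t * y)"
  have G: "?G (0 + s * x) = of_real (sqrt (2 * pi)) * (std_normal_density x *\<^sub>R iexp ((t * s) * x))" for x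
  proof -
    have "- (of_real (s * x))\<^sup>2 / (4 * of_real r) = complex_of_real (- x\<^sup>2 / 2)"
      using r s(2) by (simp add: power_mult_distrib flip: of_real_power)
    then have "exp (- (of_real (s * x))\<^sup>2 / (4 * of_real r)) = complex_of_real (exp (- x\<^sup>2 / 2))"
      by (simp only: exp_of_real)
    then show ?thesis unfolding add_0
      by (simp only:) (simp add: std_normal_density_def cis_conv_exp scaleR_conv_of_real mult_ac)
  qed
  have "integrable lborel (\<lambda>x. std_normal_density x *\<^sub>R iexp ((t * s) * x))"
  proof (rule Bochner_Integration.integrable_bound[OF integrable_std_normal_moment[of 0]])
    show "AE x in lborel. norm (std_normal_density x *\<^sub>R iexp ((t * s) * x)) \<le> norm (std_normal_density x * x ^ 0)"
      by (simp add: norm_mult)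
  qed simp
  then have int0: "integrable lborel (\<lambda>x. ?G (0 + s * x))" unfolding G by (rule integrable_mult_right)
  have int: "integrable lborel ?G"
    using lborel_integrable_real_affine_iff[of s ?G 0] s int0 by simp
  have "integral\<^sup>L lborel ?G = \<bar>s\<bar> *\<^sub>R integral\<^sup>L lborel (\<lambda>x. ?G (0 + s * x))"
    using s by (intro lborel_integral_real_affine) auto
  also have "integral\<^sup>L lborel (\<lambda>x. ?G (0 + s * x)) = of_real (sqrt (2 * pi)) * char std_normal_distribution (t * s)"
    unfolding G integral_mult_right_zero char_def by (subst integral_density) (auto simp: normal_density_nonneg)
  also have "char std_normal_distribution (t * s) = of_real (exp (- ((t * s)\<^sup>2) / 2))"
    by (simp add: char_std_normal_distribution)
  also have "- ((t * s)\<^sup>2) / 2 = - r * t\<^sup>2" by (simp add: power_mult_distrib s(2))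
  also have "\<bar>s\<bar> *\<^sub>R (complex_of_real (sqrt (2 * pi)) * of_real (exp (- r * t\<^sup>2))) = of_real (2 * sqrt (pi * r) * exp (- r * t\<^sup>2))"
  proof -
    have "\<bar>s\<bar> * sqrt (2 * pi) = 2 * sqrt (pi * r)"
      using r by (simp add: s_def real_sqrt_mult)
    then show ?thesis by (simp add: scaleR_conv_of_real flip: of_real_mult mult.assoc)
  qed
  finally show ?thesis
    using has_integral_integral_lborel[OF int] by simp
qed

lemma integral_translates:
  fixes G :: "real \<Rightarrow> complex"
  assumes G: "continuous_on UNIV G"
  shows "(\<Sum>k\<in>{- int M..int M}. integral {0..2*pi} (\<lambda>x. G (x + 2 * pi * of_int k)))
     = integral {- 2 * pi * M..2 * pi * (real M + 1)} G"
proof -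
  have int: "G integrable_on {a..b}" for a b
    using continuous_on_subset[OF G] by (intro integrable_continuous_real) auto
  have shift: "integral {0..2*pi} (\<lambda>x. G (x + c)) = integral {c..2*pi+c} G" for c
    using integral_shift[of 0 c "2*pi" G] continuous_on_subset[OF G] by (simp add: o_def)
  have pos: "0 \<le> pi * real M" for M by simp
  show ?thesis
  proof (induction M)
    case 0 then show ?case by simp
  next
    case (Suc M)
    have "{- int (Suc M)..int (Suc M)} = insert (int (Suc M)) (insert (- int (Suc M)) {- int M..int M})"
      by auto
    then have "(\<Sum>k\<in>{- int (Suc M)..int (Suc M)}. integral {0..2*pi} (\<lambda>x. G (x + 2 * pi * of_int k)))
      = integral {0..2*pi} (\<lambda>x. G (x + 2 * pi * of_int (int (Suc M)))) +
       (integral {0..2*pi} (\<lambda>x. G (x + 2 * pi * of_int (- int (Suc M)))) + integral {- 2 * pi * M..2 * pi * (real M + 1)} G)"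
      using Suc.IH by simp
    also have "\<dots> = integral {2 * pi * (real M + 1)..2 * pi * (real M + 2)} G +
       (integral {- 2 * pi * (real M + 1)..- 2 * pi * M} G + integral {- 2 * pi * M..2 * pi * (real M + 1)} G)"
      unfolding shift by (simp add: algebra_simps)
    also have "integral {- 2 * pi * (real M + 1)..- 2 * pi * M} G + integral {- 2 * pi * M..2 * pi * (real M + 1)} G
      = integral {- 2 * pi * (real M + 1)..2 * pi * (real M + 1)} G"
      by (rule Henstock_Kurzweil_Integration.integral_combine[OF _ _ int]) (use pos[of M] pi_gt_zero in \<open>simp_all add: algebra_simps\<close>)
    also have "integral {2 * pi * (real M + 1)..2 * pi * (real M + 2)} G + integral {- 2 * pi * (real M + 1)..2 * pi * (real M + 1)} G
      = integral {- 2 * pi * (real M + 1)..2 * pi * (real M + 2)} G"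
      by (subst add.commute, rule Henstock_Kurzweil_Integration.integral_combine[OF _ _ int]) (use pos[of M] pi_gt_zero in \<open>simp_all add: algebra_simps\<close>)
    finally show ?case by (simp add: algebra_simps)
  qed
qed

lemma integral_UNIV_limit:
  fixes G :: "real \<Rightarrow> complex"
  assumes G: "(G has_integral J) UNIV"
  shows "(\<lambda>M::nat. integral {- 2 * pi * M..2 * pi * (real M + 1)} G) \<longlonglongrightarrow> J"
proof (rule LIMSEQ_I)
  fix e :: real assume e: "e > 0"
  have "\<not> (\<exists>a b. UNIV = cbox a (b::real))" by (metis bounded_cbox not_bounded_UNIV)
  from has_integral_altD[OF G this e] obtain B where B: "B > 0"
    "\<And>a b. ball 0 B \<subseteq> cbox a b \<Longrightarrow> \<exists>z. ((\<lambda>x. if x \<in> UNIV then G x else 0) has_integral z) (cbox a b) \<and> norm (z - J) < e"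
    by metis
  obtain N :: nat where N: "B < N" using reals_Archimedean2 by blast
  have "norm (integral {- 2 * pi * M..2 * pi * (real M + 1)} G - J) < e" if "M \<ge> N" for M :: nat
  proof -
    have M2: "1 * real M \<le> 2 * pi * M" using pi_ge_two by (intro mult_right_mono) auto
    have "ball 0 B \<subseteq> cbox (- 2 * pi * M) (2 * pi * (real M + 1))"
    proof
      fix x :: real assume "x \<in> ball 0 B"
      then have "\<bar>x\<bar> < real M" using N that by (simp add: dist_real_def)
      moreover have "2 * pi * real M \<le> 2 * pi * (real M + 1)" by (simp add: algebra_simps)
      ultimately show "x \<in> cbox (- 2 * pi * M) (2 * pi * (real M + 1))"
        using M2 by (simp only: cbox_interval atLeastAtMost_iff abs_less_iff) linarith
    qed
    from B(2)[OF this] show ?thesis by (auto simp: integral_unique)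
  qed
  then show "\<exists>no. \<forall>n\<ge>no. norm (integral {- 2 * pi * real n..2 * pi * (real n + 1)} G - J) < e" by blast
qed

text \<open>
  Poisson summation. Unfolding the sum over translates turns the Fourier coefficients of \<open>theta_dual\<close> over
  one period into Gaussian integrals over the real line. They agree with those of \<open>theta\<close>
  up to the factor \<open>sqrt (\<pi> / r)\<close>, so the difference of both sides has vanishing Fourier
  coefficients. Equality at the end points of the period holds because a shift by one period changes the
  symmetric partial sums only by two terms that tend to 0.
\<close>

lemma theta_inversion_real:
  assumes r: "r > 0" and x: "x \<in> {0..2*pi}"
  shows "theta (of_real r) x = of_real (sqrt (pi / r)) * theta_dual (of_real r) x"
proof -
  let ?w = "complex_of_real r"
  have Rew: "Re (1 / (4 * ?w)) = 1 / (4 * r)" by (metis Re_complex_of_real of_real_1 of_real_divide of_real_mult of_real_numeral)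
  have u1: "uniform_limit {0..2*pi} (\<lambda>M x. \<Sum>n\<in>{- int M..int M}. theta_fourier ?w x n) (theta ?w) sequentially"
    using uniform_limit_compose'[OF uniform_limit_theta[OF r], of "Pair ?w" "{0..2*pi}"] by (simp add: Pi_iff)
  have u2: "uniform_limit {0..2*pi} (\<lambda>M x. \<Sum>n\<in>{- int M..int M}. theta_gauss ?w x n) (theta_dual ?w) sequentially"
    using uniform_limit_compose'[OF uniform_limit_theta_dual[of "1 / (4*r)" "1 / (4*r)" "2*pi"], of "Pair ?w" "{0..2*pi}"] r
    by (simp add: Pi_iff Rew)
  have cont_f: "continuous_on A (\<lambda>x. theta_fourier ?w x n)" for n A
    unfolding theta_fourier_def by (intro continuous_intros)
  have cont_g: "continuous_on A (\<lambda>x. theta_gauss ?w x n)" for n A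
    unfolding theta_gauss_def using r by (intro continuous_intros) auto
  have ct: "continuous_on {0..2*pi} (theta ?w)"
    by (rule uniform_limit_theorem[OF _ u1]) (intro always_eventually allI continuous_on_sum cont_f, simp)
  have cd: "continuous_on {0..2*pi} (theta_dual ?w)"
    by (rule uniform_limit_theorem[OF _ u2]) (intro always_eventually allI continuous_on_sum cont_g, simp)
  have cis_int: "continuous_on A (\<lambda>x. cis (of_int n * x))" for n A by (intro continuous_intros)
  have It: "integral {0..2*pi} (\<lambda>x. theta ?w x * cis (of_int m * x)) = of_real (2 * pi * exp (- r * of_int m ^ 2))" for m
  proof -
    let ?f = "\<lambda>M x. (\<Sum>n\<in>{- int M..int M}. theta_fourier ?w x n) * cis (of_int m * x)"
    have "(\<lambda>M. integral {0..2*pi} (?f M)) \<longlonglongrightarrow> integral {0..2*pi} (\<lambda>x. theta ?w x * cis (of_int m * x))"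
      by (rule integral_uniform_limit[OF uniform_limit_mult_unit[OF u1]])
        (auto intro!: continuous_on_mult continuous_on_sum cont_f cis_int)
    moreover have "\<forall>\<^sub>F M in sequentially. integral {0..2*pi} (?f M) = of_real (2 * pi * exp (- r * of_int m ^ 2))"
      using eventually_ge_at_top[of "nat \<bar>m\<bar>"]
    proof (rule eventually_mono)
      fix M assume M: "nat \<bar>m\<bar> \<le> M"
      have "integral {0..2*pi} (?f M) = integral {0..2*pi} (\<lambda>x. \<Sum>n\<in>{- int M..int M}. of_real (exp (- r * of_int n ^ 2)) * cis (of_int (n + m) * x))"
      proof (rule integral_cong)
        fix x
        have "exp (- complex_of_real r * of_int n ^ 2) = of_real (exp (- r * of_int n ^ 2))" for n
        proof -
          have "- complex_of_real r * of_int n ^ 2 = of_real (- r * of_int n ^ 2)" by simp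
          then show ?thesis by (simp only: exp_of_real)
        qed
        then show "?f M x = (\<Sum>n\<in>{- int M..int M}. of_real (exp (- r * of_int n ^ 2)) * cis (of_int (n + m) * x))"
          unfolding sum_distrib_right theta_fourier_eq by (simp add: mult.assoc cis_mult distrib_right)
      qed
      also have "\<dots> = (\<Sum>n\<in>{- int M..int M}. of_real (exp (- r * of_int n ^ 2)) * integral {0..2*pi} (\<lambda>x. cis (of_int (n + m) * x)))"
        unfolding integral_mult_right[symmetric]
        by (rule integral_sum) (simp, intro integrable_continuous_real continuous_on_mult cis_int continuous_on_const)
      also have "\<dots> = (\<Sum>n\<in>{- int M..int M}. if n = - m then of_real (2 * pi * exp (- r * of_int m ^ 2)) else 0)"
        unfolding integral_cis by (intro sum.cong) auto
      also have "\<dots> = of_real (2 * pi * exp (- r * of_int m ^ 2))"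
        using M by (subst sum.delta) auto
      finally show "integral {0..2*pi} (?f M) = of_real (2 * pi * exp (- r * of_int m ^ 2))" .
    qed
    ultimately show ?thesis using LIMSEQ_unique[OF _ tendsto_eventually] by blast
  qed
  have Id: "integral {0..2*pi} (\<lambda>x. theta_dual ?w x * cis (of_int m * x)) = of_real (2 * sqrt (pi * r) * exp (- r * of_int m ^ 2))" for m
  proof -
    let ?f = "\<lambda>M x. (\<Sum>n\<in>{- int M..int M}. theta_gauss ?w x n) * cis (of_int m * x)"
    let ?G = "\<lambda>y::real. exp (- (of_real y)\<^sup>2 / (4 * ?w)) * cis (of_int m * y)"
    have cG: "continuous_on A ?G" for A using r by (intro continuous_intros) auto
    have "cis (of_int m * (x + 2 * pi * of_int k)) = cis (of_int m * x)" for x and k :: int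
    proof -
      have "cis (of_int m * (x + 2 * pi * of_int k)) = cis (of_int m * x) * cis (2 * pi * of_int (m * k))"
        by (simp add: cis_mult algebra_simps)
      then show ?thesis by (simp add: cis_multiple_2pi)
    qed
    then have "integral {0..2*pi} (?f M) = integral {0..2*pi} (\<lambda>x. \<Sum>k\<in>{- int M..int M}. ?G (x + 2 * pi * of_int k))" for M
      by (simp add: sum_distrib_right theta_gauss_def)
    also have "\<dots>M = (\<Sum>k\<in>{- int M..int M}. integral {0..2*pi} (\<lambda>x. ?G (x + 2 * pi * of_int k)))" for M
      by (rule integral_sum)
        (simp, rule integrable_continuous_real, rule continuous_on_compose2[OF cG[of UNIV]], auto intro!: continuous_on_add continuous_on_id continuous_on_const)
    also have "\<dots>M = integral {- 2 * pi * M..2 * pi * (real M + 1)} ?G" for M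
      by (rule integral_translates[OF cG])
    finally have eq: "integral {0..2*pi} (?f M) = integral {- 2 * pi * M..2 * pi * (real M + 1)} ?G" for M .
    have "(\<lambda>M. integral {0..2*pi} (?f M)) \<longlonglongrightarrow> integral {0..2*pi} (\<lambda>x. theta_dual ?w x * cis (of_int m * x))"
      by (rule integral_uniform_limit[OF uniform_limit_mult_unit[OF u2]])
        (auto intro!: continuous_on_mult continuous_on_sum cont_g cis_int)
    moreover have "(\<lambda>M. integral {0..2*pi} (?f M)) \<longlonglongrightarrow> of_real (2 * sqrt (pi * r) * exp (- r * of_int m ^ 2))"
      unfolding eq by (rule integral_UNIV_limit[OF gaussian_fourier_integral[OF r]])
    ultimately show ?thesis by (rule LIMSEQ_unique)
  qed
  define u where "u x = theta ?w x - of_real (sqrt (pi / r)) * theta_dual ?w x" for x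
  have "u x = 0"
  proof (rule circle_fourier_uniqueness[OF _ _ _ x])
    show "continuous_on {0..2*pi} u" unfolding u_def by (intro continuous_intros ct cd)
    show "integral {0..2*pi} (\<lambda>x. u x * cis (of_int n * x)) = 0" for n
    proof -
      have "integral {0..2*pi} (\<lambda>x. u x * cis (of_int n * x)) =
        integral {0..2*pi} (\<lambda>x. theta ?w x * cis (of_int n * x) - of_real (sqrt (pi / r)) * (theta_dual ?w x * cis (of_int n * x)))"
        by (simp add: u_def left_diff_distrib mult.assoc)
      also have "\<dots> = of_real (2 * pi * exp (- r * of_int n ^ 2)) - of_real (sqrt (pi / r)) * of_real (2 * sqrt (pi * r) * exp (- r * of_int n ^ 2))"
        using It[of n] Id[of n]
        by (subst integral_diff) (auto intro!: integrable_continuous_real continuous_on_mult continuous_on_const cis_int ct cd)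
      also have "sqrt (pi / r) * (2 * sqrt (pi * r)) = 2 * pi"
        using r by (simp add: real_sqrt_mult real_sqrt_divide)
      then have "of_real (2 * pi * exp (- r * of_int n ^ 2)) - of_real (sqrt (pi / r)) * complex_of_real (2 * sqrt (pi * r) * exp (- r * of_int n ^ 2)) = 0"
        by (metis (no_types, lifting) diff_self mult.assoc of_real_mult)
      finally show ?thesis .
    qed
    show "u 0 = u (2*pi)"
    proof -
      have per: "theta_fourier ?w (2*pi) n = theta_fourier ?w 0 n" for n
      proof -
        have "cis (of_int n * (2*pi)) = 1" by (metis cis_multiple_2pi Ints_of_int mult.commute)
        then show ?thesis by (simp only: theta_fourier_eq) simp
      qed
      have "theta ?w (2*pi) = theta ?w 0" unfolding theta_def per[abs_def] by (simp add: per sym_term_def)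
      moreover have "theta_dual ?w (2*pi) = theta_dual ?w 0"
      proof -
        have "(\<Sum>n\<in>{- int M..int M}. theta_gauss ?w (2*pi) n) = (\<Sum>n\<in>{- int M..int M}. theta_gauss ?w 0 (n + 1))" for M
          by (simp add: theta_gauss_def algebra_simps)
        also have "\<dots>M = (\<Sum>n\<in>{- int M..int M}. theta_gauss ?w 0 n) + theta_gauss ?w 0 (int (Suc M)) - theta_gauss ?w 0 (- int M)" for M
        proof (induction M)
          case (Suc M)
          have *: "{- int (Suc M)..int (Suc M)} = insert (int (Suc M)) (insert (- int (Suc M)) {- int M..int M})" by auto
          show ?case unfolding * using Suc.IH by (simp add: algebra_simps)
        qed simp
        finally have eq: "(\<Sum>n\<in>{- int M..int M}. theta_gauss ?w (2*pi) n) = (\<Sum>n\<in>{- int M..int M}. theta_gauss ?w 0 n) + theta_gauss ?w 0 (int (Suc M)) - theta_gauss ?w 0 (- int M)" for M .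
        have z: "(\<lambda>M. theta_gauss ?w 0 (s * int M)) \<longlonglongrightarrow> 0" if "\<bar>s\<bar> = 1" for s :: int
        proof (rule Lim_null_comparison[where g="\<lambda>M. exp (- (1/(4*r)) * real M)"])
          show "\<forall>\<^sub>F M in sequentially. norm (theta_gauss ?w 0 (s * int M)) \<le> exp (- (1/(4*r)) * real M)"
          proof (rule always_eventually, rule allI)
            fix M
            have "s * s = 1" using that by (metis abs_mult_self_eq mult_1)
            then have "(real_of_int s)\<^sup>2 = 1" by (metis of_int_1 of_int_mult power2_eq_square)
            then have "(0 + 2 * pi * of_int (s * int M))\<^sup>2 = (4 * pi\<^sup>2) * (real M)\<^sup>2" by (simp add: power_mult_distrib)
            moreover have "1 * real M \<le> (4 * pi\<^sup>2) * (real M)\<^sup>2"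
              using int_abs_le_square[of "int M"] pi_ge_two power_mono[of 2 pi 2] by (intro mult_mono) auto
            ultimately have "real M \<le> (0 + 2 * pi * of_int (s * int M))\<^sup>2" by simp
            then show "norm (theta_gauss ?w 0 (s * int M)) \<le> exp (- (1/(4*r)) * real M)"
              unfolding norm_theta_gauss Rew using r by (simp add: divide_right_mono)
          qed
          show "(\<lambda>M. exp (- (1/(4*r)) * real M)) \<longlonglongrightarrow> 0"
            using r by (intro summable_LIMSEQ_zero summable_exp_neg) simp
        qed
        have lim: "(\<lambda>M. \<Sum>n\<in>{- int M..int M}. theta_gauss ?w y n) \<longlonglongrightarrow> theta_dual ?w y" if "y \<in> {0..2*pi}" for y
          using tendsto_uniform_limitI[OF u2 that] .
        have "(\<lambda>M. (\<Sum>n\<in>{- int M..int M}. theta_gauss ?w 0 n) + theta_gauss ?w 0 (int (Suc M)) - theta_gauss ?w 0 (- int M)) \<longlonglongrightarrow> theta_dual ?w 0 + 0 - 0"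
          using z[of 1] z[of "-1"] lim[of 0] by (intro tendsto_intros) (auto dest: LIMSEQ_Suc)
        then show ?thesis using lim[of "2*pi"] unfolding eq by (simp add: LIMSEQ_unique)
      qed
      ultimately show ?thesis by (simp add: u_def)
    qed
  qed
  then show ?thesis by (simp add: u_def)
qed

lemma compact_right_half_plane_bounds:
  fixes K :: "complex set"
  assumes "compact K" "\<And>w. w \<in> K \<Longrightarrow> Re w > 0"
  obtains c c' where "c > 0" "\<And>w. w \<in> K \<Longrightarrow> c \<le> Re w" "\<And>w. w \<in> K \<Longrightarrow> c \<le> Re (1 / (4 * w))"
    "\<And>w. w \<in> K \<Longrightarrow> Re (1 / (4 * w)) \<le> c'"
proof (cases "K = {}")
  case True then show ?thesis using that[of 1 1] by simp
next
  case False
  have pos: "Re (1 / (4 * w)) > 0" if "w \<in> K" for w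
  proof -
    have "Re (1 / (4 * w)) = (4 * Re w) / ((4 * Re w)\<^sup>2 + (4 * Im w)\<^sup>2)"
      by (simp add: Re_divide)
    moreover have "(4 * Re w)\<^sup>2 + (4 * Im w)\<^sup>2 > 0"
      using assms(2)[OF that] by (intro add_pos_nonneg) auto
    ultimately show ?thesis using assms(2)[OF that] by (simp only: zero_less_divide_iff) simp
  qed
  have c1: "continuous_on K Re" by (intro continuous_intros)
  have c2: "continuous_on K (\<lambda>w. Re (1 / (4 * w)))" using assms(2) by (intro continuous_intros) force
  obtain a where a: "a \<in> K" "\<And>w. w \<in> K \<Longrightarrow> Re a \<le> Re w"
    using continuous_attains_inf[OF assms(1) False c1] by blast
  obtain b where b: "b \<in> K" "\<And>w. w \<in> K \<Longrightarrow> Re (1 / (4 * b)) \<le> Re (1 / (4 * w))"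
    using continuous_attains_inf[OF assms(1) False c2] by blast
  obtain d where d: "d \<in> K" "\<And>w. w \<in> K \<Longrightarrow> Re (1 / (4 * w)) \<le> Re (1 / (4 * d))"
    using continuous_attains_sup[OF assms(1) False c2] by blast
  show ?thesis
  proof (rule that[of "min (Re a) (Re (1 / (4 * b)))" "Re (1 / (4 * d))"])
    show "min (Re a) (Re (1 / (4 * b))) > 0" using pos[OF b(1)] assms(2)[OF a(1)] by simp
  qed (use a b d in \<open>auto intro: min.coboundedI1 min.coboundedI2\<close>)
qed

lemma uniform_limit_theta_compact:
  assumes "compact K" "\<And>w. w \<in> K \<Longrightarrow> Re w > 0"
  shows "uniform_limit K (\<lambda>M w. \<Sum>n\<in>{- int M..int M}. theta_fourier w x n) (\<lambda>w. theta w x) sequentially"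
    and "uniform_limit K (\<lambda>M w. \<Sum>n\<in>{- int M..int M}. theta_gauss w x n) (\<lambda>w. theta_dual w x) sequentially"
proof -
  obtain c c' where c: "c > 0" "\<And>w. w \<in> K \<Longrightarrow> c \<le> Re w" "\<And>w. w \<in> K \<Longrightarrow> c \<le> Re (1 / (4 * w))"
    "\<And>w. w \<in> K \<Longrightarrow> Re (1 / (4 * w)) \<le> c'"
    using compact_right_half_plane_bounds[OF assms] by blast
  show "uniform_limit K (\<lambda>M w. \<Sum>n\<in>{- int M..int M}. theta_fourier w x n) (\<lambda>w. theta w x) sequentially"
    using uniform_limit_compose'[OF uniform_limit_theta[OF c(1)], of "\<lambda>w. (w, x)" K] c by (simp add: Pi_iff)
  show "uniform_limit K (\<lambda>M w. \<Sum>n\<in>{- int M..int M}. theta_gauss w x n) (\<lambda>w. theta_dual w x) sequentially"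
    using uniform_limit_compose'[OF uniform_limit_theta_dual[OF c(1)], of "\<lambda>w. (w, x)" K c' "\<bar>x\<bar>"] c by (simp add: Pi_iff)
qed

text \<open>
  Both sides are holomorphic in \<open>w\<close> on the right half plane, and they agree on the positive real axis.
\<close>

theorem theta_inversion:
  assumes w: "Re w > 0" and x: "x \<in> {0..2*pi}"
  shows "theta w x = csqrt (of_real pi / w) * theta_dual w x"
proof -
  define S where "S = {w::complex. Re w > 0}"
  have S: "open S" "connected S"
    unfolding S_def by (auto simp: open_halfspace_Re_gt intro: convex_connected convex_halfspace_Re_gt)
  have nz: "z \<noteq> 0" if "z \<in> S" for z using that by (auto simp: S_def)
  have ball: "\<exists>d. 0 < d \<and> cball z d \<subseteq> S" if "z \<in> S" for z
    using S(1) that open_contains_cball by blast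
  have h1: "(\<lambda>w. theta w x) holomorphic_on S"
  proof (rule holomorphic_uniform_sequence[OF S(1)])
    show "(\<lambda>w. \<Sum>n\<in>{- int M..int M}. theta_fourier w x n) holomorphic_on S" for M
      unfolding theta_fourier_def by (intro holomorphic_intros)
    fix z assume "z \<in> S"
    then obtain d where d: "0 < d" "cball z d \<subseteq> S" using ball by blast
    have "uniform_limit (cball z d) (\<lambda>M w. \<Sum>n\<in>{- int M..int M}. theta_fourier w x n) (\<lambda>w. theta w x) sequentially"
      using d(2) by (intro uniform_limit_theta_compact) (auto simp: S_def)
    with d show "\<exists>d>0. cball z d \<subseteq> S \<and> uniform_limit (cball z d) (\<lambda>M w. \<Sum>n\<in>{- int M..int M}. theta_fourier w x n) (\<lambda>w. theta w x) sequentially"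
      by blast
  qed
  have h2: "(\<lambda>w. theta_dual w x) holomorphic_on S"
  proof (rule holomorphic_uniform_sequence[OF S(1)])
    show "(\<lambda>w. \<Sum>n\<in>{- int M..int M}. theta_gauss w x n) holomorphic_on S" for M
      unfolding theta_gauss_def using nz by (intro holomorphic_intros) auto
    fix z assume "z \<in> S"
    then obtain d where d: "0 < d" "cball z d \<subseteq> S" using ball by blast
    have "uniform_limit (cball z d) (\<lambda>M w. \<Sum>n\<in>{- int M..int M}. theta_gauss w x n) (\<lambda>w. theta_dual w x) sequentially"
      using d(2) by (intro uniform_limit_theta_compact) (auto simp: S_def)
    with d show "\<exists>d>0. cball z d \<subseteq> S \<and> uniform_limit (cball z d) (\<lambda>M w. \<Sum>n\<in>{- int M..int M}. theta_gauss w x n) (\<lambda>w. theta_dual w x) sequentially"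
      by blast
  qed
  have h3: "(\<lambda>w. csqrt (of_real pi / w)) holomorphic_on S"
  proof -
    have "of_real pi / z \<notin> \<real>\<^sub>\<le>\<^sub>0" if "z \<in> S" for z :: complex
    proof -
      have "Re (of_real pi / z) = pi * Re z / (cmod z)\<^sup>2"
        by (simp add: Re_divide cmod_power2)
      moreover have "pi * Re z / (cmod z)\<^sup>2 > 0"
        using that nz[OF that] by (auto simp: S_def intro!: divide_pos_pos mult_pos_pos)
      ultimately show ?thesis by (auto simp: complex_nonpos_Reals_iff)
    qed
    then show ?thesis using nz by (intro holomorphic_intros) auto
  qed
  have lim: "1 islimpt (complex_of_real ` {0<..})"
  proof (subst islimpt_approachable, intro allI impI)
    fix e :: real assume "e > 0"
    have "1 + e/2 \<in> {0<..}" using \<open>e > 0\<close> by simp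
    then have 1: "complex_of_real (1 + e/2) \<in> complex_of_real ` {0<..}" by (rule imageI)
    have "dist (complex_of_real (1 + e/2)) (complex_of_real 1) = e/2"
      using \<open>e > 0\<close> by (simp only: dist_of_real) (simp add: dist_real_def)
    then have "complex_of_real (1 + e/2) \<noteq> 1" "dist (complex_of_real (1 + e/2)) 1 < e"
      using \<open>e > 0\<close> by (simp_all only: of_real_1) auto
    with 1 show "\<exists>x'\<in>complex_of_real ` {0<..}. x' \<noteq> 1 \<and> dist x' 1 < e" by blast
  qed
  have "theta w x - csqrt (of_real pi / w) * theta_dual w x = 0"
  proof (rule analytic_continuation[of "\<lambda>w. theta w x - csqrt (of_real pi / w) * theta_dual w x", OF _ S _ _ lim])
    show "(\<lambda>w. theta w x - csqrt (of_real pi / w) * theta_dual w x) holomorphic_on S"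
      by (intro holomorphic_intros h1 h2 h3)
    fix z assume "z \<in> complex_of_real ` {0<..}"
    then obtain r where r: "z = of_real r" "r > 0" by auto
    have "csqrt (of_real pi / of_real r) = of_real (sqrt (pi / r))"
    proof -
      have "complex_of_real pi / of_real r = of_real (pi / r)" by simp
      then show ?thesis using r csqrt_of_real_nonneg[of "of_real (pi / r)"] by simp
    qed
    then show "theta z x - csqrt (of_real pi / z) * theta_dual z x = 0"
      using theta_inversion_real[OF r(2) x] r by simp
  qed (use w in \<open>auto simp: S_def\<close>)
  then show ?thesis by simp
qed

lemma theta_periodic: "theta w (x + 2 * pi * of_int j) = theta w x"
proof -
  have "cis (of_int n * (x + 2 * pi * of_int j)) = cis (of_int n * x)" for n
  proof -
    have "cis (of_int n * (x + 2 * pi * of_int j)) = cis (of_int n * x) * cis (2 * pi * of_int (n * j))"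
      by (simp add: cis_mult algebra_simps)
    then show ?thesis by (simp add: cis_multiple_2pi)
  qed
  then have "theta_fourier w (x + 2 * pi * of_int j) = theta_fourier w x"
    unfolding theta_fourier_eq fun_eq_iff by simp
  then show ?thesis by (simp add: theta_def)
qed

section \<open>Gaussian sums\<close>

text \<open>
  Comparison with \<open>\<integral> 1 / (1 + s x\<^sup>2) dx\<close>: by the mean value theorem each term is at most an increment of
  \<open>arctan (sqrt s * x) / sqrt s\<close>, and the increments telescope.
\<close>

lemma sum_inverse_squares_le:
  assumes s: "s > 0"
  shows "(\<Sum>m=1..M. 1 / (1 + s * (real m)\<^sup>2)) \<le> 2 / sqrt s"
proof -
  have step: "1 / (1 + s * (real (Suc m))\<^sup>2) \<le> (arctan (sqrt s * real (Suc m)) - arctan (sqrt s * real m)) / sqrt s" for m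
  proof -
    have "sqrt s * real m < sqrt s * real (Suc m)" using s by simp
    from MVT2[OF this, of arctan "\<lambda>x. inverse (1 + x\<^sup>2)"]
    obtain z where z: "sqrt s * real m < z" "z < sqrt s * real (Suc m)"
      "arctan (sqrt s * real (Suc m)) - arctan (sqrt s * real m) = (sqrt s * real (Suc m) - sqrt s * real m) * inverse (1 + z\<^sup>2)"
      using DERIV_arctan by blast
    have "0 \<le> z" using z(1) s by (smt (verit) mult_nonneg_nonneg of_nat_0_le_iff real_sqrt_ge_zero)
    then have "z\<^sup>2 \<le> (sqrt s * real (Suc m))\<^sup>2" using z(2) by (intro power_mono) auto
    then have "z\<^sup>2 \<le> s * (real (Suc m))\<^sup>2" using s by (simp add: power_mult_distrib)
    then have "1 / (1 + s * (real (Suc m))\<^sup>2) \<le> 1 / (1 + z\<^sup>2)"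
      by (intro divide_left_mono mult_pos_pos add_pos_nonneg mult_nonneg_nonneg) (use s in auto)
    also have "\<dots> = (arctan (sqrt s * real (Suc m)) - arctan (sqrt s * real m)) / sqrt s"
    proof -
      have "sqrt s * real (Suc m) - sqrt s * real m = sqrt s" by (simp add: algebra_simps)
      then show ?thesis unfolding z(3) using s by (simp add: inverse_eq_divide)
    qed
    finally show ?thesis .
  qed
  have "(\<Sum>m=1..M. 1 / (1 + s * (real m)\<^sup>2)) \<le> arctan (sqrt s * real M) / sqrt s"
  proof (induction M)
    case (Suc M)
    have "(\<Sum>m=1..Suc M. 1 / (1 + s * (real m)\<^sup>2)) \<le> arctan (sqrt s * real M) / sqrt s + 1 / (1 + s * (real (Suc M))\<^sup>2)"
      using Suc.IH by simp
    also have "\<dots> \<le> arctan (sqrt s * real (Suc M)) / sqrt s"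
      using step[of M] by (simp add: diff_divide_distrib)
    finally show ?case .
  qed simp
  also have "\<dots> \<le> 2 / sqrt s"
    using arctan_ubound[of "sqrt s * real M"] pi_less_4 s by (intro divide_right_mono) auto
  finally show ?thesis .
qed

lemma sum_exp_squares_le:
  assumes s: "s > 0"
  shows "(\<Sum>m=1..M. exp (- s * (real m)\<^sup>2)) \<le> 2 / sqrt s"
proof -
  have "exp (- s * (real m)\<^sup>2) \<le> 1 / (1 + s * (real m)\<^sup>2)" for m
  proof -
    have "1 + s * (real m)\<^sup>2 \<le> exp (s * (real m)\<^sup>2)" by (rule exp_ge_add_one_self)
    moreover have "1 + s * (real m)\<^sup>2 > 0" using s by (intro add_pos_nonneg) auto
    ultimately have "1 / exp (s * (real m)\<^sup>2) \<le> 1 / (1 + s * (real m)\<^sup>2)"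
      by (intro divide_left_mono) auto
    then show ?thesis by (simp add: exp_minus inverse_eq_divide)
  qed
  then have "(\<Sum>m=1..M. exp (- s * (real m)\<^sup>2)) \<le> (\<Sum>m=1..M. 1 / (1 + s * (real m)\<^sup>2))" by (rule sum_mono)
  with sum_inverse_squares_le[OF s, of M] show ?thesis by linarith
qed

lemma sum_exp_int_squares_le:
  assumes s: "s > 0"
  shows "(\<Sum>n\<in>{- int M..int M}. exp (- s * (real_of_int n)\<^sup>2)) \<le> 1 + 4 / sqrt s"
proof -
  have "(\<Sum>n\<in>{- int M..int M}. exp (- s * (real_of_int n)\<^sup>2)) = (\<Sum>m<Suc M. sym_term (\<lambda>n. exp (- s * (real_of_int n)\<^sup>2)) m)"
    by (simp only: sum_sym_term)
  also have "\<dots> = 1 + 2 * (\<Sum>m=1..M. exp (- s * (real m)\<^sup>2))"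
  proof (induction M)
    case (Suc M)
    have "sym_term (\<lambda>n. exp (- s * (real_of_int n)\<^sup>2)) (Suc M) = 2 * exp (- s * (real (Suc M))\<^sup>2)"
      by (simp add: sym_term_def power2_eq_square algebra_simps)
    then show ?case using Suc.IH by (simp only: sum.lessThan_Suc[of _ "Suc M"]) simp
  qed (simp add: sym_term_def)
  finally show ?thesis using sum_exp_squares_le[OF s, of M] by simp
qed

text \<open>
  For \<open>x\<close> in one period, \<open>|x + 2 \<pi> k| \<ge> |k|\<close> for every \<open>k\<close> except \<open>k = -1\<close>, whose term is at most 1.
\<close>

lemma sum_shifted_gaussians_le:
  assumes s: "s > 0" and x: "x \<in> {0..2*pi}"
  shows "(\<Sum>k\<in>{- int M..int M}. exp (- s * (x + 2 * pi * of_int k)\<^sup>2)) \<le> 2 + 4 / sqrt s"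
proof -
  have pointwise: "exp (- s * (x + 2 * pi * of_int k)\<^sup>2) \<le> exp (- s * (real_of_int k)\<^sup>2) + (if k = -1 then 1 else 0)" for k :: int
  proof (cases "k = -1")
    case True then show ?thesis using s by (simp add: add_increasing)
  next
    case False
    have "\<bar>real_of_int k\<bar> \<le> \<bar>x + 2 * pi * of_int k\<bar>"
    proof (cases "k \<ge> 0")
      case True
      have "1 * real_of_int k \<le> 2 * pi * of_int k" using True pi_ge_two by (intro mult_right_mono) auto
      then show ?thesis using x True by simp
    next
      case False
      then have k: "real_of_int (k + 1) \<le> -1" using \<open>k \<noteq> -1\<close> by linarith
      have "x + 2 * pi * of_int k \<le> 2 * pi * of_int (k + 1)" using x by (simp add: algebra_simps)
      also have "\<dots> \<le> 4 * of_int (k + 1)" using k pi_ge_two by (intro mult_right_mono_neg) auto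
      also have "\<dots> \<le> real_of_int k" using k by simp
      finally show ?thesis using k by simp
    qed
    then have "(real_of_int k)\<^sup>2 \<le> (x + 2 * pi * of_int k)\<^sup>2" by (simp add: abs_le_square_iff)
    then show ?thesis using s False by simp
  qed
  have "(\<Sum>k\<in>{- int M..int M}. exp (- s * (x + 2 * pi * of_int k)\<^sup>2))
     \<le> (\<Sum>k\<in>{- int M..int M}. exp (- s * (real_of_int k)\<^sup>2) + (if k = -1 then 1 else 0))"
    by (intro sum_mono pointwise)
  also have "\<dots> \<le> (1 + 4 / sqrt s) + 1"
    unfolding sum.distrib by (intro add_mono sum_exp_int_squares_le s) (simp add: sum.delta)
  finally show ?thesis by simp
qed

section \<open>Oscillatory integrals\<close>

text \<open>
  The first derivative test of van der Corput: integrate by parts against \<open>1 / \<psi>'\<close>. Since \<open>\<psi>'\<close> is monotone,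
  the total variation of \<open>1 / \<psi>'\<close> is at most \<open>2 / \<mu>\<close>.
\<close>

lemma nonstationary_phase:
  fixes \<psi> \<psi>' \<psi>'' :: "real \<Rightarrow> real"
  assumes ab: "a \<le> b" and \<mu>: "\<mu> > 0"
    and d1: "\<And>t. t \<in> {a..b} \<Longrightarrow> (\<psi> has_real_derivative \<psi>' t) (at t)"
    and d2: "\<And>t. t \<in> {a..b} \<Longrightarrow> (\<psi>' has_real_derivative \<psi>'' t) (at t)"
    and convex: "\<And>t. t \<in> {a..b} \<Longrightarrow> \<psi>'' t \<ge> 0"
    and large: "\<And>t. t \<in> {a..b} \<Longrightarrow> \<mu> \<le> \<bar>\<psi>' t\<bar>"
  shows "norm (integral {a..b} (\<lambda>t. cis (- \<psi> t))) \<le> 4 / \<mu>"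
proof -
  have nz: "\<psi>' t \<noteq> 0" if "t \<in> {a..b}" for t using large[OF that] \<mu> by auto
  define G where "G t = \<i> * cis (- \<psi> t) * of_real (1 / \<psi>' t)" for t
  define R where "R t = \<i> * cis (- \<psi> t) * of_real (\<psi>'' t / (\<psi>' t)\<^sup>2)" for t
  have dG: "(G has_vector_derivative (cis (- \<psi> t) - R t)) (at t within {a..b})" if t: "t \<in> {a..b}" for t
  proof -
    have 1: "((\<lambda>t. cis (- \<psi> t)) has_vector_derivative (- \<psi>' t) *\<^sub>R (\<i> * cis (- \<psi> t))) (at t within {a..b})"
    proof -
      have "((\<lambda>t. - \<psi> t) has_vector_derivative - \<psi>' t) (at t within {a..b})"
        using d1[OF t] by (auto intro!: derivative_eq_intros simp: has_real_derivative_iff_has_vector_derivative[symmetric] intro: DERIV_subset)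
      moreover have "(cis has_vector_derivative \<i> * cis (- \<psi> t)) (at (- \<psi> t))"
        unfolding cis_conv_exp by (rule has_vector_derivative_real_field[where f="\<lambda>z. exp (\<i> * z)"]) (auto intro!: derivative_eq_intros)
      ultimately show ?thesis
        using vector_diff_chain_within[of "\<lambda>t. - \<psi> t" "- \<psi>' t" t "{a..b}" cis "\<i> * cis (- \<psi> t)"]
        by (simp add: o_def has_vector_derivative_at_within)
    qed
    have 2: "((\<lambda>t. complex_of_real (1 / \<psi>' t)) has_vector_derivative of_real (- \<psi>'' t / (\<psi>' t)\<^sup>2)) (at t within {a..b})"
    proof (rule has_vector_derivative_of_real)
      show "((\<lambda>t. 1 / \<psi>' t) has_real_derivative (- \<psi>'' t / (\<psi>' t)\<^sup>2)) (at t within {a..b})"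
        by (rule DERIV_subset[OF _ subset_UNIV]) (use d2[OF t] nz[OF t] in \<open>auto intro!: derivative_eq_intros simp: power2_eq_square\<close>)
    qed
    show ?thesis unfolding G_def R_def
      using has_vector_derivative_mult[OF has_vector_derivative_mult_right[OF 1, of \<i>] 2] nz[OF t]
      by (simp add: scaleR_conv_of_real mult_ac)
  qed
  have "((\<lambda>t. cis (- \<psi> t) - R t) has_integral (G b - G a)) {a..b}"
    by (rule fundamental_theorem_of_calculus[OF ab dG])
  moreover have cis_int: "(\<lambda>t. cis (- \<psi> t)) integrable_on {a..b}"
  proof (rule integrable_continuous_real)
    have "continuous_on {a..b} \<psi>"
      using DERIV_isCont[OF d1] by (intro continuous_at_imp_continuous_on) blast
    then show "continuous_on {a..b} (\<lambda>t. cis (- \<psi> t))" by (intro continuous_intros)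
  qed
  ultimately have Rint: "R integrable_on {a..b}" and eq: "integral {a..b} (\<lambda>t. cis (- \<psi> t)) = G b - G a + integral {a..b} R"
  proof -
    assume h: "((\<lambda>t. cis (- \<psi> t) - R t) has_integral (G b - G a)) {a..b}" and c: "(\<lambda>t. cis (- \<psi> t)) integrable_on {a..b}"
    have "((\<lambda>t. cis (- \<psi> t) - (cis (- \<psi> t) - R t)) has_integral (integral {a..b} (\<lambda>t. cis (- \<psi> t)) - (G b - G a))) {a..b}"
      by (rule has_integral_diff[OF integrable_integral[OF c] h])
    then have R: "(R has_integral (integral {a..b} (\<lambda>t. cis (- \<psi> t)) - (G b - G a))) {a..b}" by simp
    then show "R integrable_on {a..b}" by blast
    show "integral {a..b} (\<lambda>t. cis (- \<psi> t)) = G b - G a + integral {a..b} R" using integral_unique[OF R] by simp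
  qed
  have "((\<lambda>t. \<psi>'' t / (\<psi>' t)\<^sup>2) has_integral (- 1 / \<psi>' b - (- 1 / \<psi>' a))) {a..b}"
  proof (rule fundamental_theorem_of_calculus[OF ab])
    fix t assume t: "t \<in> {a..b}"
    show "((\<lambda>t. - 1 / \<psi>' t) has_vector_derivative \<psi>'' t / (\<psi>' t)\<^sup>2) (at t within {a..b})"
      unfolding has_real_derivative_iff_has_vector_derivative[symmetric]
      by (rule DERIV_subset[OF _ subset_UNIV]) (use d2[OF t] nz[OF t] in \<open>auto intro!: derivative_eq_intros simp: power2_eq_square\<close>)
  qed
  then have hi: "(\<lambda>t. \<psi>'' t / (\<psi>' t)\<^sup>2) integrable_on {a..b}" "integral {a..b} (\<lambda>t. \<psi>'' t / (\<psi>' t)\<^sup>2) = - 1 / \<psi>' b + 1 / \<psi>' a"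
    by (auto simp: integral_unique)
  have inv: "\<bar>1 / \<psi>' t\<bar> \<le> 1 / \<mu>" if "t \<in> {a..b}" for t
    using large[OF that] \<mu> by (simp add: abs_divide frac_le)
  have "norm (integral {a..b} R) \<le> integral {a..b} (\<lambda>t. \<psi>'' t / (\<psi>' t)\<^sup>2)"
    by (rule integral_norm_bound_integral[OF Rint hi(1)]) (use convex in \<open>simp add: R_def norm_mult norm_divide norm_power\<close>)
  also have "\<dots> \<le> 1 / \<mu> + 1 / \<mu>"
  proof -
    have "\<bar>1 / \<psi>' a\<bar> \<le> 1 / \<mu>" "\<bar>1 / \<psi>' b\<bar> \<le> 1 / \<mu>" using inv ab by auto
    moreover have "- 1 / \<psi>' b + 1 / \<psi>' a = 1 / \<psi>' a - 1 / \<psi>' b" by simp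
    ultimately show ?thesis unfolding hi(2) by linarith
  qed
  finally have "norm (integral {a..b} R) \<le> 2 / \<mu>" by simp
  moreover have "norm (G t) \<le> 1 / \<mu>" if "t \<in> {a..b}" for t
    using inv[OF that] by (simp add: G_def norm_mult norm_divide)
  then have "norm (G b - G a) \<le> 1 / \<mu> + 1 / \<mu>"
    using norm_triangle_ineq4[of "G b" "G a"] ab by (smt (verit) atLeastAtMost_iff)
  ultimately show ?thesis unfolding eq
    using norm_triangle_ineq[of "G b - G a" "integral {a..b} R"] by simp
qed

definition hyperbolic_phase :: "real \<Rightarrow> real \<Rightarrow> real \<Rightarrow> real" where
  "hyperbolic_phase l r t = l\<^sup>2 * t + r\<^sup>2 / (4 * t)"

text \<open>
  The derivative of the phase is \<open>l\<^sup>2 (t - s) (t + s) / t\<^sup>2\<close> with the stationary point \<open>s = r / (2 l)\<close>. Within distance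
  \<open>\<Delta> = sqrt a / l\<close> of \<open>s\<close> the integrand is bounded by 1. Outside, the derivative is at least \<open>l\<^sup>2 \<Delta> / (2 a)\<close>, so each of the
  two remaining pieces contributes at most \<open>8 \<Delta>\<close>. This choice of \<open>\<Delta>\<close> balances the pieces, uniformly in \<open>r\<close>.
\<close>

lemma hyperbolic_phase_integral_bound:
  assumes a: "0 < a" and ab: "a \<le> b" "b \<le> 2 * a" and l: "l > 0" and r: "r \<ge> 0"
  shows "norm (integral {a..b} (\<lambda>t. cis (- hyperbolic_phase l r t))) \<le> 18 * (sqrt a / l)"
proof -
  define \<Delta> where "\<Delta> = sqrt a / l"
  define s where "s = r / (2 * l)"
  have \<Delta>: "\<Delta> > 0" using a l by (simp add: \<Delta>_def)
  have s: "s \<ge> 0" using r l by (simp add: s_def)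
  \<comment> \<open>The points \<open>s - \<Delta>\<close> and \<open>s + \<Delta>\<close>, moved into the interval if they lie outside.\<close>
  define p where "p = max a (min b (s - \<Delta>))"
  define q where "q = max a (min b (s + \<Delta>))"
  have pq: "a \<le> p" "p \<le> q" "q \<le> b" "q - p \<le> 2 * \<Delta>" using ab \<Delta> by (auto simp: p_def q_def)
  let ?f = "\<lambda>t. cis (- hyperbolic_phase l r t)"
  have piece: "norm (integral {u..v} ?f) \<le> 8 * \<Delta>"
    if uv: "a \<le> u" "u \<le> v" "v \<le> b" and far: "\<And>t. t \<in> {u..v} \<Longrightarrow> \<Delta> \<le> \<bar>t - s\<bar>" for u v
  proof -
    have "norm (integral {u..v} ?f) \<le> 4 / (l\<^sup>2 * \<Delta> / (2 * a))"
    proof (rule nonstationary_phase[where \<psi>'="\<lambda>t. l\<^sup>2 - r\<^sup>2 / (4 * t\<^sup>2)" and \<psi>''="\<lambda>t. r\<^sup>2 / (2 * t ^ 3)"])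
      fix t assume t: "t \<in> {u..v}"
      have t0: "t > 0" "t \<le> 2 * a" using t uv a ab by auto
      show "(hyperbolic_phase l r has_real_derivative l\<^sup>2 - r\<^sup>2 / (4 * t\<^sup>2)) (at t)"
        unfolding hyperbolic_phase_def using t0
        by (auto intro!: derivative_eq_intros simp: power2_eq_square field_simps)
      show "((\<lambda>t. l\<^sup>2 - r\<^sup>2 / (4 * t\<^sup>2)) has_real_derivative r\<^sup>2 / (2 * t ^ 3)) (at t)"
        using t0 by (auto intro!: derivative_eq_intros simp: power2_eq_square power3_eq_cube field_simps)
      show "0 \<le> r\<^sup>2 / (2 * t ^ 3)" using t0 by simp
      have "l\<^sup>2 - r\<^sup>2 / (4 * t\<^sup>2) = (l\<^sup>2 / t) * (t - s) * ((t + s) / t)"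
        using t0 l by (simp add: s_def power2_eq_square field_simps)
      then have "\<bar>l\<^sup>2 - r\<^sup>2 / (4 * t\<^sup>2)\<bar> = (l\<^sup>2 / t) * \<bar>t - s\<bar> * ((t + s) / t)"
        using t0 s by (simp add: abs_mult)
      moreover have "(l\<^sup>2 / (2 * a)) * \<Delta> * 1 \<le> (l\<^sup>2 / t) * \<bar>t - s\<bar> * ((t + s) / t)"
        using t0 s far[OF t] \<Delta> a by (intro mult_mono divide_left_mono) auto
      ultimately show "l\<^sup>2 * \<Delta> / (2 * a) \<le> \<bar>l\<^sup>2 - r\<^sup>2 / (4 * t\<^sup>2)\<bar>" by simp
    qed (use uv l \<Delta> a in auto)
    also have "\<dots> = 8 * \<Delta>"
    proof -
      have "a = (\<Delta> * l)\<^sup>2" using a l by (simp add: \<Delta>_def)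
      then show ?thesis using \<Delta> l by (simp add: power2_eq_square)
    qed
    finally show ?thesis .
  qed
  have int: "?f integrable_on {u..v}" if "a \<le> u" for u v
    using that a unfolding hyperbolic_phase_def by (intro integrable_continuous_real continuous_intros) auto
  have 1: "norm (integral {a..p} ?f) \<le> 8 * \<Delta>"
  proof (cases "a = p")
    case False
    then have "p \<le> s - \<Delta>" by (auto simp: p_def)
    then show ?thesis using pq by (intro piece) auto
  qed (use \<Delta> in simp)
  have 3: "norm (integral {q..b} ?f) \<le> 8 * \<Delta>"
  proof (cases "q = b")
    case False
    then have "q < b" using pq by simp
    then have "q \<ge> s + \<Delta>" by (auto simp: q_def)
    then show ?thesis using pq by (intro piece) auto
  qed (use \<Delta> in simp)
  have 2: "norm (integral {p..q} ?f) \<le> 2 * \<Delta>"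
  proof -
    have "norm (integral {p..q} ?f) \<le> 1 * (q - p)"
      using pq int[of p q] integrable_bound[of 1 ?f p q]
      by (intro integral_bound) (use pq a in \<open>auto simp: hyperbolic_phase_def intro!: continuous_intros\<close>)
    then show ?thesis using pq by simp
  qed
  have "integral {a..b} ?f = integral {a..p} ?f + integral {p..q} ?f + integral {q..b} ?f"
    using pq int by (simp add: Henstock_Kurzweil_Integration.integral_combine)
  then have "norm (integral {a..b} ?f) \<le> norm (integral {a..p} ?f) + norm (integral {p..q} ?f) + norm (integral {q..b} ?f)"
    by (metis norm_triangle_mono norm_triangle_ineq order_refl)
  then show ?thesis using 1 2 3 unfolding \<Delta>_def[symmetric] by simp
qed

text \<open>
  Integration by parts reduces an integral with a slowly varying amplitude to the bounds for the
  integrals of the pure oscillation.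
\<close>

lemma oscillatory_integral_amplitude:
  fixes f A A' :: "real \<Rightarrow> complex"
  assumes ab: "a \<le> b" and f: "continuous_on {a..b} f"
    and K: "\<And>t. t \<in> {a..b} \<Longrightarrow> norm (integral {a..t} f) \<le> K"
    and A: "\<And>t. t \<in> {a..b} \<Longrightarrow> (A has_vector_derivative A' t) (at t within {a..b})"
    and A': "continuous_on {a..b} A'"
    and M: "norm (A b) \<le> M" and M': "\<And>t. t \<in> {a..b} \<Longrightarrow> norm (A' t) \<le> M'"
  shows "norm (integral {a..b} (\<lambda>t. A t * f t)) \<le> K * (M + M' * (b - a))"
proof -
  define E where "E t = integral {a..t} f" for t
  have E: "(E has_vector_derivative f t) (at t within {a..b})" if "t \<in> {a..b}" for t
    unfolding E_def by (rule integral_has_vector_derivative[OF f that])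
  have cE: "continuous_on {a..b} E" 
    using has_vector_derivative_continuous[OF E] by (simp add: continuous_on_eq_continuous_within)
  have cA: "continuous_on {a..b} A" 
    using has_vector_derivative_continuous[OF A] by (simp add: continuous_on_eq_continuous_within)
  have "((\<lambda>t. A t * f t + A' t * E t) has_integral (A b * E b - A a * E a)) {a..b}"
    by (rule fundamental_theorem_of_calculus[OF ab]) (intro has_vector_derivative_mult A E)
  moreover have i1: "(\<lambda>t. A' t * E t) integrable_on {a..b}" "(\<lambda>t. A t * f t) integrable_on {a..b}"
    by (intro integrable_continuous_real continuous_on_mult A' cE cA f)+
  ultimately have "integral {a..b} (\<lambda>t. A t * f t) + integral {a..b} (\<lambda>t. A' t * E t) = A b * E b - A a * E a"
    using integral_add[OF i1(2) i1(1)] integral_unique by metis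
  moreover have "E a = 0" by (simp add: E_def)
  ultimately have eq: "integral {a..b} (\<lambda>t. A t * f t) = A b * E b - integral {a..b} (\<lambda>t. A' t * E t)" by (simp add: algebra_simps)
  have K0: "K \<ge> 0" using K[of a] ab norm_ge_zero order_trans by (metis atLeastAtMost_iff order_refl)
  have "norm (integral {a..b} (\<lambda>t. A' t * E t)) \<le> M' * K * (b - a)"
    by (rule integral_bound[OF ab]) (auto simp: norm_mult E_def intro!: mult_mono M' K continuous_on_mult A' cE[unfolded E_def] order_trans[OF norm_ge_zero M'])
  moreover have "norm (A b * E b) \<le> M * K"
    unfolding norm_mult using M K[of b] ab K0 by (intro mult_mono) (auto simp: E_def intro: order_trans[OF norm_ge_zero M])
  ultimately show ?thesis unfolding eq
    using norm_triangle_ineq4[of "A b * E b" "integral {a..b} (\<lambda>t. A' t * E t)"] by (simp add: algebra_simps)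
qed

text \<open>
  With \<open>z = \<epsilon> - \<i> t\<close> one has \<open>1 / z = \<i> / t + \<epsilon> / (t (t + \<i> \<epsilon>))\<close>. The first term together with \<open>l\<^sup>2 t\<close> forms the real
  phase \<open>hyperbolic_phase\<close>. The second one goes into the amplitude, which has size
  \<open>a powr (-d/2)\<close> times a Gaussian in \<open>r\<close>, and whose logarithmic derivative is \<open>O(1 / a)\<close> plus \<open>r\<^sup>2 \<epsilon> / a\<^sup>3\<close>. The
  latter is absorbed by giving away half of the exponent of the Gaussian.
\<close>

lemma schroedinger_time_integral_bound:
  fixes d :: nat
  assumes eps: "0 < \<epsilon>" "\<epsilon> \<le> a" and ab: "a \<le> b" "b \<le> 2 * a" "b \<le> \<tau>" and l: "l > 0" and r: "r \<ge> 0"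
  shows "norm (integral {a..b} (\<lambda>t. of_real (1 - t / \<tau>) * cis (- (l\<^sup>2 * t)) *
     (csqrt (of_real pi / Complex \<epsilon> (-t))) ^ d * exp (- of_real (r\<^sup>2) / (4 * Complex \<epsilon> (-t)))))
    \<le> 18 * (32 + d) * (sqrt a / l) * (sqrt (pi / a)) ^ d * exp (- (r\<^sup>2 * \<epsilon> / (40 * a\<^sup>2)))"
proof -
  define z where "z t = Complex \<epsilon> (-t)" for t
  define s where "s t = csqrt (of_real pi / z t)" for t
  define v where "v t = Complex (t\<^sup>2) (\<epsilon> * t)" for t
  \<comment> \<open>In this notation \<open>exp (- r\<^sup>2 / (4 z))\<close> is the oscillation \<open>cis (- r\<^sup>2 / (4 t))\<close> times \<open>B t\<close>.\<close>
  define \<kappa> where "\<kappa> = r\<^sup>2 * \<epsilon> / 4"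
  define B where "B t = exp (- of_real \<kappa> / v t)" for t
  define A where "A t = of_real (1 - t / \<tau>) * s t ^ d * B t" for t
  define A' where "A' t = s t ^ d * B t * (- of_real (1 / \<tau>) + of_real (1 - t / \<tau>) * (of_nat d * \<i> / (2 * z t) + of_real \<kappa> * Complex (2 * t) \<epsilon> / (v t)\<^sup>2))" for t
  \<comment> \<open>On \<open>[a, 2 a]\<close> the amplitude decays like \<open>exp (- 2 y)\<close>; half of this absorbs the factor \<open>y\<close> in its derivative.\<close>
  define y where "y = r\<^sup>2 * \<epsilon> / (40 * a\<^sup>2)"
  have a: "a > 0" using eps by simp
  have y: "y \<ge> 0" using eps by (simp add: y_def)
  have \<kappa>: "\<kappa> \<ge> 0" "\<kappa> = 10 * y * a\<^sup>2" using eps a by (simp_all add: \<kappa>_def y_def)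
  have \<tau>: "\<tau> > 0" using a ab by simp
  have z0: "z t \<noteq> 0" for t using eps by (simp add: z_def complex_eq_iff)
  have v0: "v t \<noteq> 0" if "t > 0" for t using that by (simp add: v_def complex_eq_iff)
  have vz: "v t = \<i> * of_real t * z t" for t by (simp add: v_def z_def complex_eq_iff power2_eq_square)
  have z_nonpos: "of_real pi / z t \<notin> \<real>\<^sub>\<le>\<^sub>0" for t
  proof -
    have "Re (of_real pi / z t) = pi * \<epsilon> / (\<epsilon>\<^sup>2 + t\<^sup>2)" by (simp add: Re_divide z_def)
    also have "\<dots> > 0" using eps by (intro divide_pos_pos add_pos_nonneg) auto
    finally show ?thesis by (auto simp: complex_nonpos_Reals_iff)
  qed
  have dz: "(z has_vector_derivative - \<i>) (at t within S)" for t S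
  proof -
    have "z = (\<lambda>t. of_real \<epsilon> - \<i> * of_real t)" by (simp add: z_def fun_eq_iff complex_eq_iff)
    then show ?thesis by (auto intro!: derivative_eq_intros simp: scaleR_conv_of_real)
  qed
  have dv: "(v has_vector_derivative Complex (2 * t) \<epsilon>) (at t within S)" for t S
  proof -
    have "v = (\<lambda>t. of_real (t\<^sup>2) + \<i> * of_real (\<epsilon> * t))" by (simp add: v_def fun_eq_iff complex_eq_iff)
    moreover have "((\<lambda>t. of_real (t\<^sup>2) + \<i> * of_real (\<epsilon> * t)) has_vector_derivative of_real (2 * t) + \<i> * of_real \<epsilon>) (at t within S)"
      by (intro has_vector_derivative_add has_vector_derivative_mult_right has_vector_derivative_of_real) (auto intro!: derivative_eq_intros)
    ultimately show ?thesis by (simp add: complex_eq_iff Complex_eq)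
  qed
  have ds: "(s has_vector_derivative (s t * \<i> / (2 * z t))) (at t within S)" for t S
  proof -
    have "((\<lambda>w. csqrt (of_real pi / w)) has_field_derivative (- of_real pi / (z t)\<^sup>2) / (2 * csqrt (of_real pi / z t))) (at (z t))"
      using z_nonpos[of t] z0[of t] by (auto intro!: derivative_eq_intros simp: power2_eq_square)
    moreover have "(- of_real pi / (z t)\<^sup>2) / (2 * csqrt (of_real pi / z t)) = - (s t / (2 * z t))"
    proof -
      have "s t * s t = of_real pi / z t" unfolding s_def by (metis power2_csqrt power2_eq_square)
      then have "of_real pi = s t * s t * z t" using z0[of t] by (simp add: field_simps)
      moreover have "s t \<noteq> 0" using z0[of t] by (simp add: s_def)
      ultimately show ?thesis unfolding s_def[symmetric] using z0[of t] by (simp add: field_simps power2_eq_square)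
    qed
    ultimately have "((\<lambda>w. csqrt (of_real pi / w)) has_field_derivative - (s t / (2 * z t))) (at (z t))" by simp
    from field_vector_diff_chain_within[OF dz[of t S] has_field_derivative_at_within[OF this]]
    show ?thesis by (simp add: s_def[abs_def] o_def mult.commute)
  qed
  have dsd: "((\<lambda>t. s t ^ d) has_vector_derivative (s t ^ d * (of_nat d * \<i> / (2 * z t)))) (at t within S)" for t S
  proof -
    have "((\<lambda>w. w ^ d) has_field_derivative (of_nat d * s t ^ (d - 1))) (at (s t))"
      by (auto intro!: derivative_eq_intros)
    from field_vector_diff_chain_within[OF ds[of t S] has_field_derivative_at_within[OF this]]
    have "((\<lambda>t. s t ^ d) has_vector_derivative (s t * \<i> / (2 * z t) * (of_nat d * s t ^ (d - 1)))) (at t within S)"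
      by (simp add: o_def)
    moreover have "s t * \<i> / (2 * z t) * (of_nat d * s t ^ (d - 1)) = s t ^ d * (of_nat d * \<i> / (2 * z t))"
      by (cases d) (simp_all add: field_simps)
    ultimately show ?thesis by (simp only:)
  qed
  have dB: "(B has_vector_derivative (B t * (of_real \<kappa> * Complex (2 * t) \<epsilon> / (v t)\<^sup>2))) (at t within S)" if "t > 0" for t S
  proof -
    have "((\<lambda>w. exp (- of_real \<kappa> / w)) has_field_derivative (exp (- of_real \<kappa> / v t) * (of_real \<kappa> / (v t)\<^sup>2))) (at (v t))"
      using v0[OF that] by (auto intro!: derivative_eq_intros simp: power2_eq_square)
    from field_vector_diff_chain_within[OF dv[of t S] has_field_derivative_at_within[OF this]]
    show ?thesis by (simp add: B_def[abs_def] o_def mult_ac)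
  qed
  have dA: "(A has_vector_derivative A' t) (at t within {a..b})" if "t \<in> {a..b}" for t
  proof -
    have t: "t > 0" using that a by simp
    have "((\<lambda>t. complex_of_real (1 - t / \<tau>)) has_vector_derivative of_real (- (1 / \<tau>))) (at t within {a..b})"
      by (rule has_vector_derivative_of_real) (use \<tau> in \<open>auto intro!: derivative_eq_intros\<close>)
    from has_vector_derivative_mult[OF has_vector_derivative_mult[OF this dsd] dB[OF t]]
    show ?thesis unfolding A_def[abs_def] A'_def by (simp add: algebra_simps)
  qed
  have s_norm: "norm (s t ^ d) \<le> sqrt (pi / a) ^ d" if "t \<in> {a..b}" for t
  proof -
    have "a \<le> \<bar>Im (z t)\<bar>" using that a by (simp add: z_def)
    also have "\<dots> \<le> cmod (z t)" by (rule abs_Im_le_cmod)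
    finally have "pi / cmod (z t) \<le> pi / a" using a by (intro divide_left_mono mult_pos_pos) auto
    then show ?thesis by (simp add: s_def norm_power norm_divide power_mono)
  qed
  have B_norm: "norm (B t) \<le> exp (- (2 * y))" if "t \<in> {a..b}" for t
  proof -
    have t: "a \<le> t" "t \<le> 2 * a" using that ab by auto
    have "Re (1 / v t) = t\<^sup>2 / ((t\<^sup>2)\<^sup>2 + (\<epsilon> * t)\<^sup>2)" by (simp add: Re_divide v_def)
    also have "\<dots> = 1 / (t\<^sup>2 + \<epsilon>\<^sup>2)" using t a by (simp add: divide_simps power2_eq_square) (simp add: algebra_simps)
    finally have R: "Re (1 / v t) = 1 / (t\<^sup>2 + \<epsilon>\<^sup>2)" .
    have "t\<^sup>2 + \<epsilon>\<^sup>2 \<le> (2 * a)\<^sup>2 + a\<^sup>2" using t eps a by (intro add_mono power_mono) auto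
    then have "1 / (5 * a\<^sup>2) \<le> 1 / (t\<^sup>2 + \<epsilon>\<^sup>2)" using eps a by (intro divide_left_mono mult_pos_pos add_nonneg_pos) auto
    then have "\<kappa> * (1 / (5 * a\<^sup>2)) \<le> \<kappa> * Re (1 / v t)" unfolding R using \<kappa>(1) by (rule mult_left_mono)
    moreover have "\<kappa> * (1 / (5 * a\<^sup>2)) = 2 * y" using a by (simp add: \<kappa>(2))
    moreover have "Re (- of_real \<kappa> / v t) = - (\<kappa> * Re (1 / v t))" 
    proof -
      have "- of_real \<kappa> / v t = of_real (- \<kappa>) * (1 / v t)" by simp
      then show ?thesis by (simp only: times_complex.sel Re_complex_of_real Im_complex_of_real)
    qed
    ultimately show ?thesis by (simp add: B_def)
  qed
  have A_norm: "norm (A b) \<le> sqrt (pi / a) ^ d * exp (- y)"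
  proof -
    have "norm (complex_of_real (1 - b / \<tau>)) \<le> 1" unfolding norm_of_real using ab a \<tau> by (auto simp: abs_le_iff divide_simps)
    moreover have "norm (B b) \<le> exp (- y)" using B_norm[of b] ab y by (auto intro: order_trans)
    ultimately have "norm (A b) \<le> 1 * sqrt (pi / a) ^ d * exp (- y)"
      unfolding A_def norm_mult using s_norm[of b] ab a by (intro mult_mono) auto
    then show ?thesis by simp
  qed
  have A'_norm: "norm (A' t) \<le> sqrt (pi / a) ^ d * exp (- y) * ((31 + d) / a)" if "t \<in> {a..b}" for t
  proof -
    have t: "a \<le> t" "t \<le> 2 * a" "t > 0" "t \<le> \<tau>" using that ab a by auto
    have n1: "norm (complex_of_real (1 - t / \<tau>)) \<le> 1" unfolding norm_of_real using t a \<tau> by (auto simp: abs_le_iff divide_simps)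
    have n2: "norm (- complex_of_real (1 / \<tau>)) \<le> 1 / a"
      using t a \<tau> by (simp add: norm_divide frac_le)
    have n3: "norm (of_nat d * \<i> / (2 * z t)) \<le> d / a"
    proof -
      have "a \<le> \<bar>Im (z t)\<bar>" using t a by (simp add: z_def)
      also have "\<dots> \<le> cmod (z t)" by (rule abs_Im_le_cmod)
      finally have "d / (2 * cmod (z t)) \<le> d / a" using a by (intro divide_left_mono mult_pos_pos) auto
      then show ?thesis by (simp add: norm_mult norm_divide)
    qed
    have n4: "norm (of_real \<kappa> * Complex (2 * t) \<epsilon> / (v t)\<^sup>2) \<le> 30 * y / a"
    proof -
      have "norm (Complex (2 * t) \<epsilon>) \<le> 3 * t" using cmod_le[of "Complex (2 * t) \<epsilon>"] eps t by simp
      moreover have "t\<^sup>2 \<le> cmod (v t)" using complex_Re_le_cmod[of "v t"] by (simp add: v_def)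
      then have "t\<^sup>2 * t\<^sup>2 \<le> (cmod (v t))\<^sup>2" unfolding power2_eq_square[of "cmod (v t)"] by (intro mult_mono) auto
      ultimately have "norm (of_real \<kappa> * Complex (2 * t) \<epsilon> / (v t)\<^sup>2) \<le> \<kappa> * (3 * t) / (t\<^sup>2 * t\<^sup>2)"
        unfolding norm_divide norm_mult norm_power using \<kappa>(1) t by (intro frac_le mult_mono) auto
      also have "\<dots> = 30 * y * a\<^sup>2 / (t\<^sup>2 * t)" using t by (simp add: \<kappa>(2) power2_eq_square)
      also have "\<dots> \<le> 30 * y * a\<^sup>2 / (a\<^sup>2 * a)"
        using t a y by (intro divide_left_mono mult_mono mult_pos_pos power_mono) auto
      also have "\<dots> = 30 * y / a" using a by (simp add: power2_eq_square)
      finally show ?thesis .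
    qed
    have "norm (- of_real (1 / \<tau>) + of_real (1 - t / \<tau>) * (of_nat d * \<i> / (2 * z t) + of_real \<kappa> * Complex (2 * t) \<epsilon> / (v t)\<^sup>2))
      \<le> 1 / a + 1 * (d / a + 30 * y / a)"
      by (intro norm_triangle_mono n2 order_trans[OF eq_refl[OF norm_mult]] mult_mono n1 n3 n4) auto
    also have "\<dots> = (1 + d + 30 * y) / a" by (simp add: add_divide_distrib)
    finally have "norm (A' t) \<le> sqrt (pi / a) ^ d * exp (- (2 * y)) * ((1 + d + 30 * y) / a)"
      unfolding A'_def norm_mult[of "s t ^ d * B t"] norm_mult[of "s t ^ d"]
      using s_norm[OF that] B_norm[OF that] a by (intro mult_mono) auto
    also have "\<dots> = sqrt (pi / a) ^ d * exp (- y) * (exp (- y) * (1 + d + 30 * y) / a)"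
      by (simp add: exp_add[symmetric])
    also have "\<dots> \<le> sqrt (pi / a) ^ d * exp (- y) * ((31 + d) / a)"
    proof -
      have "exp (- y) * (1 + real d) \<le> 1 * (1 + real d)" using y by (intro mult_right_mono) auto
      moreover have "y \<le> exp y" using exp_ge_add_one_self[of y] by linarith
      then have "y * exp (- y) \<le> exp y * exp (- y)" by (intro mult_right_mono) auto
      then have "y * exp (- y) \<le> 1" by (simp add: exp_add[symmetric])
      ultimately have "exp (- y) * (1 + d + 30 * y) \<le> 31 + d" by (simp add: algebra_simps)
      then show ?thesis using a by (intro mult_left_mono divide_right_mono) auto
    qed
    finally show ?thesis .
  qed
  have cA': "continuous_on {a..b} A'"
  proof -
    have cont: "continuous_on {a..b} s" "continuous_on {a..b} z" "continuous_on {a..b} v" "continuous_on {a..b} B"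
      using has_vector_derivative_continuous[OF ds] has_vector_derivative_continuous[OF dz] has_vector_derivative_continuous[OF dv]
       has_vector_derivative_continuous[OF dB] a by (auto simp: continuous_on_eq_continuous_within)
    have "(\<lambda>t. Complex (2 * t) \<epsilon>) = (\<lambda>t. of_real (2 * t) + \<i> * of_real \<epsilon>)" by (simp add: fun_eq_iff complex_eq_iff)
    then have "continuous_on {a..b} (\<lambda>t. Complex (2 * t) \<epsilon>)" by (simp only:) (intro continuous_intros)
    then show ?thesis unfolding A'_def using z0 v0 a \<tau> by (intro continuous_intros cont) auto
  qed
  have ch: "continuous_on {a..b} (\<lambda>t. cis (- hyperbolic_phase l r t))"
    unfolding hyperbolic_phase_def using a by (intro continuous_intros) auto
  have integrand: "of_real (1 - t / \<tau>) * cis (- (l\<^sup>2 * t)) * (csqrt (of_real pi / Complex \<epsilon> (-t))) ^ d * exp (- of_real (r\<^sup>2) / (4 * Complex \<epsilon> (-t)))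
     = A t * cis (- hyperbolic_phase l r t)" if "t \<in> {a..b}" for t
  proof -
    have t: "t > 0" using that a by simp
    have "1 / z t = \<i> / of_real t + of_real \<epsilon> / v t"
    proof -
      have "\<i> / of_real t + of_real \<epsilon> / v t = (\<i> * (\<i> * z t) + of_real \<epsilon>) / (\<i> * of_real t * z t)"
        unfolding vz using t z0[of t] by (simp add: divide_simps)
      also have "\<i> * (\<i> * z t) + of_real \<epsilon> = \<i> * of_real t" by (simp add: z_def complex_eq_iff)
      also have "\<i> * of_real t / (\<i> * of_real t * z t) = 1 / z t" using t by simp
      finally show ?thesis by simp
    qed
    then have "- of_real (r\<^sup>2) / (4 * z t) = \<i> * of_real (- (r\<^sup>2 / (4 * t))) + (- of_real \<kappa> / v t)"
    proof -
      have "- of_real (r\<^sup>2) / (4 * z t) = - of_real (r\<^sup>2 / 4) * (1 / z t)" by simp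
      also have "\<dots> = - of_real (r\<^sup>2 / 4) * (\<i> / of_real t) + - of_real (r\<^sup>2 / 4) * (of_real \<epsilon> / v t)"
        unfolding \<open>1 / z t = _\<close> by (rule distrib_left)
      finally show ?thesis by (simp add: \<kappa>_def)
    qed
    then have "exp (- of_real (r\<^sup>2) / (4 * z t)) = cis (- (r\<^sup>2 / (4 * t))) * B t"
      by (simp only: exp_add cis_conv_exp B_def)
    moreover have "cis (- hyperbolic_phase l r t) = cis (- (l\<^sup>2 * t)) * cis (- (r\<^sup>2 / (4 * t)))"
      by (simp add: cis_mult hyperbolic_phase_def)
    ultimately show ?thesis unfolding A_def s_def z_def[symmetric] by (simp add: mult_ac)
  qed
  have K: "norm (integral {a..t} (\<lambda>t. cis (- hyperbolic_phase l r t))) \<le> 18 * (sqrt a / l)" if "t \<in> {a..b}" for t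
    using that ab by (intro hyperbolic_phase_integral_bound a l r) auto
  have "norm (integral {a..b} (\<lambda>t. A t * cis (- hyperbolic_phase l r t)))
     \<le> 18 * (sqrt a / l) * (sqrt (pi / a) ^ d * exp (- y) + sqrt (pi / a) ^ d * exp (- y) * ((31 + d) / a) * (b - a))"
    by (rule oscillatory_integral_amplitude[OF ab(1) ch K dA cA' A_norm A'_norm])
  also have "\<dots> \<le> 18 * (sqrt a / l) * (sqrt (pi / a) ^ d * exp (- y) + sqrt (pi / a) ^ d * exp (- y) * ((31 + d) / a) * a)"
    using a l ab by (intro mult_left_mono add_left_mono) auto
  also have "\<dots> = 18 * (32 + d) * (sqrt a / l) * sqrt (pi / a) ^ d * exp (- y)"
  proof -
    have "sqrt (pi / a) ^ d * exp (- y) * ((31 + d) / a) * a = sqrt (pi / a) ^ d * exp (- y) * (31 + d)" using a by simp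
    then show ?thesis by (simp add: algebra_simps)
  qed
  finally show ?thesis
    using integral_cong[OF integrand, of "{a..b}"] unfolding y_def by simp
qed

section \<open>The kernel of a Schroedinger time average\<close>

lemma uniform_limit_prod:
  fixes f :: "'i \<Rightarrow> nat \<Rightarrow> 'a \<Rightarrow> complex"
  assumes "finite I" "\<And>i. i \<in> I \<Longrightarrow> uniform_limit S (f i) (g i) sequentially" "\<And>i. i \<in> I \<Longrightarrow> bounded (g i ` S)"
  shows "uniform_limit S (\<lambda>n x. \<Prod>i\<in>I. f i n x) (\<lambda>x. \<Prod>i\<in>I. g i x) sequentially \<and> bounded ((\<lambda>x. \<Prod>i\<in>I. g i x) ` S)"
  using assms
proof (induction I rule: finite_induct)
  case empty
  have "(\<lambda>x. 1::complex) ` S \<subseteq> {1}" by auto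
  then have "bounded ((\<lambda>x. 1::complex) ` S)" by (rule bounded_subset[rotated]) simp
  then show ?case by (simp add: uniform_limit_const)
next
  case (insert i I)
  then have IH: "uniform_limit S (\<lambda>n x. \<Prod>i\<in>I. f i n x) (\<lambda>x. \<Prod>i\<in>I. g i x) sequentially" "bounded ((\<lambda>x. \<Prod>i\<in>I. g i x) ` S)"
    by auto
  have i: "uniform_limit S (f i) (g i) sequentially" "bounded (g i ` S)" using insert by auto
  obtain b1 b2 where b: "\<forall>x\<in>S. norm (g i x) \<le> b1" "\<forall>x\<in>S. norm (\<Prod>i\<in>I. g i x) \<le> b2"
    using IH(2) i(2) by (auto simp: bounded_iff)
  have "\<forall>x\<in>S. norm (g i x * (\<Prod>i\<in>I. g i x)) \<le> b1 * b2"
    using b by (auto simp: norm_mult intro!: mult_mono intro: order_trans[OF norm_ge_zero])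
  then have "bounded ((\<lambda>x. g i x * (\<Prod>i\<in>I. g i x)) ` S)" by (auto simp: bounded_iff)
  then show ?case using uniform_lim_mult[OF i(1) IH(1) i(2) IH(2)] insert by simp
qed

lemma norm_theta_partial_le:
  assumes "Re w > 0"
  shows "norm (\<Sum>n\<in>{- int M..int M}. theta_fourier w x n) \<le> 1 + 4 / sqrt (Re w)"
proof -
  have "norm (\<Sum>n\<in>{- int M..int M}. theta_fourier w x n) \<le> (\<Sum>n\<in>{- int M..int M}. exp (- Re w * (real_of_int n)\<^sup>2))"
    by (rule sum_norm_le) (simp add: norm_theta_fourier)
  then show ?thesis using sum_exp_int_squares_le[OF assms, of M] by linarith
qed

lemma theta_tendsto:
  assumes "Re w > 0"
  shows "(\<lambda>M. \<Sum>n\<in>{- int M..int M}. theta_fourier w x n) \<longlonglongrightarrow> theta w x"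
  using tendsto_uniform_limitI[OF uniform_limit_theta_compact(1)[of "{w}" x]] assms by simp

lemma norm_theta_le:
  assumes "Re w > 0"
  shows "norm (theta w x) \<le> 1 + 4 / sqrt (Re w)"
  by (rule Lim_bounded[OF tendsto_norm[OF theta_tendsto[OF assms]], of 0]) (simp add: norm_theta_partial_le[OF assms])

lemma csqrt_pi_scaled:
  assumes "\<alpha> > 0" "Re z > 0"
  shows "csqrt (of_real pi / (z / of_real (\<alpha>\<^sup>2))) = of_real \<alpha> * csqrt (of_real pi / z)"
proof (rule csqrt_unique)
  have "Re (csqrt (of_real pi / z)) > 0"
  proof -
    have R: "Re (of_real pi / z) > 0"
      unfolding Re_divide using assms(2) by (auto intro!: divide_pos_pos add_pos_nonneg)
    then have "(cmod (of_real pi / z) + Re (of_real pi / z)) / 2 > 0" by (intro divide_pos_pos add_nonneg_pos) auto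
    then show ?thesis unfolding csqrt.simps by simp
  qed
  then show "0 < Re (of_real \<alpha> * csqrt (of_real pi / z)) \<or> Re (of_real \<alpha> * csqrt (of_real pi / z)) = 0 \<and> 0 \<le> Im (of_real \<alpha> * csqrt (of_real pi / z))"
    using assms(1) by simp
  show "(of_real \<alpha> * csqrt (of_real pi / z))\<^sup>2 = of_real pi / (z / of_real (\<alpha>\<^sup>2))"
    using assms by (simp add: power_mult_distrib)
qed

text \<open>
  The integrand of the convolution kernel at time \<open>t\<close>: the triangular Fejer weight, the modulation that
  centres the spectrum at \<open>l\<^sup>2\<close>, and the kernel of \<open>exp ((1/l\<^sup>2 - \<i> t) \<Delta>)\<close>, which factors over the coordinates of a
  rectangular torus. The damping \<open>1/l\<^sup>2\<close> localises to frequencies of size \<open>l\<close>. The argument \<open>\<theta> j\<close> is the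
  displacement in the \<open>j\<close>-th coordinate divided by \<open>\<alpha> j\<close>.
\<close>

definition kernel_integrand :: "real \<Rightarrow> real \<Rightarrow> real ^ 'n \<Rightarrow> real ^ 'n \<Rightarrow> real \<Rightarrow> complex" where
  "kernel_integrand l \<tau> \<alpha> \<theta> t = of_real (1 - t / \<tau>) * cis (- (l\<^sup>2 * t)) *
     (\<Prod>j\<in>UNIV. theta (Complex (1 / l\<^sup>2) (-t) / of_real ((\<alpha> $ j)\<^sup>2)) (\<theta> $ j))"

lemma continuous_on_theta_line:
  assumes "\<epsilon> > 0" "\<alpha> > 0"
  shows "continuous_on {a..b} (\<lambda>t. theta (Complex \<epsilon> (-t) / of_real (\<alpha>\<^sup>2)) x)"
    and "uniform_limit {a..b} (\<lambda>M t. \<Sum>n\<in>{- int M..int M}. theta_fourier (Complex \<epsilon> (-t) / of_real (\<alpha>\<^sup>2)) x n)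
       (\<lambda>t. theta (Complex \<epsilon> (-t) / of_real (\<alpha>\<^sup>2)) x) sequentially"
    and "uniform_limit {a..b} (\<lambda>M t. \<Sum>n\<in>{- int M..int M}. theta_gauss (Complex \<epsilon> (-t) / of_real (\<alpha>\<^sup>2)) x n)
       (\<lambda>t. theta_dual (Complex \<epsilon> (-t) / of_real (\<alpha>\<^sup>2)) x) sequentially"
proof -
  let ?w = "\<lambda>t. Complex \<epsilon> (-t) / of_real (\<alpha>\<^sup>2)"
  have w_eq: "?w = (\<lambda>t. (of_real \<epsilon> - \<i> * of_real t) / of_real (\<alpha>\<^sup>2))" by (simp add: fun_eq_iff Complex_eq)
  have cw: "continuous_on {a..b} ?w" unfolding w_eq using assms by (intro continuous_intros) auto
  have Kc: "compact (?w ` {a..b})" by (rule compact_continuous_image[OF cw]) simp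
  have Kpos: "Re w > 0" if "w \<in> ?w ` {a..b}" for w using that assms by auto
  note ul = uniform_limit_theta_compact[OF Kc Kpos, of x]
  show u: "uniform_limit {a..b} (\<lambda>M t. \<Sum>n\<in>{- int M..int M}. theta_fourier (?w t) x n) (\<lambda>t. theta (?w t) x) sequentially"
    by (rule uniform_limit_compose'[OF ul(1)]) auto
  show "uniform_limit {a..b} (\<lambda>M t. \<Sum>n\<in>{- int M..int M}. theta_gauss (?w t) x n) (\<lambda>t. theta_dual (?w t) x) sequentially"
    by (rule uniform_limit_compose'[OF ul(2)]) auto
  have "continuous_on {a..b} (\<lambda>t. \<Sum>n\<in>{- int M..int M}. theta_fourier (?w t) x n)" for M
    unfolding theta_fourier_def by (intro continuous_intros cw)
  then show "continuous_on {a..b} (\<lambda>t. theta (?w t) x)"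
    by (intro uniform_limit_theorem[OF _ u]) auto
qed

lemma kernel_integrand_continuous:
  fixes \<alpha> :: "real ^ 'n"
  assumes "l > 0" "\<tau> > 0" "\<And>j. \<alpha> $ j > 0"
  shows "continuous_on {a..b} (kernel_integrand l \<tau> \<alpha> \<theta>)"
  unfolding kernel_integrand_def using assms
  by (intro continuous_on_mult continuous_on_prod continuous_on_theta_line(1)) (auto intro!: continuous_intros)

text \<open>
  For times below \<open>1 / l\<^sup>2\<close> there is no oscillation to exploit, and it suffices to count the about \<open>l\<close>
  frequencies in each coordinate.
\<close>

lemma kernel_integrand_norm_le:
  fixes \<alpha> :: "real ^ 'n"
  assumes "l \<ge> 1" "\<And>j. \<alpha> $ j > 0" "\<And>j. 1 + 4 * \<alpha> $ j \<le> C" "0 \<le> t" "t \<le> \<tau>" "0 < \<tau>"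
  shows "norm (kernel_integrand l \<tau> \<alpha> \<theta> t) \<le> (C * l) ^ CARD('n)"
proof -
  have "norm (theta (Complex (1 / l\<^sup>2) (-t) / of_real ((\<alpha> $ j)\<^sup>2)) (\<theta> $ j)) \<le> C * l" for j
  proof -
    let ?w = "Complex (1 / l\<^sup>2) (-t) / of_real ((\<alpha> $ j)\<^sup>2)"
    have R: "Re ?w = (1 / (l * \<alpha> $ j))\<^sup>2" by (simp add: power_divide power_mult_distrib)
    have lj: "l * \<alpha> $ j > 0" using assms by simp
    have "Re ?w > 0" unfolding R using lj by (intro zero_less_power divide_pos_pos) auto
    have sq: "sqrt (Re ?w) = 1 / (l * \<alpha> $ j)" unfolding R using lj by simp
    from norm_theta_le[OF \<open>Re ?w > 0\<close>, of "\<theta> $ j"] have "norm (theta ?w (\<theta> $ j)) \<le> 1 + 4 * (l * \<alpha> $ j)"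
      unfolding sq by simp
    also have "\<dots> \<le> l * (1 + 4 * \<alpha> $ j)" using assms(1) by (simp add: algebra_simps)
    also have "\<dots> \<le> l * C" using assms by (intro mult_left_mono) auto
    finally show ?thesis by (simp add: mult.commute)
  qed
  then have "norm (\<Prod>j\<in>UNIV. theta (Complex (1 / l\<^sup>2) (-t) / of_real ((\<alpha> $ j)\<^sup>2)) (\<theta> $ j)) \<le> (\<Prod>j\<in>(UNIV::'n set). C * l)"
    unfolding prod_norm[symmetric] by (intro prod_mono) auto
  moreover have "norm (complex_of_real (1 - t / \<tau>)) \<le> 1"
    unfolding norm_of_real using assms by (auto simp: abs_le_iff divide_simps)
  ultimately have "norm (kernel_integrand l \<tau> \<alpha> \<theta> t) \<le> 1 * 1 * (\<Prod>j\<in>(UNIV::'n set). C * l)"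
    unfolding kernel_integrand_def norm_mult by (intro mult_mono) auto
  then show ?thesis by simp
qed

text \<open>
  By Jacobi inversion in each coordinate the integrand is a sum, over the lattice of periods, of the
  integrands of \<open>schroedinger_time_integral_bound\<close>, where \<open>r\<close> is the distance to the translated point. The Gaussian
  factors that remain after the integration in time factor again over the coordinates, and sum to \<open>O(1 + l a)\<close> in each.
\<close>

lemma kernel_dyadic_bound:
  fixes \<alpha> \<theta> :: "real ^ 'n"
  assumes l: "l \<ge> 1" and \<alpha>: "\<And>j. \<alpha> $ j > 0" and \<theta>: "\<And>j. \<theta> $ j \<in> {0..2*pi}"
    and C: "\<And>j. 2 * \<alpha> $ j \<le> C" "26 \<le> C"
    and ab: "1 / l\<^sup>2 \<le> a" "a \<le> b" "b \<le> 2 * a" "b \<le> \<tau>"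
  shows "norm (integral {a..b} (kernel_integrand l \<tau> \<alpha> \<theta>))
     \<le> 18 * (32 + CARD('n)) * (sqrt a / l) * sqrt (pi / a) ^ CARD('n) * (C * (1 + l * a)) ^ CARD('n)"
proof -
  define \<epsilon> where "\<epsilon> = 1 / l\<^sup>2"
  have \<epsilon>: "\<epsilon> > 0" "\<epsilon> \<le> a" using l ab by (simp_all add: \<epsilon>_def)
  have a: "a > 0" using \<epsilon> by simp
  have \<tau>: "\<tau> > 0" using a ab by simp
  define z where "z t = Complex \<epsilon> (-t)" for t
  define D where "D = 18 * (32 + real CARD('n)) * (sqrt a / l) * sqrt (pi / a) ^ CARD('n)"
  have D: "D \<ge> 0" using a l by (simp add: D_def)
  define r where "r k = sqrt (\<Sum>j\<in>UNIV. (\<alpha> $ j * (\<theta> $ j + 2 * pi * of_int (k j)))\<^sup>2)" for k :: "'n \<Rightarrow> int"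
  have r2: "(r k)\<^sup>2 = (\<Sum>j\<in>UNIV. (\<alpha> $ j * (\<theta> $ j + 2 * pi * of_int (k j)))\<^sup>2)" for k
    unfolding r_def by (rule real_sqrt_pow2) (auto intro: sum_nonneg)
  \<comment> \<open>The truncation of the dual sum to \<open>|k| \<le> M\<close>; the bound for its integral is uniform in \<open>M\<close>.\<close>
  define F where "F M t = of_real (1 - t / \<tau>) * cis (- (l\<^sup>2 * t)) *
     (\<Prod>j\<in>UNIV. (of_real (\<alpha> $ j) * csqrt (of_real pi / z t)) * (\<Sum>k\<in>{- int M..int M}. theta_gauss (z t / of_real ((\<alpha> $ j)\<^sup>2)) (\<theta> $ j) k))" for M t
  define U where "U \<rho> t = of_real (1 - t / \<tau>) * cis (- (l\<^sup>2 * t)) *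
     (csqrt (of_real pi / z t)) ^ CARD('n) * exp (- of_real (\<rho>\<^sup>2) / (4 * z t))" for \<rho> t
  let ?K = "\<lambda>M. PiE (UNIV::'n set) (\<lambda>_. {- int M..int M})"
  have z0: "z t \<noteq> 0" for t using \<epsilon> by (simp add: z_def complex_eq_iff)
  have z_eq: "z = (\<lambda>t. of_real \<epsilon> - \<i> * of_real t)" by (simp add: z_def fun_eq_iff complex_eq_iff)
  have cz: "continuous_on S z" for S unfolding z_eq by (intro continuous_intros)
  have z_nonpos: "of_real pi / z t \<notin> \<real>\<^sub>\<le>\<^sub>0" for t
  proof -
    have "Re (of_real pi / z t) = pi * \<epsilon> / (\<epsilon>\<^sup>2 + t\<^sup>2)" by (simp add: Re_divide z_def)
    also have "\<dots> > 0" using \<epsilon> by (intro divide_pos_pos add_pos_nonneg) auto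
    finally show ?thesis by (auto simp: complex_nonpos_Reals_iff)
  qed
  have cs: "continuous_on S (\<lambda>t. csqrt (of_real pi / z t))" for S
    using z_nonpos z0 by (intro continuous_on_compose2[OF continuous_on_csqrt] continuous_intros cz) auto
  have cU: "continuous_on S (U \<rho>)" for S \<rho>
    unfolding U_def using z0 \<tau> by (intro continuous_intros cz cs) auto
  have F_expand: "F M t = of_real (\<Prod>j\<in>UNIV. \<alpha> $ j) * (\<Sum>k\<in>?K M. U (r k) t)" for M t
  proof -
    have gauss: "theta_gauss (z t / of_real ((\<alpha> $ j)\<^sup>2)) (\<theta> $ j) m = exp (- of_real ((\<alpha> $ j * (\<theta> $ j + 2 * pi * of_int m))\<^sup>2) / (4 * z t))" for j m
    proof -
      have "- (of_real (\<theta> $ j + 2 * pi * of_int m))\<^sup>2 / (4 * (z t / of_real ((\<alpha> $ j)\<^sup>2))) = - of_real ((\<alpha> $ j * (\<theta> $ j + 2 * pi * of_int m))\<^sup>2) / (4 * z t)"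
        unfolding power_mult_distrib of_real_mult of_real_power using \<alpha>[of j] z0[of t] by (simp add: divide_simps mult_ac)
      then show ?thesis unfolding theta_gauss_def by (rule arg_cong)
    qed
    have "(\<Prod>j\<in>UNIV. \<Sum>k\<in>{- int M..int M}. theta_gauss (z t / of_real ((\<alpha> $ j)\<^sup>2)) (\<theta> $ j) k)
       = (\<Sum>k\<in>?K M. \<Prod>j\<in>UNIV. exp (- of_real ((\<alpha> $ j * (\<theta> $ j + 2 * pi * of_int (k j)))\<^sup>2) / (4 * z t)))"
      unfolding gauss by (rule prod_sum_PiE) auto
    also have "\<dots> = (\<Sum>k\<in>?K M. exp (- of_real ((r k)\<^sup>2) / (4 * z t)))"
      unfolding r2 of_real_sum sum_negf[symmetric] sum_divide_distrib by (simp add: exp_sum)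
    finally show ?thesis
      unfolding F_def U_def prod.distrib by (simp add: sum_distrib_left mult_ac)
  qed
  have F_bound: "norm (integral {a..b} (F M)) \<le> D * (C * (1 + l * a)) ^ CARD('n)" for M
  proof -
    have P0: "(\<Prod>j\<in>UNIV. \<alpha> $ j) \<ge> 0" using \<alpha> by (intro prod_nonneg) (auto intro: less_imp_le)
    have "integral {a..b} (F M) = of_real (\<Prod>j\<in>UNIV. \<alpha> $ j) * (\<Sum>k\<in>?K M. integral {a..b} (U (r k)))"
      unfolding F_expand[abs_def] integral_mult_right
      by (subst integral_sum) (auto intro!: integrable_continuous_real cU finite_PiE)
    also have "norm \<dots> \<le> (\<Prod>j\<in>UNIV. \<alpha> $ j) * (\<Sum>k\<in>?K M. D * exp (- ((r k)\<^sup>2 * \<epsilon> / (40 * a\<^sup>2))))"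
    proof -
      have "norm (integral {a..b} (U (r k))) \<le> D * exp (- ((r k)\<^sup>2 * \<epsilon> / (40 * a\<^sup>2)))" for k
        unfolding U_def z_def D_def of_nat_mult of_nat_add
        by (rule order_trans[OF schroedinger_time_integral_bound[OF \<epsilon> ab(2-4), of l "r k" "CARD('n)"]]) (use l in \<open>auto simp: r_def sum_nonneg\<close>)
      then show ?thesis
        using P0 unfolding norm_mult norm_of_real abs_of_nonneg[OF P0] by (intro mult_left_mono sum_norm_le) auto
    qed
    also have "(\<Sum>k\<in>?K M. D * exp (- ((r k)\<^sup>2 * \<epsilon> / (40 * a\<^sup>2))))
      = D * (\<Sum>k\<in>?K M. \<Prod>j\<in>UNIV. exp (- ((\<alpha> $ j)\<^sup>2 * \<epsilon> / (40 * a\<^sup>2)) * (\<theta> $ j + 2 * pi * of_int (k j))\<^sup>2))"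
    proof -
      have "- ((r k)\<^sup>2 * \<epsilon> / (40 * a\<^sup>2)) = (\<Sum>j\<in>UNIV. - ((\<alpha> $ j)\<^sup>2 * \<epsilon> / (40 * a\<^sup>2)) * (\<theta> $ j + 2 * pi * of_int (k j))\<^sup>2)" for k
        unfolding r2 sum_distrib_right sum_divide_distrib sum_negf[symmetric]
        by (intro sum.cong) (simp_all add: power_mult_distrib mult_ac)
      then have "exp (- ((r k)\<^sup>2 * \<epsilon> / (40 * a\<^sup>2))) = (\<Prod>j\<in>UNIV. exp (- ((\<alpha> $ j)\<^sup>2 * \<epsilon> / (40 * a\<^sup>2)) * (\<theta> $ j + 2 * pi * of_int (k j))\<^sup>2))" for k
        by (simp only: exp_sum[OF finite])
      then show ?thesis unfolding sum_distrib_left by presburger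
    qed
    also have "(\<Sum>k\<in>?K M. \<Prod>j\<in>UNIV. exp (- ((\<alpha> $ j)\<^sup>2 * \<epsilon> / (40 * a\<^sup>2)) * (\<theta> $ j + 2 * pi * of_int (k j))\<^sup>2))
      = (\<Prod>j\<in>UNIV. \<Sum>m\<in>{- int M..int M}. exp (- ((\<alpha> $ j)\<^sup>2 * \<epsilon> / (40 * a\<^sup>2)) * (\<theta> $ j + 2 * pi * of_int m)\<^sup>2))"
      by (rule prod_sum_PiE[symmetric]) auto
    also have "(\<Prod>j\<in>UNIV. \<alpha> $ j) * (D * \<dots>) = D * (\<Prod>j\<in>UNIV. \<alpha> $ j * (\<Sum>m\<in>{- int M..int M}. exp (- ((\<alpha> $ j)\<^sup>2 * \<epsilon> / (40 * a\<^sup>2)) * (\<theta> $ j + 2 * pi * of_int m)\<^sup>2)))"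
      unfolding prod.distrib by simp
    also have "\<dots> \<le> D * (\<Prod>j\<in>(UNIV::'n set). C * (1 + l * a))"
    proof (intro mult_left_mono D prod_mono conjI)
      fix j
      show "0 \<le> \<alpha> $ j * (\<Sum>m\<in>{- int M..int M}. exp (- ((\<alpha> $ j)\<^sup>2 * \<epsilon> / (40 * a\<^sup>2)) * (\<theta> $ j + 2 * pi * of_int m)\<^sup>2))"
        using \<alpha>[of j] by (intro mult_nonneg_nonneg sum_nonneg) auto
      define s where "s = (\<alpha> $ j)\<^sup>2 * \<epsilon> / (40 * a\<^sup>2)"
      have s: "s > 0" using \<alpha>[of j] \<epsilon> a by (simp add: s_def)
      have sq: "sqrt s = \<alpha> $ j / (sqrt 40 * l * a)"
        using \<alpha>[of j] a l by (simp add: s_def \<epsilon>_def real_sqrt_mult real_sqrt_divide field_simps)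
      have "\<alpha> $ j * (\<Sum>m\<in>{- int M..int M}. exp (- s * (\<theta> $ j + 2 * pi * of_int m)\<^sup>2)) \<le> \<alpha> $ j * (2 + 4 / sqrt s)"
        using sum_shifted_gaussians_le[OF s \<theta>] \<alpha>[of j] by (intro mult_left_mono) auto
      also have "\<dots> = 2 * \<alpha> $ j + 4 * sqrt 40 * (l * a)"
        unfolding sq using \<alpha>[of j] by (simp add: field_simps)
      also have "\<dots> \<le> C + C * (l * a)"
      proof (intro add_mono C mult_right_mono)
        have "sqrt 40 \<le> 6.5" by (rule real_le_lsqrt) (auto simp: power2_eq_square)
        then show "4 * sqrt 40 \<le> C" using C(2) by simp
      qed (use l a in auto)
      finally show "\<alpha> $ j * (\<Sum>m\<in>{- int M..int M}. exp (- ((\<alpha> $ j)\<^sup>2 * \<epsilon> / (40 * a\<^sup>2)) * (\<theta> $ j + 2 * pi * of_int m)\<^sup>2)) \<le> C * (1 + l * a)"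
        unfolding s_def by (simp add: algebra_simps)
    qed
    finally show ?thesis by simp
  qed
  have lim: "uniform_limit {a..b} F (kernel_integrand l \<tau> \<alpha> \<theta>) sequentially"
  proof -
    let ?s = "\<lambda>j t. of_real (\<alpha> $ j) * csqrt (of_real pi / z t)"
    have cb: "bounded (g ` {a..b})" if "continuous_on {a..b} g" for g :: "real \<Rightarrow> complex"
      using that by (intro compact_imp_bounded compact_continuous_image) auto
    have uj: "uniform_limit {a..b} (\<lambda>M t. ?s j t * (\<Sum>k\<in>{- int M..int M}. theta_gauss (z t / of_real ((\<alpha> $ j)\<^sup>2)) (\<theta> $ j) k))
       (\<lambda>t. theta (z t / of_real ((\<alpha> $ j)\<^sup>2)) (\<theta> $ j)) sequentially" for j
    proof -
      let ?g = "\<lambda>M t. \<Sum>k\<in>{- int M..int M}. theta_gauss (z t / of_real ((\<alpha> $ j)\<^sup>2)) (\<theta> $ j) k"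
      have ug: "uniform_limit {a..b} ?g (\<lambda>t. theta_dual (z t / of_real ((\<alpha> $ j)\<^sup>2)) (\<theta> $ j)) sequentially"
        unfolding z_def by (rule continuous_on_theta_line(3)[OF \<epsilon>(1) \<alpha>])
      have cg: "continuous_on {a..b} (?g M)" for M
        unfolding theta_gauss_def using z0 \<alpha>[of j] by (intro continuous_intros cz) auto
      have cd: "continuous_on {a..b} (\<lambda>t. theta_dual (z t / of_real ((\<alpha> $ j)\<^sup>2)) (\<theta> $ j))"
        by (rule uniform_limit_theorem[OF _ ug]) (intro always_eventually allI cg, simp)
      have "uniform_limit {a..b} (\<lambda>M t. ?s j t * ?g M t) (\<lambda>t. ?s j t * theta_dual (z t / of_real ((\<alpha> $ j)\<^sup>2)) (\<theta> $ j)) sequentially"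
        by (intro uniform_lim_mult uniform_limit_const ug cb cd continuous_on_mult cs continuous_on_const)
      moreover have "?s j t * theta_dual (z t / of_real ((\<alpha> $ j)\<^sup>2)) (\<theta> $ j) = theta (z t / of_real ((\<alpha> $ j)\<^sup>2)) (\<theta> $ j)" for t
        using csqrt_pi_scaled[OF \<alpha>[of j], of "z t"] \<epsilon> \<alpha>[of j]
        by (subst theta_inversion[OF _ \<theta>]) (auto simp: z_def)
      ultimately show ?thesis by simp
    qed
    have bt: "bounded ((\<lambda>t. theta (z t / of_real ((\<alpha> $ j)\<^sup>2)) (\<theta> $ j)) ` {a..b})" for j
      unfolding z_def by (intro cb continuous_on_theta_line \<epsilon> \<alpha>)
    note up = uniform_limit_prod[where I="UNIV::'n set", OF finite uj bt]
    have "uniform_limit {a..b} F (\<lambda>t. of_real (1 - t / \<tau>) * cis (- (l\<^sup>2 * t)) * (\<Prod>j\<in>UNIV. theta (z t / of_real ((\<alpha> $ j)\<^sup>2)) (\<theta> $ j))) sequentially"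
      unfolding F_def[abs_def]
    proof (rule uniform_lim_mult[OF uniform_limit_const conjunct1[OF up] _ conjunct2[OF up]])
      show "bounded ((\<lambda>t. complex_of_real (1 - t / \<tau>) * cis (- (l\<^sup>2 * t))) ` {a..b})"
        using \<tau> by (intro cb continuous_intros) auto
    qed
    then show ?thesis by (simp add: kernel_integrand_def[abs_def] z_def \<epsilon>_def)
  qed
  have cF: "continuous_on {a..b} (F M)" for M
    unfolding F_expand[abs_def] by (intro continuous_intros cU)
  have "(\<lambda>M. integral {a..b} (F M)) \<longlonglongrightarrow> integral {a..b} (kernel_integrand l \<tau> \<alpha> \<theta>)"
    by (rule integral_uniform_limit[OF lim cF])
  from Lim_bounded[OF tendsto_norm[OF this], of 0 "D * (C * (1 + l * a)) ^ CARD('n)"] F_bound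
  show ?thesis by (simp add: D_def)
qed

lemma kernel_integrand_periodic:
  "kernel_integrand l \<tau> \<alpha> (\<chi> j. \<theta> $ j + 2 * pi * of_int (k j)) = kernel_integrand l \<tau> \<alpha> \<theta>"
  unfolding kernel_integrand_def by (simp add: theta_periodic)

lemma reduce_angle: "\<exists>k::int. x + 2 * pi * of_int k \<in> {0..2*pi}"
proof (intro exI)
  let ?k = "- \<lfloor>x / (2 * pi)\<rfloor>"
  have "of_int \<lfloor>x / (2 * pi)\<rfloor> \<le> x / (2 * pi)" "x / (2 * pi) \<le> of_int \<lfloor>x / (2 * pi)\<rfloor> + 1" by linarith+
  then have "2 * pi * of_int \<lfloor>x / (2 * pi)\<rfloor> \<le> 2 * pi * (x / (2 * pi))"
    "2 * pi * (x / (2 * pi)) \<le> 2 * pi * (of_int \<lfloor>x / (2 * pi)\<rfloor> + 1)"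
    by (intro mult_left_mono; simp)+
  then show "x + 2 * pi * of_int ?k \<in> {0..2*pi}" by (simp add: algebra_simps)
qed

lemma kernel_integrand_reduce:
  fixes \<theta> :: "real ^ 'n"
  obtains \<theta>' :: "real ^ 'n" where "\<And>j. \<theta>' $ j \<in> {0..2*pi}" "kernel_integrand l \<tau> \<alpha> \<theta>' = kernel_integrand l \<tau> \<alpha> \<theta>"
proof -
  have "\<forall>j. \<exists>k::int. \<theta> $ j + 2 * pi * of_int k \<in> {0..2*pi}" using reduce_angle by blast
  then obtain k :: "'n \<Rightarrow> int" where k: "\<And>j. \<theta> $ j + 2 * pi * of_int (k j) \<in> {0..2*pi}" by metis
  show ?thesis
    by (rule that[of "\<chi> j. \<theta> $ j + 2 * pi * of_int (k j)"]) (use k kernel_integrand_periodic in auto)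
qed

text \<open>
  These are \<open>a powr (-(d-1)/2)\<close> and \<open>l powr d * a powr ((d+1)/2)\<close>, the contributions of the Gaussian nearest to the
  point and of the \<open>(l a)\<^sup>d\<close> other ones to the kernel at times of size \<open>a\<close>. With square roots both are natural
  powers, so that doubling \<open>a\<close> is easy to follow.
\<close>

definition near_size :: "nat \<Rightarrow> real \<Rightarrow> real" where "near_size d a = sqrt a / sqrt a ^ d"
definition far_size :: "nat \<Rightarrow> real \<Rightarrow> real \<Rightarrow> real" where "far_size d l a = sqrt a * (l * sqrt a) ^ d"

lemma near_size_nonneg: "near_size d a \<ge> 0" if "a > 0"
  using that by (simp add: near_size_def)

lemma far_size_mono: "far_size d l a \<le> far_size d l b" if "0 \<le> a" "a \<le> b" "l \<ge> 0"
  unfolding far_size_def using that by (intro mult_mono power_mono) auto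

lemma near_size_double: "2 * near_size d (2 * a) \<le> near_size d a" if "a > 0" "d \<ge> 3"
proof -
  obtain e where d: "d = e + 3" using \<open>d \<ge> 3\<close> by (metis add.commute le_Suc_ex)
  have s2: "sqrt 2 ^ 3 = 2 * sqrt 2" by (simp add: power3_eq_cube)
  have "2 * near_size d (2 * a) = near_size d a / sqrt 2 ^ e"
    using that(1) unfolding near_size_def d by (simp add: real_sqrt_mult power_mult_distrib power_add s2)
  also have "\<dots> \<le> near_size d a / 1"
    using that by (intro divide_left_mono near_size_nonneg) (auto intro: one_le_power)
  finally show ?thesis by simp
qed

lemma far_size_double: "2 * far_size d l a \<le> far_size d l (2 * a)" if "a > 0" "d \<ge> 3" "l \<ge> 0"
proof -
  obtain e where d: "d = e + 3" using \<open>d \<ge> 3\<close> by (metis add.commute le_Suc_ex)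
  have s2: "sqrt 2 ^ 3 = 2 * sqrt 2" by (simp add: power3_eq_cube)
  have f: "far_size d l (2 * a) = 4 * sqrt 2 ^ e * far_size d l a"
    unfolding far_size_def d by (simp add: real_sqrt_mult power_mult_distrib power_add s2 mult_ac)
  have "2 * far_size d l a \<le> 4 * sqrt 2 ^ e * far_size d l a"
  proof (rule mult_right_mono)
    have "1 \<le> sqrt 2 ^ e" by (rule one_le_power) simp
    then show "2 \<le> 4 * sqrt 2 ^ e" by linarith
  qed (use that in \<open>simp add: far_size_def\<close>)
  then show ?thesis unfolding f .
qed

lemma power_sum_le: "(x + y) ^ d \<le> 2 ^ d * (x ^ d + y ^ d)" if "x \<ge> 0" "y \<ge> (0::real)"
proof -
  have "(x + y) ^ d \<le> (2 * max x y) ^ d" using that by (intro power_mono) auto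
  also have "\<dots> = 2 ^ d * max x y ^ d" by (simp add: power_mult_distrib)
  also have "max x y ^ d \<le> x ^ d + y ^ d" using that by (simp add: max_def)
  finally show ?thesis by simp
qed

text \<open>
  Along a dyadic sequence of times \<open>near_size\<close> at least halves and \<open>far_size\<close> at least doubles, so the sums
  are dominated by the first and the last term. The subtracted \<open>far_size d l a\<close> makes the induction close.
\<close>

lemma dyadic_summation:
  fixes F :: "real \<Rightarrow> complex"
  assumes F: "continuous_on {0..\<tau>} F" and D: "D \<ge> 0" and d: "d \<ge> 3" and l: "l > 0"
    and dyadic: "\<And>a b. \<epsilon> \<le> a \<Longrightarrow> a \<le> b \<Longrightarrow> b \<le> 2 * a \<Longrightarrow> b \<le> \<tau> \<Longrightarrow> norm (integral {a..b} F) \<le> D * (near_size d a + far_size d l a)"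
    and \<epsilon>: "\<epsilon> > 0"
  shows "\<epsilon> \<le> a \<Longrightarrow> a \<le> b \<Longrightarrow> b \<le> 2 ^ k * a \<Longrightarrow> b \<le> \<tau> \<Longrightarrow>
    norm (integral {a..b} F) \<le> D * (2 * near_size d a + 2 * far_size d l b - far_size d l a)"
proof (induction k arbitrary: a)
  case (0 a)
  then have "a > 0" "b = a" using \<epsilon> by auto
  then show ?case using D l by (auto intro!: mult_nonneg_nonneg add_nonneg_nonneg simp: near_size_def far_size_def)
next
  case (Suc k a)
  have a: "a > 0" using Suc \<epsilon> by linarith
  have n0: "near_size d a \<ge> 0" using a by (rule near_size_nonneg)
  show ?case
  proof (cases "b \<le> 2 * a")
    case True
    have "near_size d a + far_size d l a \<le> 2 * near_size d a + 2 * far_size d l b - far_size d l a"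
      using n0 far_size_mono[of a b l d] a Suc.prems l by simp
    then have "D * (near_size d a + far_size d l a) \<le> D * (2 * near_size d a + 2 * far_size d l b - far_size d l a)"
      using D by (rule mult_left_mono)
    with dyadic[OF Suc.prems(1,2) True Suc.prems(4)] show ?thesis by linarith
  next
    case False
    have "integral {a..b} F = integral {a..2 * a} F + integral {2 * a..b} F"
      using False a Suc.prems \<epsilon> continuous_on_subset[OF F]
      by (intro Henstock_Kurzweil_Integration.integral_combine[symmetric] integrable_continuous_real) auto
    then have "norm (integral {a..b} F) \<le> norm (integral {a..2 * a} F) + norm (integral {2 * a..b} F)"
      using norm_triangle_ineq by metis
    also have "\<dots> \<le> D * (near_size d a + far_size d l a) + D * (2 * near_size d (2 * a) + 2 * far_size d l b - far_size d l (2 * a))"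
      using Suc.prems False a by (intro add_mono dyadic Suc.IH) auto
    also have "\<dots> \<le> D * (2 * near_size d a + 2 * far_size d l b - far_size d l a)"
    proof -
      have "near_size d a + far_size d l a + (2 * near_size d (2 * a) + 2 * far_size d l b - far_size d l (2 * a)) \<le> 2 * near_size d a + 2 * far_size d l b - far_size d l a"
        using near_size_double[OF a d] far_size_double[OF a d, of l] l by simp
      from mult_left_mono[OF this D] show ?thesis by (simp only: distrib_left[of D])
    qed
    finally show ?thesis .
  qed
qed

lemma kernel_dyadic_bound_split:
  fixes \<alpha> \<theta> :: "real ^ 'n"
  assumes l: "l \<ge> 1" and \<alpha>: "\<And>j. \<alpha> $ j > 0"
    and C: "\<And>j. 2 * \<alpha> $ j \<le> C" "26 \<le> C"
    and ab: "1 / l\<^sup>2 \<le> a" "a \<le> b" "b \<le> 2 * a" "b \<le> \<tau>"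
  shows "norm (integral {a..b} (kernel_integrand l \<tau> \<alpha> \<theta>))
     \<le> (18 * (32 + CARD('n)) * (2 * sqrt pi * C) ^ CARD('n) / l) * (near_size CARD('n) a + far_size CARD('n) l a)"
proof -
  let ?d = "CARD('n)"
  obtain \<theta>' :: "real ^ 'n" where \<theta>': "\<And>j. \<theta>' $ j \<in> {0..2*pi}" "kernel_integrand l \<tau> \<alpha> \<theta>' = kernel_integrand l \<tau> \<alpha> \<theta>"
    using kernel_integrand_reduce[where \<theta>=\<theta> and l=l and \<tau>=\<tau> and \<alpha>=\<alpha>] by blast
  have "1 / l\<^sup>2 > 0" using l by simp
  then have a: "a > 0" using ab by linarith
  have "norm (integral {a..b} (kernel_integrand l \<tau> \<alpha> \<theta>))
     \<le> 18 * (32 + CARD('n)) * (sqrt a / l) * sqrt (pi / a) ^ ?d * (C * (1 + l * a)) ^ ?d"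
    using kernel_dyadic_bound[OF l \<alpha> \<theta>'(1) C ab] unfolding \<theta>'(2) .
  also have "\<dots> = 18 * (32 + ?d) / l * (sqrt pi * C) ^ ?d * (sqrt a * (1 / sqrt a + l * sqrt a) ^ ?d)"
  proof -
    have "l * a / sqrt a = l * (a / sqrt a)" by simp
    also have "a / sqrt a = sqrt a" using a by (simp add: real_div_sqrt)
    finally have q: "(1 + l * a) / sqrt a = 1 / sqrt a + l * sqrt a"
      by (simp only: add_divide_distrib)
    have "sqrt (pi / a) * (C * (1 + l * a)) = sqrt pi * C * ((1 + l * a) / sqrt a)"
      by (simp add: real_sqrt_divide mult_ac)
    then have e: "sqrt (pi / a) * (C * (1 + l * a)) = sqrt pi * C * (1 / sqrt a + l * sqrt a)"
      unfolding q .
    have "sqrt (pi / a) ^ ?d * (C * (1 + l * a)) ^ ?d = (sqrt pi * C) ^ ?d * (1 / sqrt a + l * sqrt a) ^ ?d"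
      unfolding power_mult_distrib[symmetric] e ..
    then show ?thesis by (simp add: mult_ac)
  qed
  also have "\<dots> \<le> 18 * (32 + ?d) / l * (sqrt pi * C) ^ ?d * (sqrt a * (2 ^ ?d * ((1 / sqrt a) ^ ?d + (l * sqrt a) ^ ?d)))"
    using a l C(2) by (intro mult_left_mono power_sum_le) auto
  also have "\<dots> = (18 * (32 + CARD('n)) * (2 * sqrt pi * C) ^ CARD('n) / l) * (near_size CARD('n) a + far_size CARD('n) l a)"
    unfolding near_size_def far_size_def by (simp add: power_mult_distrib power_divide algebra_simps)
  finally show ?thesis .
qed

text \<open>
  The interval of integration is split at \<open>max a (1/l\<^sup>2)\<close>: the trivial bound is used before this time, and the dyadic
  bounds after it.
\<close>

theorem kernel_bound:
  fixes \<alpha> :: "real ^ 'n"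
  assumes \<alpha>: "\<And>j. \<alpha> $ j > 0" and d: "CARD('n) \<ge> 3"
  shows "\<exists>B>0. \<forall>l \<tau> a \<theta>. 1 \<le> l \<longrightarrow> 1 / l\<^sup>2 \<le> \<tau> \<longrightarrow> 0 \<le> a \<longrightarrow> a \<le> \<tau> \<longrightarrow>
     norm (integral {a..\<tau>} (kernel_integrand l \<tau> \<alpha> \<theta>))
       \<le> B / l * (near_size CARD('n) (max a (1 / l\<^sup>2)) + far_size CARD('n) l \<tau>)"
proof -
  let ?d = "CARD('n)"
  define C where "C = 26 + (\<Sum>j\<in>UNIV. 4 * \<alpha> $ j)"
  have Cj: "26 + 4 * \<alpha> $ j \<le> C" for j
    unfolding C_def using member_le_sum[of j UNIV "\<lambda>j. 4 * \<alpha> $ j"] \<alpha> by (simp add: less_imp_le)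
  have C: "2 * \<alpha> $ j \<le> C" "1 + 4 * \<alpha> $ j \<le> C" "26 \<le> C" for j
    using Cj[of j] \<alpha>[of j] by linarith+
  define D where "D = 18 * (32 + ?d) * (2 * sqrt pi * C) ^ ?d"
  have D: "D > 0" using C(3) by (simp add: D_def)
  have C0: "C ^ ?d > 0" using C(3) by simp
  define B where "B = C ^ ?d + 2 * D"
  show ?thesis
  proof (intro exI[of _ B] conjI allI impI)
    show "B > 0" using D C0 by (simp add: B_def)
    fix l \<tau> a :: real and \<theta> :: "real ^ 'n"
    assume l: "1 \<le> l" and \<tau>: "1 / l\<^sup>2 \<le> \<tau>" and a: "0 \<le> a" "a \<le> \<tau>"
    define \<epsilon> where "\<epsilon> = 1 / l\<^sup>2"
    have \<epsilon>: "\<epsilon> > 0" using l by (simp add: \<epsilon>_def)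
    have \<tau>0: "\<tau> > 0" using \<tau> \<epsilon> unfolding \<epsilon>_def by linarith
    let ?F = "kernel_integrand l \<tau> \<alpha> \<theta>"
    have cF: "continuous_on {u..v} ?F" for u v
      using l \<tau>0 \<alpha> by (intro kernel_integrand_continuous) auto
    have int: "?F integrable_on {u..v}" for u v by (rule integrable_continuous_real[OF cF])
    define m where "m = max a \<epsilon>"
    have m: "\<epsilon> \<le> m" "a \<le> m" "m \<le> \<tau>" using \<tau> a by (auto simp: m_def \<epsilon>_def)
    have near0: "near_size ?d m \<ge> 0" using m \<epsilon> by (intro near_size_nonneg) linarith
    have far0: "far_size ?d l \<tau> \<ge> 0" using l \<tau>0 by (simp add: far_size_def)
    have 1: "norm (integral {a..m} ?F) \<le> C ^ ?d / l * near_size ?d m"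
    proof (cases "a < \<epsilon>")
      case False
      then have "a = m" by (simp add: m_def)
      then show ?thesis using near0 C0 l by simp
    next
      case True
      then have m\<epsilon>: "m = \<epsilon>" by (simp add: m_def)
      have "norm (integral {a..\<epsilon>} ?F) \<le> (C * l) ^ ?d * (\<epsilon> - a)"
      proof (rule integral_bound)
        show "norm (?F t) \<le> (C * l) ^ ?d" if "t \<in> {a..\<epsilon>}" for t
          using that a \<tau> \<tau>0 by (intro kernel_integrand_norm_le l \<alpha> C) (auto simp: \<epsilon>_def)
      qed (use True cF in auto)
      also have "\<dots> \<le> (C * l) ^ ?d * \<epsilon>" using a l C(3) by (intro mult_left_mono) auto
      also have "\<dots> = C ^ ?d / l * near_size ?d \<epsilon>"
        using l by (simp add: \<epsilon>_def near_size_def real_sqrt_divide power_mult_distrib power_divide power2_eq_square)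
      finally show ?thesis by (simp add: m\<epsilon>)
    qed
    have "((\<lambda>k::nat. \<tau> / 2 ^ k) \<longlonglongrightarrow> 0)" by (rule LIMSEQ_divide_realpow_zero) simp
    then have "\<forall>\<^sub>F k in sequentially. \<tau> / 2 ^ k < m" using m \<epsilon> by (intro order_tendstoD) auto
    then obtain k :: nat where "\<tau> / 2 ^ k < m" by (auto simp: eventually_sequentially)
    then have k: "\<tau> \<le> 2 ^ k * m" by (simp add: divide_less_eq mult.commute)
    have 2: "norm (integral {m..\<tau>} ?F) \<le> (D / l) * (2 * near_size ?d m + 2 * far_size ?d l \<tau> - far_size ?d l m)"
    proof (rule dyadic_summation[where \<epsilon>=\<epsilon> and \<tau>=\<tau>, OF cF _ d _ _ \<epsilon> m(1,3) k])
      show "norm (integral {a..b} ?F) \<le> D / l * (near_size ?d a + far_size ?d l a)"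
        if "\<epsilon> \<le> a" "a \<le> b" "b \<le> 2 * a" "b \<le> \<tau>" for a b
        using kernel_dyadic_bound_split[OF l \<alpha> C(1,3), of a b \<tau> \<theta>] that unfolding \<epsilon>_def D_def by simp
    qed (use D l in auto)
    have far_m: "far_size ?d l m \<ge> 0" using l m \<epsilon> by (simp add: far_size_def)
    have "norm (integral {a..\<tau>} ?F) \<le> norm (integral {a..m} ?F) + norm (integral {m..\<tau>} ?F)"
      using Henstock_Kurzweil_Integration.integral_combine[OF m(2,3) int] norm_triangle_ineq by metis
    also have "\<dots> \<le> C ^ ?d / l * near_size ?d m + (D / l) * (2 * near_size ?d m + 2 * far_size ?d l \<tau> - far_size ?d l m)"
      using 1 2 by linarith
    also have "\<dots> \<le> C ^ ?d / l * (near_size ?d m + far_size ?d l \<tau>) + (D / l) * (2 * near_size ?d m + 2 * far_size ?d l \<tau>)"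
      using far0 far_m C0 D l by (intro add_mono mult_left_mono) auto
    also have "\<dots> = B / l * (near_size ?d m + far_size ?d l \<tau>)"
      unfolding B_def by (simp add: algebra_simps add_divide_distrib)
    finally show "norm (integral {a..\<tau>} ?F) \<le> B / l * (near_size ?d (max a (1 / l\<^sup>2)) + far_size ?d l \<tau>)"
      unfolding m_def \<epsilon>_def .
  qed
qed

section \<open>Characters and eigenfunctions on the torus\<close>

definition torus_char :: "real ^ 'n \<Rightarrow> ('n \<Rightarrow> int) \<Rightarrow> real ^ 'n \<Rightarrow> complex" where
  "torus_char \<alpha> n x = cis (\<Sum>j\<in>UNIV. of_int (n j) * (x $ j / \<alpha> $ j))"

definition torus_freq :: "real ^ 'n \<Rightarrow> ('n \<Rightarrow> int) \<Rightarrow> real" where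
  "torus_freq \<alpha> n = sqrt (\<Sum>j\<in>UNIV. (of_int (n j) / \<alpha> $ j)\<^sup>2)"

abbreviation torus_cell :: "real ^ 'n \<Rightarrow> (real ^ 'n) set" where
  "torus_cell \<alpha> \<equiv> cbox 0 ((2 * pi) *\<^sub>R \<alpha>)"

lemma torus_char_0 [simp]: "torus_char \<alpha> (\<lambda>_. 0) x = 1"
  by (simp add: torus_char_def)

lemma norm_torus_char [simp]: "norm (torus_char \<alpha> n x) = 1"
  by (simp add: torus_char_def)

lemma torus_char_mult: "torus_char \<alpha> n x * torus_char \<alpha> m x = torus_char \<alpha> (\<lambda>j. n j + m j) x"
  by (simp only: torus_char_def cis_mult of_int_add distrib_right sum.distrib)

lemma cnj_torus_char: "cnj (torus_char \<alpha> n x) = torus_char \<alpha> (\<lambda>j. - n j) x"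
  by (simp add: torus_char_def cis_cnj sum_negf)

lemma torus_char_shift:
  fixes \<alpha> :: "real ^ 'n"
  shows "torus_char \<alpha> n (x + t *\<^sub>R axis i 1) = cis (of_int (n i) / \<alpha> $ i * t) * torus_char \<alpha> n x"
proof -
  have "(\<Sum>j\<in>UNIV. of_int (n j) * ((x + t *\<^sub>R axis i 1) $ j / \<alpha> $ j)) =
    (\<Sum>j\<in>UNIV. of_int (n j) * (x $ j / \<alpha> $ j) + (if j = i then of_int (n i) / \<alpha> $ i * t else 0))"
    by (intro sum.cong) (auto simp: axis_def add_divide_distrib distrib_left)
  then show ?thesis by (simp add: torus_char_def sum.distrib cis_mult add.commute)
qed

lemma torus_periodic_char:
  fixes \<alpha> :: "real ^ 'n"
  assumes "\<And>i. \<alpha> $ i > 0"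
  shows "torus_periodic \<alpha> (torus_char \<alpha> n)"
  unfolding torus_periodic_def
proof (intro allI)
  fix x i
  have "axis i (2 * pi * \<alpha> $ i) = (2 * pi * \<alpha> $ i) *\<^sub>R (axis i 1 :: real ^ 'n)"
    by (simp add: vec_eq_iff axis_def)
  moreover have "cis (of_int (n i) / \<alpha> $ i * (2 * pi * \<alpha> $ i)) = 1"
  proof -
    have "of_int (n i) / \<alpha> $ i * (2 * pi * \<alpha> $ i) = 2 * pi * of_int (n i)"
      using less_imp_neq[OF assms[of i], THEN not_sym] by simp
    then show ?thesis by (simp only: cis_multiple_2pi[OF Ints_of_int])
  qed
  ultimately show "torus_char \<alpha> n (x + axis i (2 * pi * \<alpha> $ i)) = torus_char \<alpha> n x"
    by (simp add: torus_char_shift)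
qed

lemma continuous_torus_char [continuous_intros]: "continuous_on S (torus_char \<alpha> n)"
  unfolding torus_char_def[abs_def] divide_inverse by (intro continuous_intros)

lemma torus_char_has_partial_derivative:
  "((\<lambda>t. torus_char \<alpha> n (x + t *\<^sub>R axis i 1)) has_vector_derivative
     (\<i> * of_real (of_int (n i) / \<alpha> $ i) * torus_char \<alpha> n x)) (at 0)"
proof -
  define c where "c = of_int (n i) / \<alpha> $ i"
  have "((\<lambda>t. exp (\<i> * of_real c * t)) has_field_derivative (\<i> * of_real c * exp (\<i> * of_real c * of_real 0))) (at (of_real 0))"
    by (auto intro!: derivative_eq_intros)
  from has_vector_derivative_real_field[OF this]
  have "((\<lambda>t. cis (c * t)) has_vector_derivative \<i> * of_real c) (at 0)"
    by (simp add: cis_conv_exp mult.assoc)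
  from has_vector_derivative_mult_left[OF this, of "torus_char \<alpha> n x"]
  show ?thesis unfolding torus_char_shift c_def[symmetric] .
qed

lemma partial_deriv_torus_char:
  "partial_deriv i (\<lambda>x. c * torus_char \<alpha> n x) = (\<lambda>x. (c * (\<i> * of_real (of_int (n i) / \<alpha> $ i))) * torus_char \<alpha> n x)"
  unfolding partial_deriv_def
proof
  fix x
  from vector_derivative_at[OF has_vector_derivative_mult_right[OF torus_char_has_partial_derivative[of \<alpha> n x i], of c]]
  show "vector_derivative (\<lambda>t. c * torus_char \<alpha> n (x + t *\<^sub>R axis i 1)) (at 0) = (c * (\<i> * of_real (of_int (n i) / \<alpha> $ i))) * torus_char \<alpha> n x"
    by (simp add: mult.assoc)
qed

lemma C_k_torus_char: "C_k k (\<lambda>x. c * torus_char \<alpha> n x)"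
proof (induction k arbitrary: c)
  case 0 show ?case by (auto intro!: continuous_intros)
next
  case (Suc k)
  have "(\<lambda>t. c * torus_char \<alpha> n (x + t *\<^sub>R axis i 1)) differentiable (at 0)" for i x
    using has_vector_derivative_mult_right[OF torus_char_has_partial_derivative[of \<alpha> n x i], of c]
    by (rule differentiableI_vector)
  then show ?case
    unfolding C_k.simps partial_deriv_torus_char by (intro conjI allI Suc.IH continuous_intros)
qed

lemma torus_char_eigenfunction:
  fixes \<alpha> :: "real ^ 'n"
  assumes "\<And>i. \<alpha> $ i > 0"
  shows "torus_char \<alpha> n \<in> sqrt_laplacian_eigenspace \<alpha> (torus_freq \<alpha> n)"
proof -
  define c where "c i = \<i> * complex_of_real (of_int (n i) / \<alpha> $ i)" for i
  have p1: "partial_deriv i (torus_char \<alpha> n) = (\<lambda>x. c i * torus_char \<alpha> n x)" for i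
    using partial_deriv_torus_char[of i 1 \<alpha> n] unfolding mult_1 c_def .
  have p2: "partial_deriv i (\<lambda>x. c i * torus_char \<alpha> n x) = (\<lambda>x. c i * c i * torus_char \<alpha> n x)" for i
    using partial_deriv_torus_char[of i "c i" \<alpha> n] unfolding c_def .
  have cc: "c i * c i = - of_real ((of_int (n i) / \<alpha> $ i)\<^sup>2)" for i
    by (simp only: c_def power2_eq_square[symmetric] power_mult_distrib power2_i of_real_power) simp
  have "\<not> torus_freq \<alpha> n < 0" by (simp add: torus_freq_def sum_nonneg not_less)
  moreover have "- laplacian (torus_char \<alpha> n) x = of_real ((torus_freq \<alpha> n)\<^sup>2) * torus_char \<alpha> n x" for x
  proof -
    have "laplacian (torus_char \<alpha> n) x = (\<Sum>i\<in>UNIV. - of_real ((of_int (n i) / \<alpha> $ i)\<^sup>2) * torus_char \<alpha> n x)"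
      unfolding laplacian_def p1 p2 cc ..
    also have "\<dots> = - (of_real (\<Sum>i\<in>UNIV. (of_int (n i) / \<alpha> $ i)\<^sup>2)) * torus_char \<alpha> n x"
      by (simp add: sum_distrib_right sum_negf)
    also have "(\<Sum>i\<in>UNIV. (of_int (n i) / \<alpha> $ i)\<^sup>2) = (torus_freq \<alpha> n)\<^sup>2"
      by (simp add: torus_freq_def sum_nonneg)
    finally show ?thesis by simp
  qed
  moreover have "C_k k (torus_char \<alpha> n)" for k using C_k_torus_char[of k 1 \<alpha> n] by simp
  ultimately show ?thesis
    using torus_periodic_char[OF assms] by (simp add: sqrt_laplacian_eigenspace_def)
qed

text \<open>
  Translate the cell instead of the function. The part of the translated cell that sticks out on one side is
  moved back by a period, where it fills the gap on the other side.
\<close>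

lemma integral_translate_periodic:
  fixes \<alpha> :: "real ^ 'n" and G :: "real ^ 'n \<Rightarrow> complex"
  assumes \<alpha>: "\<And>i. \<alpha> $ i > 0" and per: "torus_periodic \<alpha> G" and cont: "continuous_on UNIV G"
    and t: "0 \<le> t" "t \<le> 2 * pi * \<alpha> $ i"
  shows "integral (torus_cell \<alpha>) (\<lambda>x. G (x + t *\<^sub>R axis i 1)) = integral (torus_cell \<alpha>) G"
proof -
  define L where "L = (2 * pi) *\<^sub>R \<alpha>"
  define v where "v = t *\<^sub>R (axis i 1 :: real ^ 'n)"
  have L: "L $ j > 0" for j using \<alpha>[of j] by (simp add: L_def)
  have ti: "0 \<le> t" "t \<le> L $ i" using t by (auto simp: L_def)
  have int: "G integrable_on cbox a b" for a b
    by (intro integrable_continuous continuous_on_subset[OF cont]) auto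
  have v: "v $ j = (if j = i then t else 0)" for j by (simp add: v_def axis_def)
  have ax: "axis i 1 \<in> (Basis :: (real ^ 'n) set)" by (simp add: axis_in_Basis_iff)
  have ia: "x \<bullet> axis i 1 = x $ i" for x :: "real ^ 'n" by (simp add: inner_axis)
  define w where "w = (\<chi> j. if j = i then L $ i else (0::real))"
  define Lt where "Lt = (\<chi> j. if j = i then t else L $ j)"
  have le: "cbox a b \<inter> {x. x \<bullet> axis i 1 \<le> c} = {x. \<forall>j. a $ j \<le> x $ j \<and> x $ j \<le> b $ j \<and> (j = i \<longrightarrow> x $ j \<le> c)}"
    and ge: "cbox a b \<inter> {x. x \<bullet> axis i 1 \<ge> c} = {x. \<forall>j. a $ j \<le> x $ j \<and> x $ j \<le> b $ j \<and> (j = i \<longrightarrow> x $ j \<ge> c)}"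
    and bx: "cbox a b = {x. \<forall>j. a $ j \<le> x $ j \<and> x $ j \<le> b $ j}" for a b :: "real ^ 'n" and c
    by (auto simp: mem_box_cart ia)
  have "integral (cbox 0 L) (\<lambda>x. G (x + v)) = integral (cbox v (L + v)) G"
    using integral_shift_cbox_plus[of 0 L G v] by (simp add: o_def add.commute)
  also have "\<dots> = integral (cbox v (L + v) \<inter> {x. x \<bullet> axis i 1 \<le> L $ i}) G + integral (cbox v (L + v) \<inter> {x. x \<bullet> axis i 1 \<ge> L $ i}) G"
    by (rule integral_split[OF int ax])
  also have "cbox v (L + v) \<inter> {x. x \<bullet> axis i 1 \<le> L $ i} = cbox v L"
    unfolding le ge unfolding bx using ti L
    by (intro Collect_cong all_cong1) (auto simp: v w_def Lt_def intro: order_trans)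
  also have "cbox v (L + v) \<inter> {x. x \<bullet> axis i 1 \<ge> L $ i} = cbox (0 + w) (Lt + w)"
    unfolding le ge unfolding bx using ti L
    by (intro Collect_cong all_cong1) (auto simp: v w_def Lt_def intro: order_trans)
  also have "integral (cbox (0 + w) (Lt + w)) G = integral (cbox 0 Lt) (\<lambda>x. G (x + w))"
    using integral_shift_cbox_plus[of 0 Lt G w] by (simp add: o_def add.commute)
  also have "(\<lambda>x. G (x + w)) = G"
  proof -
    have "w = axis i (2 * pi * \<alpha> $ i)" by (simp add: vec_eq_iff w_def axis_def L_def)
    then show ?thesis using per unfolding torus_periodic_def by auto
  qed
  also have "cbox v L = cbox 0 L \<inter> {x. x \<bullet> axis i 1 \<ge> t}"
    unfolding le ge unfolding bx using ti L
    by (intro Collect_cong all_cong1) (auto simp: v w_def Lt_def intro: order_trans)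
  also have "cbox 0 Lt = cbox 0 L \<inter> {x. x \<bullet> axis i 1 \<le> t}"
    unfolding le ge unfolding bx using ti L
    by (intro Collect_cong all_cong1) (auto simp: v w_def Lt_def intro: order_trans)
  also have "integral (cbox 0 L \<inter> {x. x \<bullet> axis i 1 \<ge> t}) G + integral (cbox 0 L \<inter> {x. x \<bullet> axis i 1 \<le> t}) G = integral (cbox 0 L) G"
    using integral_split[OF int ax, of 0 L t] by simp
  finally show ?thesis unfolding L_def v_def .
qed

lemma has_vector_derivative_along_line:
  fixes e :: "'a::real_normed_vector"
  assumes "\<And>x. ((\<lambda>t. u (x + t *\<^sub>R e)) has_vector_derivative u' x) (at 0)"
  shows "((\<lambda>t. u (x + t *\<^sub>R e)) has_vector_derivative u' (x + s *\<^sub>R e)) (at s within S)"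
proof -
  have 1: "((\<lambda>t. t - s) has_vector_derivative 1) (at s)"
    by (auto intro!: derivative_eq_intros)
  have "((\<lambda>t. u ((x + s *\<^sub>R e) + t *\<^sub>R e)) has_vector_derivative u' (x + s *\<^sub>R e)) (at (s - s))"
    using assms[of "x + s *\<^sub>R e"] by simp
  have eq: "x + s *\<^sub>R e + (t - s) *\<^sub>R e = x + t *\<^sub>R e" for t
    by (simp add: algebra_simps)
  from vector_diff_chain_at[OF 1 \<open>((\<lambda>t. u ((x + s *\<^sub>R e) + t *\<^sub>R e)) has_vector_derivative u' (x + s *\<^sub>R e)) (at (s - s))\<close>]
  have "((\<lambda>t. u (x + t *\<^sub>R e)) has_vector_derivative u' (x + s *\<^sub>R e)) (at s)"
    unfolding o_def eq by simp
  then show ?thesis by (rule has_vector_derivative_at_within)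
qed

text \<open>
  The integral over the cell of a translate of \<open>G\<close> does not depend on the translation. Differentiate under the integral
  sign at translation 0. Applied to characters this gives their orthogonality, and applied to
  products with characters the formula for the Fourier coefficients of a derivative.
\<close>

lemma integral_partial_derivative_zero:
  fixes \<alpha> :: "real ^ 'n" and G G' :: "real ^ 'n \<Rightarrow> complex"
  assumes \<alpha>: "\<And>i. \<alpha> $ i > 0" and per: "torus_periodic \<alpha> G" and cont: "continuous_on UNIV G" "continuous_on UNIV G'"
    and d: "\<And>x. ((\<lambda>t. G (x + t *\<^sub>R axis i 1)) has_vector_derivative G' x) (at 0)"
  shows "integral (torus_cell \<alpha>) G' = 0"
proof -
  define U where "U = {0..2 * pi * \<alpha> $ i}"
  let ?J = "\<lambda>t. integral (torus_cell \<alpha>) (\<lambda>x. G (x + t *\<^sub>R axis i 1))"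
  have p: "0 < 2 * pi * \<alpha> $ i" using \<alpha>[of i] by simp
  have "(?J has_vector_derivative integral (torus_cell \<alpha>) (\<lambda>x. G' (x + 0 *\<^sub>R axis i 1))) (at 0 within U)"
  proof (rule leibniz_rule_vector_derivative)
    show "((\<lambda>s. G (x + s *\<^sub>R axis i 1)) has_vector_derivative G' (x + t *\<^sub>R axis i 1)) (at t within U)" for x t
      by (rule has_vector_derivative_along_line[OF d])
    show "(\<lambda>x. G (x + t *\<^sub>R axis i 1)) integrable_on torus_cell \<alpha>" for t
      by (intro integrable_continuous continuous_on_compose2[OF cont(1)] continuous_intros) auto
    have "continuous_on (U \<times> torus_cell \<alpha>) (\<lambda>p. G' (snd p + fst p *\<^sub>R axis i 1))"
      by (intro continuous_on_compose2[OF cont(2)] continuous_intros) auto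
    then show "continuous_on (U \<times> torus_cell \<alpha>) (\<lambda>(t, x). G' (x + t *\<^sub>R axis i 1))"
      by (simp add: case_prod_unfold)
  qed (use p in \<open>auto simp: U_def\<close>)
  then have 1: "(?J has_vector_derivative integral (torus_cell \<alpha>) G') (at 0 within U)" by simp
  have "((\<lambda>t. integral (torus_cell \<alpha>) G) has_vector_derivative 0) (at 0 within U)" by simp
  then have 2: "(?J has_vector_derivative 0) (at 0 within U)"
    by (rule has_vector_derivative_transform[rotated 2])
      (use p in \<open>auto simp: U_def intro!: integral_translate_periodic[OF \<alpha> per cont(1)]\<close>)
  show ?thesis
    using vector_derivative_unique_within[OF _ 1 2] p trivial_limit_within[of 0 U]
    by (metis U_def islimpt_Icc atLeastAtMost_iff less_eq_real_def)
qed

lemma integral_torus_char: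
  fixes \<alpha> :: "real ^ 'n"
  assumes \<alpha>: "\<And>i. \<alpha> $ i > 0"
  shows "integral (torus_cell \<alpha>) (torus_char \<alpha> n) = (if n = (\<lambda>_. 0) then of_real (measure lebesgue (torus_cell \<alpha>)) else 0)"
proof (cases "n = (\<lambda>_. 0)")
  case True
  then have "torus_char \<alpha> n = (\<lambda>x. 1)" by auto
  then show ?thesis using True by (simp add: content_eq_0 scaleR_conv_of_real)
next
  case False
  then obtain i where i: "n i \<noteq> 0" by auto
  let ?c = "\<i> * complex_of_real (of_int (n i) / \<alpha> $ i)"
  have "integral (torus_cell \<alpha>) (\<lambda>x. ?c * torus_char \<alpha> n x) = 0"
    by (rule integral_partial_derivative_zero[OF \<alpha> torus_periodic_char[OF \<alpha>] _ _ torus_char_has_partial_derivative])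
      (intro continuous_on_mult continuous_on_const continuous_torus_char)+
  moreover have "?c \<noteq> 0" using i less_imp_neq[OF \<alpha>[of i], THEN not_sym] by simp
  ultimately show ?thesis using False by simp
qed

lemma fourier_coefficient_partial_derivative:
  fixes \<alpha> :: "real ^ 'n"
  assumes \<alpha>: "\<And>i. \<alpha> $ i > 0" and per: "torus_periodic \<alpha> u" and cont: "continuous_on UNIV u" "continuous_on UNIV u'"
    and d: "\<And>x. ((\<lambda>t. u (x + t *\<^sub>R axis i 1)) has_vector_derivative u' x) (at 0)"
  shows "integral (torus_cell \<alpha>) (\<lambda>x. u' x * torus_char \<alpha> n x) =
    - (\<i> * of_real (of_int (n i) / \<alpha> $ i)) * integral (torus_cell \<alpha>) (\<lambda>x. u x * torus_char \<alpha> n x)"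
proof -
  let ?c = "\<i> * complex_of_real (of_int (n i) / \<alpha> $ i)"
  have "integral (torus_cell \<alpha>) (\<lambda>x. u x * (?c * torus_char \<alpha> n x) + u' x * torus_char \<alpha> n x) = 0"
  proof (rule integral_partial_derivative_zero[OF \<alpha>])
    show "torus_periodic \<alpha> (\<lambda>x. u x * torus_char \<alpha> n x)"
      using per torus_periodic_char[OF \<alpha>] by (simp add: torus_periodic_def)
    show "((\<lambda>t. u (x + t *\<^sub>R axis i 1) * torus_char \<alpha> n (x + t *\<^sub>R axis i 1)) has_vector_derivative
       u x * (?c * torus_char \<alpha> n x) + u' x * torus_char \<alpha> n x) (at 0)" for x
      using has_vector_derivative_mult[OF d torus_char_has_partial_derivative, of x \<alpha> n] by simp
  qed (intro continuous_intros cont)+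
  moreover have "(\<lambda>x. u' x * torus_char \<alpha> n x) integrable_on torus_cell \<alpha>" "(\<lambda>x. ?c * (u x * torus_char \<alpha> n x)) integrable_on torus_cell \<alpha>"
    by (intro integrable_continuous continuous_intros continuous_on_subset[OF cont(1)] continuous_on_subset[OF cont(2)]; simp)+
  then have "integral (torus_cell \<alpha>) (\<lambda>x. ?c * (u x * torus_char \<alpha> n x) + u' x * torus_char \<alpha> n x)
    = ?c * integral (torus_cell \<alpha>) (\<lambda>x. u x * torus_char \<alpha> n x) + integral (torus_cell \<alpha>) (\<lambda>x. u' x * torus_char \<alpha> n x)"
    by (subst integral_add) auto
  ultimately show ?thesis by (simp add: mult_ac add_eq_0_iff)
qed

lemma axis_eq_scaleR: "axis i c = c *\<^sub>R (axis i 1 :: real ^ 'n)"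
  by (simp add: vec_eq_iff axis_def)

lemma torus_periodic_multiple:
  fixes \<alpha> :: "real ^ 'n"
  assumes per: "torus_periodic \<alpha> u"
  shows "u (x + axis i (2 * pi * \<alpha> $ i * of_int k)) = u x"
proof (induction k arbitrary: x rule: int_induct[where k=0])
  case base then show ?case by (simp add: axis_eq_scaleR[of i 0])
next
  case (step1 k)
  have "x + axis i (2 * pi * \<alpha> $ i * of_int (k + 1)) = (x + axis i (2 * pi * \<alpha> $ i * of_int k)) + axis i (2 * pi * \<alpha> $ i)"
    by (simp add: vec_eq_iff axis_def algebra_simps)
  then show ?case using step1.IH per by (simp only: torus_periodic_def)
next
  case (step2 k)
  have "u (x + axis i (2 * pi * \<alpha> $ i * of_int (k - 1))) = u ((x + axis i (2 * pi * \<alpha> $ i * of_int (k - 1))) + axis i (2 * pi * \<alpha> $ i))"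
    using per by (simp only: torus_periodic_def)
  also have "(x + axis i (2 * pi * \<alpha> $ i * of_int (k - 1))) + axis i (2 * pi * \<alpha> $ i) = x + axis i (2 * pi * \<alpha> $ i * of_int k)"
    by (simp add: vec_eq_iff axis_def algebra_simps)
  finally show ?case using step2.IH by simp
qed

lemma torus_periodic_lattice:
  fixes \<alpha> :: "real ^ 'n"
  assumes per: "torus_periodic \<alpha> u"
  shows "u (x + (\<chi> j. 2 * pi * \<alpha> $ j * of_int (k j))) = u x"
proof -
  have "u (x + (\<Sum>j\<in>J. axis j (2 * pi * \<alpha> $ j * of_int (k j)))) = u x" if "finite J" for J
    using that
  proof (induction J)
    case (insert j J)
    then have "u (x + (\<Sum>j\<in>insert j J. axis j (2 * pi * \<alpha> $ j * of_int (k j)))) =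
       u ((x + (\<Sum>j\<in>J. axis j (2 * pi * \<alpha> $ j * of_int (k j)))) + axis j (2 * pi * \<alpha> $ j * of_int (k j)))"
      by (simp add: ac_simps)
    then show ?case using insert.IH torus_periodic_multiple[OF per] by simp
  qed simp
  from this[of UNIV] have "u (x + (\<Sum>j\<in>UNIV. axis j (2 * pi * \<alpha> $ j * of_int (k j)))) = u x" by simp
  moreover have "(\<Sum>j\<in>UNIV. axis j (2 * pi * \<alpha> $ j * of_int (k j))) = (\<chi> j. 2 * pi * \<alpha> $ j * of_int (k j))"
    by (simp add: vec_eq_iff axis_def)
  ultimately show ?thesis by simp
qed

text \<open>
  The representative \<open>y\<close> in the cell serves all periodic functions at once.
\<close>

lemma torus_periodic_reduce:
  fixes \<alpha> :: "real ^ 'n"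
  assumes \<alpha>: "\<And>i. \<alpha> $ i > 0"
  obtains y where "y \<in> torus_cell \<alpha>" "\<And>u. torus_periodic \<alpha> u \<Longrightarrow> u y = u x"
proof -
  define k where "k j = - \<lfloor>x $ j / (2 * pi * \<alpha> $ j)\<rfloor>" for j
  define y where "y = x + (\<chi> j. 2 * pi * \<alpha> $ j * of_int (k j))"
  have "0 \<le> y $ j \<and> y $ j \<le> 2 * pi * \<alpha> $ j" for j
  proof -
    define L where "L = 2 * pi * \<alpha> $ j"
    have L: "L > 0" using \<alpha>[of j] by (simp add: L_def)
    have "of_int \<lfloor>x $ j / L\<rfloor> \<le> x $ j / L" "x $ j / L \<le> of_int \<lfloor>x $ j / L\<rfloor> + 1" by linarith+
    then have "L * of_int \<lfloor>x $ j / L\<rfloor> \<le> L * (x $ j / L)" "L * (x $ j / L) \<le> L * (of_int \<lfloor>x $ j / L\<rfloor> + 1)"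
      using L by (intro mult_left_mono; simp)+
    moreover have "L * (x $ j / L) = x $ j" using L by simp
    moreover have "y $ j = x $ j - L * of_int \<lfloor>x $ j / L\<rfloor>" unfolding y_def k_def L_def by simp
    ultimately show ?thesis unfolding L_def[symmetric] distrib_left by linarith
  qed
  then have "y \<in> torus_cell \<alpha>" by (simp add: mem_box_cart)
  then show ?thesis
    by (rule that) (simp add: y_def torus_periodic_lattice)
qed

lemma torus_cell_box_nonempty:
  fixes \<alpha> :: "real ^ 'n"
  assumes \<alpha>: "\<And>i. \<alpha> $ i > 0"
  shows "box 0 ((2 * pi) *\<^sub>R \<alpha>) \<noteq> {}"
proof -
  have "pi *\<^sub>R \<alpha> \<in> box 0 ((2 * pi) *\<^sub>R \<alpha>)" using \<alpha> by (simp add: mem_box_cart)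
  then show ?thesis by blast
qed

text \<open>
  The map \<open>h\<close> wraps the cell onto a product of circles, and its coordinates act on
  characters by shifting a frequency by \<open>\<plusminus>1\<close>.
\<close>

lemma torus_fourier_uniqueness:
  fixes \<alpha> :: "real ^ 'n"
  assumes \<alpha>: "\<And>i. \<alpha> $ i > 0" and per: "torus_periodic \<alpha> u" and u: "continuous_on UNIV u"
    and orth: "\<And>n. integral (torus_cell \<alpha>) (\<lambda>x. u x * torus_char \<alpha> n x) = 0"
  shows "u = (\<lambda>x. 0)"
proof
  fix x
  define h where "h y = (\<chi> j. cis (y $ j / \<alpha> $ j))" for y :: "real ^ 'n"
  obtain y where y: "y \<in> torus_cell \<alpha>" "u y = u x"
    using torus_periodic_reduce[OF \<alpha>, of x] per by metis
  have "u y = 0"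
  proof (rule orthogonal_to_characters_imp_zero[where h=h and e="torus_char \<alpha>" and ?n0.0="\<lambda>_. 0", OF torus_cell_box_nonempty[OF \<alpha>]])
    show "continuous_on (torus_cell \<alpha>) h"
      unfolding h_def divide_inverse by (intro continuous_intros)
    show "continuous_on (torus_cell \<alpha>) (torus_char \<alpha> n)" for n by (intro continuous_intros)
    show "continuous_on (torus_cell \<alpha>) u" by (rule continuous_on_subset[OF u]) simp
    show "\<exists>p q c d. \<forall>n x. complex_of_real (h x \<bullet> j) * torus_char \<alpha> n x = c * torus_char \<alpha> (p n) x + d * torus_char \<alpha> (q n) x"
      if "j \<in> Basis" for j
    proof -
      obtain i b where j: "j = axis i b" "b \<in> Basis" using \<open>j \<in> Basis\<close> by (auto simp: Basis_vec_def)
      have shift: "cis (x $ i / \<alpha> $ i) * torus_char \<alpha> n x = torus_char \<alpha> (n(i := n i + 1)) x"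
        "cis (- (x $ i / \<alpha> $ i)) * torus_char \<alpha> n x = torus_char \<alpha> (n(i := n i - 1)) x" for n x
      proof -
        have "(\<Sum>k\<in>UNIV. of_int ((n(i := n i + s)) k) * (x $ k / \<alpha> $ k)) =
          (\<Sum>k\<in>UNIV. of_int (n k) * (x $ k / \<alpha> $ k) + (if k = i then of_int s * (x $ i / \<alpha> $ i) else 0))" for s
          by (intro sum.cong) (auto simp: distrib_right add_divide_distrib)
        then have *: "(\<Sum>k\<in>UNIV. of_int ((n(i := n i + s)) k) * (x $ k / \<alpha> $ k)) = of_int s * (x $ i / \<alpha> $ i) + (\<Sum>k\<in>UNIV. of_int (n k) * (x $ k / \<alpha> $ k))" for s
          by (simp add: sum.distrib)
        show "cis (x $ i / \<alpha> $ i) * torus_char \<alpha> n x = torus_char \<alpha> (n(i := n i + 1)) x"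
          unfolding torus_char_def *[of 1] cis_mult by simp
        show "cis (- (x $ i / \<alpha> $ i)) * torus_char \<alpha> n x = torus_char \<alpha> (n(i := n i - 1)) x"
          using *[of "-1"] unfolding torus_char_def cis_mult by simp
      qed
      have co: "complex_of_real (cos t) = (1/2) * cis t + (1/2) * cis (- t)"
        and si: "complex_of_real (sin t) = (- \<i>/2) * cis t + (\<i>/2) * cis (- t)" for t
        by (simp_all add: complex_eq_iff)
      have hj: "h x \<bullet> j = cis (x $ i / \<alpha> $ i) \<bullet> b" for x by (simp add: j h_def inner_axis)
      have b: "b = 1 \<or> b = \<i>" using j(2) by (auto simp: Basis_complex_def)
      then show ?thesis
      proof
        assume "b = 1"
        then have hj': "h x \<bullet> j = cos (x $ i / \<alpha> $ i)" for x unfolding hj by (simp add: inner_complex_def)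
        show ?thesis unfolding hj' co distrib_right mult.assoc shift by (intro exI allI) (rule refl)
      next
        assume "b = \<i>"
        then have hj': "h x \<bullet> j = sin (x $ i / \<alpha> $ i)" for x unfolding hj by (simp add: inner_complex_def)
        show ?thesis unfolding hj' si distrib_right mult.assoc shift by (intro exI allI) (rule refl)
      qed
    qed
    show "u x = u y" if xy: "x \<in> torus_cell \<alpha>" "y \<in> torus_cell \<alpha>" "h x = h y" for x y
    proof -
      have "\<exists>k::int. y $ j = x $ j + 2 * pi * \<alpha> $ j * of_int k" for j
      proof -
        have "cis (x $ j / \<alpha> $ j) = cis (y $ j / \<alpha> $ j)" using xy(3) by (simp add: h_def vec_eq_iff)
        then have "sin (y $ j / \<alpha> $ j) = sin (x $ j / \<alpha> $ j) \<and> cos (y $ j / \<alpha> $ j) = cos (x $ j / \<alpha> $ j)"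
          by (simp add: complex_eq_iff)
        then obtain k :: int where "y $ j / \<alpha> $ j = x $ j / \<alpha> $ j + 2 * pi * of_int k"
          by (metis sin_cos_eq_iff mult.commute)
        then have "y $ j = \<alpha> $ j * (x $ j / \<alpha> $ j + 2 * pi * of_int k)"
          using less_imp_neq[OF \<alpha>[of j], THEN not_sym] by (simp add: field_simps)
        then show ?thesis using less_imp_neq[OF \<alpha>[of j], THEN not_sym] by (intro exI[of _ k]) (simp add: algebra_simps)
      qed
      then obtain k :: "'n \<Rightarrow> int" where "\<And>j. y $ j = x $ j + 2 * pi * \<alpha> $ j * of_int (k j)" by metis
      then have "y = x + (\<chi> j. 2 * pi * \<alpha> $ j * of_int (k j))" by (simp add: vec_eq_iff)
      then show ?thesis using torus_periodic_lattice[OF per] by simp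
    qed
  qed (use y orth in auto)
  then show "u x = 0" using y by simp
qed

lemma torus_freq_nonneg: "torus_freq \<alpha> n \<ge> 0"
  by (simp add: torus_freq_def sum_nonneg)

lemma torus_freq_sq: "(torus_freq \<alpha> n)\<^sup>2 = (\<Sum>j\<in>UNIV. (of_int (n j) / \<alpha> $ j)\<^sup>2)"
  by (simp add: torus_freq_def sum_nonneg)

lemma torus_freq_coordinate_le:
  fixes \<alpha> :: "real ^ 'n"
  assumes \<alpha>: "\<And>i. \<alpha> $ i > 0"
  shows "\<bar>real_of_int (n j)\<bar> \<le> torus_freq \<alpha> n * \<alpha> $ j"
proof -
  have "(of_int (n j) / \<alpha> $ j)\<^sup>2 \<le> (torus_freq \<alpha> n)\<^sup>2"
    unfolding torus_freq_sq by (rule member_le_sum) auto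
  then have "\<bar>of_int (n j) / \<alpha> $ j\<bar> \<le> torus_freq \<alpha> n"
    using torus_freq_nonneg[of \<alpha> n] unfolding abs_le_square_iff[symmetric] by simp
  then show ?thesis using \<alpha>[of j] by (simp add: abs_divide divide_le_eq)
qed

lemma torus_freq_le_box:
  fixes \<alpha> :: "real ^ 'n"
  assumes \<alpha>: "\<And>i. \<alpha> $ i > 0"
  shows "\<exists>M0. \<forall>M\<ge>M0. {n. torus_freq \<alpha> n \<le> R} \<subseteq> PiE UNIV (\<lambda>_. {- int M..int M})"
proof (intro exI allI impI subsetI)
  fix M n assume M: "nat \<lceil>R * (\<Sum>j\<in>UNIV. \<alpha> $ j)\<rceil> \<le> M" and n: "n \<in> {n. torus_freq \<alpha> n \<le> R}"
  have "n j \<in> {- int M..int M}" for j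
  proof -
    have R: "R \<ge> 0" using n torus_freq_nonneg[of \<alpha> n] by simp
    have "\<bar>real_of_int (n j)\<bar> \<le> torus_freq \<alpha> n * \<alpha> $ j" by (rule torus_freq_coordinate_le[OF \<alpha>])
    also have "\<dots> \<le> R * (\<Sum>j\<in>UNIV. \<alpha> $ j)"
      using n R \<alpha> by (intro mult_mono member_le_sum) (auto intro: less_imp_le)
    also have "\<dots> \<le> real M" using M by linarith
    finally show ?thesis by auto
  qed
  then show "n \<in> PiE UNIV (\<lambda>_. {- int M..int M})" by auto
qed

lemma finite_torus_freq_le:
  fixes \<alpha> :: "real ^ 'n"
  assumes \<alpha>: "\<And>i. \<alpha> $ i > 0"
  shows "finite {n. torus_freq \<alpha> n \<le> R}"
proof -
  obtain M0 where "{n. torus_freq \<alpha> n \<le> R} \<subseteq> PiE UNIV (\<lambda>_. {- int M0..int M0})"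
    using torus_freq_le_box[OF \<alpha>, of R] by blast
  moreover have "finite (PiE (UNIV::'n set) (\<lambda>_. {- int M0..int M0}))" by (intro finite_PiE) auto
  ultimately show ?thesis by (rule finite_subset)
qed

lemma partial_deriv_has_vector_derivative:
  assumes "(\<lambda>t. u (x + t *\<^sub>R axis i 1)) differentiable (at 0)"
  shows "((\<lambda>t. u (x + t *\<^sub>R axis i 1)) has_vector_derivative partial_deriv i u x) (at 0)"
  using assms by (simp add: partial_deriv_def vector_derivative_works)

lemma torus_periodic_partial_deriv:
  assumes "torus_periodic \<alpha> u"
  shows "torus_periodic \<alpha> (partial_deriv i u)"
proof -
  have "u (x + axis j (2 * pi * \<alpha> $ j) + t *\<^sub>R axis i 1) = u (x + t *\<^sub>R axis i 1)" for x j t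
    using assms unfolding torus_periodic_def by (metis add.commute add.left_commute)
  then show ?thesis unfolding torus_periodic_def partial_deriv_def by simp
qed

text \<open>
  Integrating by parts twice in every coordinate multiplies a Fourier coefficient of \<open>u\<close> by the square of its
  frequency, while the eigenvalue equation multiplies it by \<open>\<mu>\<^sup>2\<close>.
\<close>

lemma eigenfunction_fourier_coefficient:
  fixes \<alpha> :: "real ^ 'n"
  assumes \<alpha>: "\<And>i. \<alpha> $ i > 0" and \<mu>: "\<mu> \<ge> 0" and u: "u \<in> sqrt_laplacian_eigenspace \<alpha> \<mu>"
    and n: "torus_freq \<alpha> n \<noteq> \<mu>"
  shows "integral (torus_cell \<alpha>) (\<lambda>x. u x * torus_char \<alpha> n x) = 0"
proof -
  let ?I = "\<lambda>f. integral (torus_cell \<alpha>) (\<lambda>x. f x * torus_char \<alpha> n x)"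
  have per: "torus_periodic \<alpha> u" and smooth: "C_k k u" and eig: "- laplacian u x = of_real (\<mu>\<^sup>2) * u x" for k x
    using u \<mu> by (auto simp: sqrt_laplacian_eigenspace_def)
  have C: "continuous_on UNIV u" "continuous_on UNIV (partial_deriv i u)" "continuous_on UNIV (partial_deriv i (partial_deriv i u))"
    "(\<lambda>t. u (x + t *\<^sub>R axis i 1)) differentiable (at 0)" "(\<lambda>t. partial_deriv i u (x + t *\<^sub>R axis i 1)) differentiable (at 0)" for i x
    using smooth[of "Suc (Suc 0)"] by auto
  have "?I (partial_deriv i (partial_deriv i u)) = - of_real ((of_int (n i) / \<alpha> $ i)\<^sup>2) * ?I u" for i
  proof -
    let ?c = "\<i> * complex_of_real (of_int (n i) / \<alpha> $ i)"
    have "?I (partial_deriv i (partial_deriv i u)) = - ?c * ?I (partial_deriv i u)"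
      by (rule fourier_coefficient_partial_derivative[OF \<alpha> torus_periodic_partial_deriv[OF per] C(2,3) partial_deriv_has_vector_derivative[OF C(5)]])
    also have "?I (partial_deriv i u) = - ?c * ?I u"
      by (rule fourier_coefficient_partial_derivative[OF \<alpha> per C(1,2) partial_deriv_has_vector_derivative[OF C(4)]])
    also have "- ?c * (- ?c * ?I u) = (?c)\<^sup>2 * ?I u" by (simp add: power2_eq_square)
    also have "?c\<^sup>2 = - of_real ((of_int (n i) / \<alpha> $ i)\<^sup>2)" by (simp only: power_mult_distrib power2_i of_real_power) simp
    finally show ?thesis .
  qed
  then have "(\<Sum>i\<in>UNIV. ?I (partial_deriv i (partial_deriv i u))) = - of_real ((torus_freq \<alpha> n)\<^sup>2) * ?I u"
    unfolding torus_freq_sq of_real_sum sum_negf[symmetric] sum_distrib_right by simp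
  moreover have "(\<Sum>i\<in>UNIV. ?I (partial_deriv i (partial_deriv i u))) = ?I (laplacian u)"
    unfolding laplacian_def sum_distrib_right
    by (rule integral_sum[symmetric]) (auto intro!: integrable_continuous continuous_on_mult continuous_torus_char continuous_on_subset[OF C(3)])
  moreover have "laplacian u = (\<lambda>x. - of_real (\<mu>\<^sup>2) * u x)" 
  proof
    fix x show "laplacian u x = - of_real (\<mu>\<^sup>2) * u x" using eig[of x] by (metis minus_equation_iff mult_minus_left)
  qed
  then have "?I (laplacian u) = - of_real (\<mu>\<^sup>2) * ?I u" by (simp add: mult.assoc)
  ultimately have "complex_of_real ((torus_freq \<alpha> n)\<^sup>2 - \<mu>\<^sup>2) * ?I u = 0" by (simp add: algebra_simps)
  moreover have "(torus_freq \<alpha> n)\<^sup>2 \<noteq> \<mu>\<^sup>2" using n \<mu> torus_freq_nonneg[of \<alpha> n] by (simp add: power2_eq_iff_nonneg)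
  ultimately show ?thesis by (metis mult_eq_0_iff of_real_eq_0_iff eq_iff_diff_eq_0)
qed

lemma measure_torus_cell_pos:
  fixes \<alpha> :: "real ^ 'n"
  assumes \<alpha>: "\<And>i. \<alpha> $ i > 0"
  shows "measure lebesgue (torus_cell \<alpha>) > 0"
  using content_lt_nz[of 0 "(2 * pi) *\<^sub>R \<alpha>"] content_pos_lt_eq[of 0 "(2 * pi) *\<^sub>R \<alpha>"] torus_cell_box_nonempty[OF \<alpha>]
  by (auto simp: box_ne_empty)

lemma integral_torus_char_orthogonal:
  fixes \<alpha> :: "real ^ 'n"
  assumes \<alpha>: "\<And>i. \<alpha> $ i > 0"
  shows "integral (torus_cell \<alpha>) (\<lambda>x. torus_char \<alpha> n x * cnj (torus_char \<alpha> m x)) = (if n = m then of_real (measure lebesgue (torus_cell \<alpha>)) else 0)"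
proof -
  have "((\<lambda>j. n j + - m j) = (\<lambda>_. 0)) = (n = m)" by (auto simp: fun_eq_iff)
  then show ?thesis
    unfolding cnj_torus_char torus_char_mult integral_torus_char[OF \<alpha>] by simp
qed

lemma eigenfunction_is_trigonometric:
  fixes \<alpha> :: "real ^ 'n"
  assumes \<alpha>: "\<And>i. \<alpha> $ i > 0" and \<mu>: "\<mu> \<ge> 0" and u: "u \<in> sqrt_laplacian_eigenspace \<alpha> \<mu>"
  shows "\<exists>c. u = (\<lambda>x. \<Sum>n | torus_freq \<alpha> n = \<mu>. c n * torus_char \<alpha> n x)"
proof -
  define S where "S = {n. torus_freq \<alpha> n = \<mu>}"
  have S: "finite S" by (rule finite_subset[OF _ finite_torus_freq_le[OF \<alpha>, of \<mu>]]) (auto simp: S_def)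
  define V where "V = measure lebesgue (torus_cell \<alpha>)"
  have V: "V > 0" unfolding V_def by (rule measure_torus_cell_pos[OF \<alpha>])
  define c where "c n = integral (torus_cell \<alpha>) (\<lambda>x. u x * torus_char \<alpha> (\<lambda>j. - n j) x) / of_real V" for n
  have per: "torus_periodic \<alpha> u" and smooth: "C_k 0 u"
    using u \<mu> by (auto simp: sqrt_laplacian_eigenspace_def)
  then have cu: "continuous_on UNIV u" by simp
  have neg: "torus_freq \<alpha> (\<lambda>j. - n j) = torus_freq \<alpha> n" for n by (simp add: torus_freq_def)
  have "(\<lambda>x. u x - (\<Sum>n\<in>S. c n * torus_char \<alpha> n x)) = (\<lambda>x. 0)"
  proof (rule torus_fourier_uniqueness[OF \<alpha>])
    show "torus_periodic \<alpha> (\<lambda>x. u x - (\<Sum>n\<in>S. c n * torus_char \<alpha> n x))"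
      using per torus_periodic_char[OF \<alpha>] by (simp add: torus_periodic_def)
    show "continuous_on UNIV (\<lambda>x. u x - (\<Sum>n\<in>S. c n * torus_char \<alpha> n x))"
      by (intro continuous_intros cu)
    fix m :: "'n \<Rightarrow> int"
    let ?m = "\<lambda>j. - m j"
    have "integral (torus_cell \<alpha>) (\<lambda>x. (u x - (\<Sum>n\<in>S. c n * torus_char \<alpha> n x)) * torus_char \<alpha> m x)
      = integral (torus_cell \<alpha>) (\<lambda>x. u x * torus_char \<alpha> m x - (\<Sum>n\<in>S. c n * (torus_char \<alpha> n x * torus_char \<alpha> m x)))"
      by (simp add: left_diff_distrib sum_distrib_right mult.assoc)
    also have "\<dots> = integral (torus_cell \<alpha>) (\<lambda>x. u x * torus_char \<alpha> m x) - (\<Sum>n\<in>S. c n * integral (torus_cell \<alpha>) (\<lambda>x. torus_char \<alpha> n x * torus_char \<alpha> m x))"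
    proof (subst integral_diff)
      show "(\<lambda>x. u x * torus_char \<alpha> m x) integrable_on torus_cell \<alpha>"
        by (intro integrable_continuous continuous_on_mult continuous_torus_char continuous_on_subset[OF cu]) simp
      show "(\<lambda>x. \<Sum>n\<in>S. c n * (torus_char \<alpha> n x * torus_char \<alpha> m x)) integrable_on torus_cell \<alpha>"
        by (intro integrable_continuous continuous_on_sum continuous_on_mult continuous_on_const continuous_torus_char)
      have "integral (torus_cell \<alpha>) (\<lambda>x. \<Sum>n\<in>S. c n * (torus_char \<alpha> n x * torus_char \<alpha> m x))
        = (\<Sum>n\<in>S. integral (torus_cell \<alpha>) (\<lambda>x. c n * (torus_char \<alpha> n x * torus_char \<alpha> m x)))"
        by (rule integral_sum[OF S]) (intro integrable_continuous continuous_on_mult continuous_on_const continuous_torus_char)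
      then show "integral (torus_cell \<alpha>) (\<lambda>x. u x * torus_char \<alpha> m x) - integral (torus_cell \<alpha>) (\<lambda>x. \<Sum>n\<in>S. c n * (torus_char \<alpha> n x * torus_char \<alpha> m x))
        = integral (torus_cell \<alpha>) (\<lambda>x. u x * torus_char \<alpha> m x) - (\<Sum>n\<in>S. c n * integral (torus_cell \<alpha>) (\<lambda>x. torus_char \<alpha> n x * torus_char \<alpha> m x))"
        by simp
    qed
    also have "(\<Sum>n\<in>S. c n * integral (torus_cell \<alpha>) (\<lambda>x. torus_char \<alpha> n x * torus_char \<alpha> m x)) = (\<Sum>n\<in>S. if n = ?m then c ?m * of_real V else 0)"
    proof (intro sum.cong refl)
      fix n
      have "torus_char \<alpha> m x = cnj (torus_char \<alpha> ?m x)" for x by (simp add: cnj_torus_char)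
      then show "c n * integral (torus_cell \<alpha>) (\<lambda>x. torus_char \<alpha> n x * torus_char \<alpha> m x) = (if n = ?m then c ?m * of_real V else 0)"
        using integral_torus_char_orthogonal[OF \<alpha>, of n ?m] by (simp add: V_def)
    qed
    also have "\<dots> = (if ?m \<in> S then c ?m * of_real V else 0)" using S by simp
    also have "\<dots> = integral (torus_cell \<alpha>) (\<lambda>x. u x * torus_char \<alpha> m x)"
    proof (cases "?m \<in> S")
      case True then show ?thesis using V by (simp add: c_def)
    next
      case False
      then have "torus_freq \<alpha> m \<noteq> \<mu>" using neg[of m] by (simp add: S_def)
      from eigenfunction_fourier_coefficient[OF \<alpha> \<mu> u this] False show ?thesis by simp
    qed
    finally show "integral (torus_cell \<alpha>) (\<lambda>x. (u x - (\<Sum>n\<in>S. c n * torus_char \<alpha> n x)) * torus_char \<alpha> m x) = 0" by simp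
  qed
  then have "u = (\<lambda>x. \<Sum>n\<in>S. c n * torus_char \<alpha> n x)" by (auto simp: fun_eq_iff)
  then show ?thesis unfolding S_def by blast
qed

section \<open>The spectral projection as a trigonometric polynomial\<close>

lemma space_torus_measure: "space (torus_measure \<alpha>) = torus_cell \<alpha>"
  by (simp add: torus_measure_def)

lemma finite_measure_torus: "finite_measure (torus_measure \<alpha>)"
  unfolding torus_measure_def by (intro finite_measure_lebesgue_on) auto

lemma integrable_torus_continuous:
  fixes f :: "real ^ 'n \<Rightarrow> 'b::euclidean_space"
  assumes "continuous_on UNIV f"
  shows "integrable (torus_measure \<alpha>) f"
  unfolding torus_measure_def using continuous_on_subset[OF assms] by (intro continuous_imp_integrable) auto

lemma integral_torus_continuous:
  fixes f :: "real ^ 'n \<Rightarrow> 'b::euclidean_space"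
  assumes "continuous_on UNIV f"
  shows "integral\<^sup>L (torus_measure \<alpha>) f = integral (torus_cell \<alpha>) f"
  using lebesgue_integral_eq_integral[OF integrable_torus_continuous[OF assms, unfolded torus_measure_def]]
  by (simp add: torus_measure_def)

lemma borel_measurable_torus_continuous:
  fixes f :: "real ^ 'n \<Rightarrow> 'b::euclidean_space"
  assumes "continuous_on UNIV f"
  shows "f \<in> borel_measurable (torus_measure \<alpha>)"
  using integrable_torus_continuous[OF assms] by (rule borel_measurable_integrable)

lemma torus_L2_integrable:
  assumes "f \<in> torus_Lp \<alpha> 2"
  shows "f \<in> borel_measurable (torus_measure \<alpha>)" "integrable (torus_measure \<alpha>) (\<lambda>x. (norm (f x))\<^sup>2)"
    "integrable (torus_measure \<alpha>) f"
proof -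
  interpret finite_measure "torus_measure \<alpha>" by (rule finite_measure_torus)
  show m: "f \<in> borel_measurable (torus_measure \<alpha>)" using assms by (simp add: torus_Lp_def)
  have "norm (f x) powr 2 = (norm (f x))\<^sup>2" for x by (simp add: powr_numeral)
  then show i: "integrable (torus_measure \<alpha>) (\<lambda>x. (norm (f x))\<^sup>2)" using assms by (simp add: torus_Lp_def)
  show "integrable (torus_measure \<alpha>) f"
  proof (rule Bochner_Integration.integrable_bound[OF _ m])
    show "integrable (torus_measure \<alpha>) (\<lambda>x. 1 + (norm (f x))\<^sup>2)" using i by simp
    have "norm y \<le> 1 + (norm y)\<^sup>2" for y :: complex
    proof -
      have "0 \<le> (norm y - 1)\<^sup>2" by simp
      also have "(norm y - 1)\<^sup>2 = (norm y)\<^sup>2 + 1 - 2 * norm y" by (simp add: power2_diff)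
      finally show ?thesis using norm_ge_zero[of y] by linarith
    qed
    then show "AE x in torus_measure \<alpha>. norm (f x) \<le> norm (1 + (norm (f x))\<^sup>2)" by (simp add: abs_of_nonneg)
  qed
qed

lemma integrable_mult_bounded:
  fixes f g :: "'a \<Rightarrow> complex"
  assumes "integrable M f" "g \<in> borel_measurable M" "\<And>x. norm (g x) \<le> B"
  shows "integrable M (\<lambda>x. f x * g x)"
proof (rule Bochner_Integration.integrable_bound)
  show "integrable M (\<lambda>x. B * norm (f x))" using assms(1) by simp
  show "(\<lambda>x. f x * g x) \<in> borel_measurable M" using assms by measurable
  have "B \<ge> 0" using assms(3) norm_ge_zero order_trans by blast
  have "norm (f x) * norm (g x) \<le> norm (f x) * B" for x by (intro mult_left_mono assms) auto
  then show "AE x in M. norm (f x * g x) \<le> norm (B * norm (f x))"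
    using \<open>B \<ge> 0\<close> by (simp add: norm_mult mult.commute)
qed

definition trig_poly :: "real ^ 'n \<Rightarrow> ('n \<Rightarrow> int) set \<Rightarrow> (('n \<Rightarrow> int) \<Rightarrow> complex) \<Rightarrow> real ^ 'n \<Rightarrow> complex" where
  "trig_poly \<alpha> S c x = (\<Sum>n\<in>S. c n * torus_char \<alpha> n x)"

lemma continuous_trig_poly [continuous_intros]: "continuous_on A (trig_poly \<alpha> S c)"
  unfolding trig_poly_def[abs_def] by (intro continuous_intros)

lemma torus_periodic_trig_poly:
  fixes \<alpha> :: "real ^ 'n"
  assumes "\<And>i. \<alpha> $ i > 0"
  shows "torus_periodic \<alpha> (trig_poly \<alpha> S c)"
  using torus_periodic_char[OF assms] by (simp add: torus_periodic_def trig_poly_def)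

lemma torus_inner_char:
  fixes \<alpha> :: "real ^ 'n"
  assumes \<alpha>: "\<And>i. \<alpha> $ i > 0"
  shows "torus_inner \<alpha> (torus_char \<alpha> n) (torus_char \<alpha> m) = (if n = m then of_real (measure lebesgue (torus_cell \<alpha>)) else 0)"
  unfolding torus_inner_def
  by (subst integral_torus_continuous) (auto intro!: continuous_intros simp: integral_torus_char_orthogonal[OF \<alpha>])

lemma torus_inner_trig_poly_char:
  fixes \<alpha> :: "real ^ 'n"
  assumes \<alpha>: "\<And>i. \<alpha> $ i > 0" and S: "finite S"
  shows "torus_inner \<alpha> (trig_poly \<alpha> S c) (torus_char \<alpha> m) = (if m \<in> S then c m * of_real (measure lebesgue (torus_cell \<alpha>)) else 0)"
proof -
  have "torus_inner \<alpha> (trig_poly \<alpha> S c) (torus_char \<alpha> m) = (\<Sum>n\<in>S. c n * torus_inner \<alpha> (torus_char \<alpha> n) (torus_char \<alpha> m))"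
    unfolding torus_inner_def trig_poly_def sum_distrib_right mult.assoc
    by (subst Bochner_Integration.integral_sum) (auto intro!: integrable_mult_right integrable_torus_continuous continuous_intros)
  also have "\<dots> = (\<Sum>n\<in>S. if n = m then c m * of_real (measure lebesgue (torus_cell \<alpha>)) else 0)"
    by (intro sum.cong) (auto simp: torus_inner_char[OF \<alpha>])
  finally show ?thesis using S by simp
qed

lemma torus_inner_trig_poly_right:
  assumes r: "integrable (torus_measure \<alpha>) r"
  shows "torus_inner \<alpha> r (trig_poly \<alpha> S b) = (\<Sum>n\<in>S. cnj (b n) * torus_inner \<alpha> r (torus_char \<alpha> n))"
proof -
  have int: "integrable (torus_measure \<alpha>) (\<lambda>x. r x * cnj (torus_char \<alpha> n x))" for n
    by (rule integrable_mult_bounded[where B=1, OF r borel_measurable_torus_continuous])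
      (auto intro!: continuous_intros)
  have "r x * cnj (trig_poly \<alpha> S b x) = (\<Sum>n\<in>S. cnj (b n) * (r x * cnj (torus_char \<alpha> n x)))" for x
    unfolding trig_poly_def cnj_sum sum_distrib_left complex_cnj_mult by (intro sum.cong refl mult.left_commute)
  then show ?thesis
    unfolding torus_inner_def by (simp add: Bochner_Integration.integral_sum int)
qed

lemma torus_char_inj:
  fixes \<alpha> :: "real ^ 'n"
  assumes \<alpha>: "\<And>i. \<alpha> $ i > 0" and "torus_char \<alpha> n = torus_char \<alpha> m"
  shows "n = m"
proof (rule ccontr)
  assume "n \<noteq> m"
  then have "torus_inner \<alpha> (torus_char \<alpha> n) (torus_char \<alpha> m) = 0" by (simp add: torus_inner_char[OF \<alpha>])
  moreover have "torus_inner \<alpha> (torus_char \<alpha> n) (torus_char \<alpha> m) \<noteq> 0"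
    unfolding assms(2) torus_inner_char[OF \<alpha>] using measure_torus_cell_pos[OF \<alpha>] by simp
  ultimately show False by simp
qed

definition torus_window :: "real ^ 'n \<Rightarrow> real \<Rightarrow> real \<Rightarrow> ('n \<Rightarrow> int) set" where
  "torus_window \<alpha> l \<delta> = {n. torus_freq \<alpha> n \<in> {l - \<delta>..l + \<delta>}}"

lemma finite_torus_window:
  fixes \<alpha> :: "real ^ 'n"
  assumes "\<And>i. \<alpha> $ i > 0"
  shows "finite (torus_window \<alpha> l \<delta>)"
  by (rule finite_subset[OF _ finite_torus_freq_le[OF assms, of "l + \<delta>"]]) (auto simp: torus_window_def)

text \<open>
  Every eigenfunction is a finite combination of characters of its frequency, and every character is an
  eigenfunction. Hence the subspace consists of the trigonometric polynomials with frequencies in the shell.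
\<close>

lemma spectral_subspace_eq:
  fixes \<alpha> :: "real ^ 'n"
  assumes \<alpha>: "\<And>i. \<alpha> $ i > 0" and l: "l - \<delta> \<ge> 0"
  shows "spectral_subspace \<alpha> {l - \<delta>..l + \<delta>} = range (trig_poly \<alpha> (torus_window \<alpha> l \<delta>))"
proof (intro equalityI subsetI)
  let ?S = "torus_window \<alpha> l \<delta>"
  have fin: "finite ?S" by (rule finite_torus_window[OF \<alpha>])
  fix g assume "g \<in> spectral_subspace \<alpha> {l - \<delta>..l + \<delta>}"
  then obtain F c where g: "g = (\<lambda>x. \<Sum>u\<in>F. c u * u x)" "finite F" "F \<subseteq> (\<Union>\<mu>\<in>{l - \<delta>..l + \<delta>}. sqrt_laplacian_eigenspace \<alpha> \<mu>)"
    unfolding spectral_subspace_def by blast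
  have "\<exists>b. u = trig_poly \<alpha> ?S b" if u: "u \<in> F" for u
  proof -
    obtain \<mu> where \<mu>: "\<mu> \<in> {l - \<delta>..l + \<delta>}" "u \<in> sqrt_laplacian_eigenspace \<alpha> \<mu>" using g(3) u by blast
    then have "\<mu> \<ge> 0" using l by simp
    from eigenfunction_is_trigonometric[OF \<alpha> this \<mu>(2)] obtain b where b: "u = (\<lambda>x. \<Sum>n | torus_freq \<alpha> n = \<mu>. b n * torus_char \<alpha> n x)" by blast
    have "u = trig_poly \<alpha> ?S (\<lambda>n. if torus_freq \<alpha> n = \<mu> then b n else 0)"
    proof
      fix x
      show "u x = trig_poly \<alpha> ?S (\<lambda>n. if torus_freq \<alpha> n = \<mu> then b n else 0) x"
        unfolding b trig_poly_def using \<mu>(1) by (intro sum.mono_neutral_cong_left fin) (auto simp: torus_window_def)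
    qed
    then show ?thesis by blast
  qed
  then obtain b where b: "\<And>u. u \<in> F \<Longrightarrow> u = trig_poly \<alpha> ?S (b u)" by metis
  have "g = trig_poly \<alpha> ?S (\<lambda>n. \<Sum>u\<in>F. c u * b u n)"
  proof
    fix x
    have "g x = (\<Sum>u\<in>F. c u * trig_poly \<alpha> ?S (b u) x)" unfolding g(1) by (intro sum.cong) (simp_all add: b[symmetric])
    also have "\<dots> = trig_poly \<alpha> ?S (\<lambda>n. \<Sum>u\<in>F. c u * b u n) x"
      unfolding trig_poly_def sum_distrib_left sum_distrib_right by (subst sum.swap) (simp add: mult.assoc)
    finally show "g x = trig_poly \<alpha> ?S (\<lambda>n. \<Sum>u\<in>F. c u * b u n) x" .
  qed
  then show "g \<in> range (trig_poly \<alpha> ?S)" by blast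
next
  let ?S = "torus_window \<alpha> l \<delta>"
  fix g assume "g \<in> range (trig_poly \<alpha> ?S)"
  then obtain c where g: "g = trig_poly \<alpha> ?S c" by blast
  have inj: "inj_on (torus_char \<alpha>) ?S" using torus_char_inj[OF \<alpha>] by (auto intro: inj_onI)
  let ?c = "\<lambda>u. c (inv_into ?S (torus_char \<alpha>) u)"
  have "g = (\<lambda>x. \<Sum>u\<in>torus_char \<alpha> ` ?S. ?c u * u x)"
    unfolding g by (rule ext) (simp add: trig_poly_def sum.reindex[OF inj] inv_into_f_f[OF inj])
  moreover have "finite (torus_char \<alpha> ` ?S)" using finite_torus_window[OF \<alpha>] by blast
  moreover have "torus_char \<alpha> ` ?S \<subseteq> (\<Union>\<mu>\<in>{l - \<delta>..l + \<delta>}. sqrt_laplacian_eigenspace \<alpha> \<mu>)"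
    using torus_char_eigenfunction[OF \<alpha>] by (auto simp: torus_window_def)
  ultimately show "g \<in> spectral_subspace \<alpha> {l - \<delta>..l + \<delta>}"
    unfolding spectral_subspace_def by (intro CollectI exI conjI)
qed

text \<open>
  Among trigonometric polynomials with frequencies in the shell, orthogonality of \<open>f - g\<close> to the characters
  of the shell determines the coefficients of \<open>g\<close>.
\<close>

lemma spectral_projection_eq:
  fixes \<alpha> :: "real ^ 'n"
  assumes \<alpha>: "\<And>i. \<alpha> $ i > 0" and l: "l - \<delta> \<ge> 0" and f: "f \<in> torus_Lp \<alpha> 2"
  shows "spectral_projection \<alpha> l \<delta> f =
    trig_poly \<alpha> (torus_window \<alpha> l \<delta>) (\<lambda>n. torus_inner \<alpha> f (torus_char \<alpha> n) / of_real (measure lebesgue (torus_cell \<alpha>)))"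
  unfolding spectral_projection_def spectral_subspace_eq[OF \<alpha> l]
proof (rule the_equality)
  let ?S = "torus_window \<alpha> l \<delta>" and ?V = "measure lebesgue (torus_cell \<alpha>)"
  let ?c = "\<lambda>n. torus_inner \<alpha> f (torus_char \<alpha> n) / of_real ?V"
  have fin: "finite ?S" by (rule finite_torus_window[OF \<alpha>])
  have V: "?V > 0" by (rule measure_torus_cell_pos[OF \<alpha>])
  have int: "integrable (torus_measure \<alpha>) (\<lambda>x. (f x - trig_poly \<alpha> ?S c x) * cnj (torus_char \<alpha> n x))" for c n
  proof (rule integrable_mult_bounded[where B=1])
    show "integrable (torus_measure \<alpha>) (\<lambda>x. f x - trig_poly \<alpha> ?S c x)"
      by (rule Bochner_Integration.integrable_diff[OF torus_L2_integrable(3)[OF f] integrable_torus_continuous[OF continuous_trig_poly]])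
    show "(\<lambda>x. cnj (torus_char \<alpha> n x)) \<in> borel_measurable (torus_measure \<alpha>)"
      by (intro borel_measurable_torus_continuous continuous_intros)
  qed simp
  have inner_diff: "torus_inner \<alpha> (\<lambda>x. f x - trig_poly \<alpha> ?S c x) (torus_char \<alpha> n) = torus_inner \<alpha> f (torus_char \<alpha> n) - c n * of_real ?V"
    if "n \<in> ?S" for c n
  proof -
    have "integrable (torus_measure \<alpha>) (\<lambda>x. f x * cnj (torus_char \<alpha> n x))"
      by (rule integrable_mult_bounded[where B=1, OF torus_L2_integrable(3)[OF f] borel_measurable_torus_continuous])
        (auto intro!: continuous_intros)
    moreover have "integrable (torus_measure \<alpha>) (\<lambda>x. trig_poly \<alpha> ?S c x * cnj (torus_char \<alpha> n x))"
      by (intro integrable_torus_continuous continuous_intros)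
    ultimately have "torus_inner \<alpha> (\<lambda>x. f x - trig_poly \<alpha> ?S c x) (torus_char \<alpha> n) = torus_inner \<alpha> f (torus_char \<alpha> n) - torus_inner \<alpha> (trig_poly \<alpha> ?S c) (torus_char \<alpha> n)"
      unfolding torus_inner_def left_diff_distrib by (rule Bochner_Integration.integral_diff)
    then show ?thesis using torus_inner_trig_poly_char[OF \<alpha> fin, of c n] that by simp
  qed
  show "trig_poly \<alpha> ?S ?c \<in> range (trig_poly \<alpha> ?S) \<and> (\<forall>h\<in>range (trig_poly \<alpha> ?S). torus_inner \<alpha> (\<lambda>x. f x - trig_poly \<alpha> ?S ?c x) h = 0)"
  proof (intro conjI ballI)
    fix h assume "h \<in> range (trig_poly \<alpha> ?S)"
    then obtain b where h: "h = trig_poly \<alpha> ?S b" by blast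
    have "torus_inner \<alpha> (\<lambda>x. f x - trig_poly \<alpha> ?S ?c x) h = (\<Sum>n\<in>?S. cnj (b n) * torus_inner \<alpha> (\<lambda>x. f x - trig_poly \<alpha> ?S ?c x) (torus_char \<alpha> n))"
      unfolding h by (rule torus_inner_trig_poly_right)
        (rule Bochner_Integration.integrable_diff[OF torus_L2_integrable(3)[OF f] integrable_torus_continuous[OF continuous_trig_poly]])
    also have "\<dots> = 0"
      using V by (intro sum.neutral ballI) (simp only: inner_diff, simp)
    finally show "torus_inner \<alpha> (\<lambda>x. f x - trig_poly \<alpha> ?S ?c x) h = 0" .
  qed simp
  fix g assume g: "g \<in> range (trig_poly \<alpha> ?S) \<and> (\<forall>h\<in>range (trig_poly \<alpha> ?S). torus_inner \<alpha> (\<lambda>x. f x - g x) h = 0)"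
  then obtain b where b: "g = trig_poly \<alpha> ?S b" by blast
  have "b n = ?c n" if n: "n \<in> ?S" for n
  proof -
    have "torus_char \<alpha> n = trig_poly \<alpha> ?S (\<lambda>m. if m = n then 1 else 0)"
    proof
      fix x
      have "trig_poly \<alpha> ?S (\<lambda>m. if m = n then 1 else 0) x = (\<Sum>m\<in>?S. if m = n then torus_char \<alpha> n x else 0)"
        unfolding trig_poly_def by (intro sum.cong) auto
      then show "torus_char \<alpha> n x = trig_poly \<alpha> ?S (\<lambda>m. if m = n then 1 else 0) x"
        using fin n by (simp only: sum.delta if_True)
    qed
    then have "torus_inner \<alpha> (\<lambda>x. f x - g x) (torus_char \<alpha> n) = 0" using g by (metis rangeI)
    then show ?thesis using inner_diff[OF n, of b] V unfolding b by (simp add: field_simps)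
  qed
  then show "g = trig_poly \<alpha> ?S ?c" unfolding b trig_poly_def by (intro ext sum.cong) auto
qed

text \<open>
  Expand the square in \<open>\<integral> |f - g|\<^sup>2 \<ge> 0\<close>, where \<open>g\<close> is the orthogonal projection of \<open>f\<close>. The volume of the cell appears
  because the characters have norm \<open>sqrt V\<close>.
\<close>

lemma torus_bessel:
  fixes \<alpha> :: "real ^ 'n"
  assumes \<alpha>: "\<And>i. \<alpha> $ i > 0" and S: "finite S"
    and f: "integrable (torus_measure \<alpha>) f" and f2: "integrable (torus_measure \<alpha>) (\<lambda>x. (norm (f x))\<^sup>2)"
  shows "(\<Sum>n\<in>S. (norm (torus_inner \<alpha> f (torus_char \<alpha> n)))\<^sup>2) \<le> measure lebesgue (torus_cell \<alpha>) * (LINT x|torus_measure \<alpha>. (norm (f x))\<^sup>2)"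
proof -
  define V where "V = measure lebesgue (torus_cell \<alpha>)"
  have V: "V > 0" unfolding V_def by (rule measure_torus_cell_pos[OF \<alpha>])
  define b where "b n = torus_inner \<alpha> f (torus_char \<alpha> n)" for n
  let ?g = "trig_poly \<alpha> S (\<lambda>n. b n / of_real V)"
  have cnj_g: "cnj (?g x) = (\<Sum>n\<in>S. cnj (b n) / of_real V * cnj (torus_char \<alpha> n x))" for x
    by (simp add: trig_poly_def)
  have i1: "integrable (torus_measure \<alpha>) (\<lambda>x. f x * cnj (torus_char \<alpha> n x))" for n
    by (rule integrable_mult_bounded[OF f, where B=1]) (auto intro!: borel_measurable_torus_continuous continuous_intros)
  have i2: "integrable (torus_measure \<alpha>) (\<lambda>x. ?g x * cnj (torus_char \<alpha> n x))" for n
    by (intro integrable_torus_continuous continuous_intros)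
  have fg: "integrable (torus_measure \<alpha>) (\<lambda>x. f x * cnj (?g x))"
    unfolding cnj_g sum_distrib_left mult.left_commute[of "f _"] by (intro Bochner_Integration.integrable_sum integrable_mult_right i1)
  have E: "complex_of_real (\<Sum>n\<in>S. (norm (b n))\<^sup>2 / V) = (\<Sum>n\<in>S. cnj (b n) / of_real V * b n)"
    by (simp add: complex_norm_square mult.commute del: of_real_power)
  have Ifg: "(LINT x|torus_measure \<alpha>. f x * cnj (?g x)) = of_real (\<Sum>n\<in>S. (norm (b n))\<^sup>2 / V)"
    unfolding E cnj_g sum_distrib_left mult.left_commute[of "f _"]
    by (subst Bochner_Integration.integral_sum) (auto intro!: integrable_mult_right i1 simp: b_def torus_inner_def)
  have Igg: "(LINT x|torus_measure \<alpha>. ?g x * cnj (?g x)) = of_real (\<Sum>n\<in>S. (norm (b n))\<^sup>2 / V)"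
  proof -
    have "(LINT x|torus_measure \<alpha>. ?g x * cnj (?g x)) = (\<Sum>n\<in>S. cnj (b n) / of_real V * torus_inner \<alpha> ?g (torus_char \<alpha> n))"
      unfolding cnj_g sum_distrib_left mult.left_commute[of "?g _"] torus_inner_def
      by (subst Bochner_Integration.integral_sum) (auto intro!: integrable_mult_right i2)
    also have "\<dots> = (\<Sum>n\<in>S. cnj (b n) / of_real V * b n)"
      using V by (intro sum.cong) (simp_all add: torus_inner_trig_poly_char[OF \<alpha> S] V_def)
    finally show ?thesis unfolding E .
  qed
  define D where "D = (\<Sum>n\<in>S. (norm (b n))\<^sup>2 / V)"
  have Rfg: "(LINT x|torus_measure \<alpha>. Re (f x * cnj (?g x))) = D" and ifg: "integrable (torus_measure \<alpha>) (\<lambda>x. Re (f x * cnj (?g x)))"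
    using integral_bounded_linear[OF bounded_linear_Re fg] integrable_bounded_linear[OF bounded_linear_Re fg]
    unfolding Ifg D_def Re_complex_of_real by blast+
  have cgg: "integrable (torus_measure \<alpha>) (\<lambda>x. ?g x * cnj (?g x))" by (intro integrable_torus_continuous continuous_intros)
  have Rgg: "(LINT x|torus_measure \<alpha>. (norm (?g x))\<^sup>2) = D" and igg: "integrable (torus_measure \<alpha>) (\<lambda>x. (norm (?g x))\<^sup>2)"
  proof -
    have *: "(norm (?g x))\<^sup>2 = Re (?g x * cnj (?g x))" for x by (simp only: complex_norm_square[symmetric] Re_complex_of_real)
    show "(LINT x|torus_measure \<alpha>. (norm (?g x))\<^sup>2) = D" 
      unfolding * D_def using integral_bounded_linear[OF bounded_linear_Re cgg] unfolding Igg Re_complex_of_real .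
    show "integrable (torus_measure \<alpha>) (\<lambda>x. (norm (?g x))\<^sup>2)" 
      unfolding * by (rule integrable_bounded_linear[OF bounded_linear_Re cgg])
  qed
  have exp: "(norm (f x - ?g x))\<^sup>2 = (norm (f x))\<^sup>2 - 2 * Re (f x * cnj (?g x)) + (norm (?g x))\<^sup>2" for x
    unfolding cmod_power2 by (simp add: power2_eq_square algebra_simps)
  define R where "R x = Re (f x * cnj (?g x))" for x
  have "0 \<le> (LINT x|torus_measure \<alpha>. (norm (f x - ?g x))\<^sup>2)" by simp
  also have "\<dots> = (LINT x|torus_measure \<alpha>. (norm (f x))\<^sup>2) - 2 * D + D"
    unfolding exp R_def[symmetric] using f2 ifg[folded R_def] igg Rfg[folded R_def] Rgg by simp
  finally have "D \<le> (LINT x|torus_measure \<alpha>. (norm (f x))\<^sup>2)" by simp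
  then have "V * D \<le> V * (LINT x|torus_measure \<alpha>. (norm (f x))\<^sup>2)" using V by simp
  also have "V * D = (\<Sum>n\<in>S. (norm (b n))\<^sup>2)" using V by (simp add: D_def sum_distrib_left)
  finally show ?thesis by (simp add: b_def V_def)
qed

section \<open>A Fejer majorant of the spectral shell\<close>

text \<open>
  A truncation of \<open>kernel_integrand\<close> to a box of frequencies, so that the duality argument below involves only
  finite sums. By \<open>box_integrand_expand\<close> it is a finite sum of characters with the coefficients \<open>mode_integrand\<close>.
\<close>

definition box_integrand :: "real \<Rightarrow> real \<Rightarrow> real ^ 'n \<Rightarrow> nat \<Rightarrow> real ^ 'n \<Rightarrow> real \<Rightarrow> complex" where
  "box_integrand l \<tau> \<alpha> M \<theta> t = of_real (1 - t / \<tau>) * cis (- (l\<^sup>2 * t)) *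
     (\<Prod>j\<in>UNIV. \<Sum>n\<in>{- int M..int M}. theta_fourier (Complex (1 / l\<^sup>2) (-t) / of_real ((\<alpha> $ j)\<^sup>2)) (\<theta> $ j) n)"

abbreviation freq_box :: "nat \<Rightarrow> ('n \<Rightarrow> int) set" where
  "freq_box M \<equiv> PiE UNIV (\<lambda>_. {- int M..int M})"

lemma finite_freq_box: "finite (freq_box M :: ('n::finite \<Rightarrow> int) set)"
  by (intro finite_PiE) auto

lemma box_integrand_continuous:
  fixes \<alpha> :: "real ^ 'n"
  assumes "\<tau> > 0"
  shows "continuous_on A (box_integrand l \<tau> \<alpha> M \<theta>)"
proof -
  have e: "Complex (1 / l\<^sup>2) (-t) / of_real ((\<alpha> $ j)\<^sup>2) = (of_real (1 / l\<^sup>2) - \<i> * of_real t) * of_real (inverse ((\<alpha> $ j)\<^sup>2))" for t j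
    by (simp add: Complex_eq divide_inverse)
  show ?thesis unfolding box_integrand_def[abs_def] theta_fourier_def e using assms
    by (intro continuous_intros) auto
qed

text \<open>
  The product of the truncated theta series converges uniformly in the time and in the displacement together. This
  gives one truncation that works for all pairs of points of the torus.
\<close>

lemma box_integrand_approx:
  fixes \<alpha> :: "real ^ 'n"
  assumes l: "l > 0" and \<alpha>: "\<And>j. \<alpha> $ j > 0" and a: "0 \<le> a" "a \<le> \<tau>" and \<tau>: "\<tau> > 0" and \<eta>: "\<eta> > 0"
  shows "\<exists>M0. \<forall>M\<ge>M0. \<forall>\<theta>. norm (integral {a..\<tau>} (box_integrand l \<tau> \<alpha> M \<theta>)) \<le> norm (integral {a..\<tau>} (kernel_integrand l \<tau> \<alpha> \<theta>)) + \<eta>"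
proof -
  define X where "X = {a..\<tau>} \<times> (UNIV :: (real ^ 'n) set)"
  define w where "w j t = Complex (1 / l\<^sup>2) (-t) / of_real ((\<alpha> $ j)\<^sup>2)" for j t
  have Rew: "Re (w j t) = 1 / l\<^sup>2 / (\<alpha> $ j)\<^sup>2" for j t by (simp add: w_def)
  have Rpos: "1 / l\<^sup>2 / (\<alpha> $ j)\<^sup>2 > 0" for j using l less_imp_neq[OF \<alpha>[of j]] by (intro divide_pos_pos) auto
  have uj: "uniform_limit X (\<lambda>M p. \<Sum>n\<in>{- int M..int M}. theta_fourier (w j (fst p)) (snd p $ j) n)
     (\<lambda>p. theta (w j (fst p)) (snd p $ j)) sequentially" for j
    using uniform_limit_compose'[OF uniform_limit_theta[OF Rpos[of j]], of "\<lambda>p. (w j (fst p), snd p $ j)" X]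
    by (simp add: Pi_iff Rew)
  have bj: "bounded ((\<lambda>p. theta (w j (fst p)) (snd p $ j)) ` X)" for j
  proof (rule boundedI[where B="1 + 4 / sqrt (1 / l\<^sup>2 / (\<alpha> $ j)\<^sup>2)"])
    fix y assume "y \<in> (\<lambda>p. theta (w j (fst p)) (snd p $ j)) ` X"
    then obtain p where y: "y = theta (w j (fst p)) (snd p $ j)" by blast
    show "norm y \<le> 1 + 4 / sqrt (1 / l\<^sup>2 / (\<alpha> $ j)\<^sup>2)"
      using norm_theta_le[of "w j (fst p)" "snd p $ j"] Rpos[of j] unfolding y Rew by blast
  qed
  have "uniform_limit X (\<lambda>M p. \<Prod>j\<in>UNIV. \<Sum>n\<in>{- int M..int M}. theta_fourier (w j (fst p)) (snd p $ j) n)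
     (\<lambda>p. \<Prod>j\<in>UNIV. theta (w j (fst p)) (snd p $ j)) sequentially"
    using uniform_limit_prod[where I="UNIV::'n set" and S=X and f="\<lambda>j M p. \<Sum>n\<in>{- int M..int M}. theta_fourier (w j (fst p)) (snd p $ j) n"
        and g="\<lambda>j p. theta (w j (fst p)) (snd p $ j)"] uj bj by (simp add: finite)
  moreover have "\<eta> / \<tau> > 0" using \<eta> \<tau> by simp
  ultimately have "\<forall>\<^sub>F M in sequentially. \<forall>p\<in>X. dist (\<Prod>j\<in>UNIV. \<Sum>n\<in>{- int M..int M}. theta_fourier (w j (fst p)) (snd p $ j) n)
      (\<Prod>j\<in>UNIV. theta (w j (fst p)) (snd p $ j)) < \<eta> / \<tau>"
    by (rule uniform_limitD)
  then obtain M0 where M0: "\<And>M p. M \<ge> M0 \<Longrightarrow> p \<in> X \<Longrightarrow> norm ((\<Prod>j\<in>UNIV. \<Sum>n\<in>{- int M..int M}. theta_fourier (w j (fst p)) (snd p $ j) n)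
      - (\<Prod>j\<in>UNIV. theta (w j (fst p)) (snd p $ j))) < \<eta> / \<tau>"
    unfolding eventually_sequentially dist_norm by blast
  show ?thesis
  proof (intro exI[of _ M0] allI impI)
    fix M and \<theta> :: "real ^ 'n" assume M: "M0 \<le> M"
    let ?b = "box_integrand l \<tau> \<alpha> M \<theta>" and ?k = "kernel_integrand l \<tau> \<alpha> \<theta>"
    have c: "continuous_on {a..\<tau>} ?b" "continuous_on {a..\<tau>} ?k"
      using box_integrand_continuous[OF \<tau>] kernel_integrand_continuous[OF l \<tau> \<alpha>] by auto
    have "norm (integral {a..\<tau>} (\<lambda>t. ?b t - ?k t)) \<le> \<eta> / \<tau> * (\<tau> - a)"
    proof (rule integral_bound[OF a(2)])
      show "continuous_on {a..\<tau>} (\<lambda>t. ?b t - ?k t)" by (intro continuous_intros c)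
      fix t assume t: "t \<in> {a..\<tau>}"
      have "norm (complex_of_real (1 - t / \<tau>)) \<le> 1"
        unfolding norm_of_real using t a \<tau> by (auto simp: abs_le_iff divide_simps)
      moreover have "(t, \<theta>) \<in> X" using t by (simp add: X_def)
      from M0[OF M this] have "norm ((\<Prod>j\<in>UNIV. \<Sum>n\<in>{- int M..int M}. theta_fourier (w j t) (\<theta> $ j) n) - (\<Prod>j\<in>UNIV. theta (w j t) (\<theta> $ j))) \<le> \<eta> / \<tau>"
        by simp
      ultimately have "norm (complex_of_real (1 - t / \<tau>)) * norm (cis (- (l\<^sup>2 * t))) * norm ((\<Prod>j\<in>UNIV. \<Sum>n\<in>{- int M..int M}. theta_fourier (w j t) (\<theta> $ j) n) - (\<Prod>j\<in>UNIV. theta (w j t) (\<theta> $ j))) \<le> 1 * 1 * (\<eta> / \<tau>)"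
        by (intro mult_mono) auto
      then show "norm (?b t - ?k t) \<le> \<eta> / \<tau>"
        unfolding box_integrand_def kernel_integrand_def w_def[symmetric] right_diff_distrib[symmetric] norm_mult by simp
    qed
    also have "\<dots> \<le> \<eta> / \<tau> * \<tau>" using a \<eta> \<tau> by (intro mult_left_mono) auto
    finally have "norm (integral {a..\<tau>} ?b - integral {a..\<tau>} ?k) \<le> \<eta>"
      using c \<tau> by (simp add: integral_diff integrable_continuous_real)
    then show "norm (integral {a..\<tau>} ?b) \<le> norm (integral {a..\<tau>} ?k) + \<eta>"
      using norm_triangle_ineq2[of "integral {a..\<tau>} ?b" "integral {a..\<tau>} ?k"] by linarith
  qed
qed

definition mode_integrand :: "real \<Rightarrow> real \<Rightarrow> real ^ 'n \<Rightarrow> ('n \<Rightarrow> int) \<Rightarrow> real \<Rightarrow> complex" where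
  "mode_integrand l \<tau> \<alpha> n t = of_real (1 - t / \<tau>) * cis (- (l\<^sup>2 * t)) * exp (- Complex (1 / l\<^sup>2) (-t) * of_real ((torus_freq \<alpha> n)\<^sup>2))"

lemma mode_integrand_eq:
  "mode_integrand l \<tau> \<alpha> n t = of_real (exp (- (torus_freq \<alpha> n)\<^sup>2 / l\<^sup>2)) * (of_real (1 - t / \<tau>) * cis (t * ((torus_freq \<alpha> n)\<^sup>2 - l\<^sup>2)))"
proof -
  let ?\<nu> = "(torus_freq \<alpha> n)\<^sup>2"
  have "- Complex (1 / l\<^sup>2) (-t) * of_real ?\<nu> = of_real (- ?\<nu> / l\<^sup>2) + \<i> * of_real (t * ?\<nu>)"
    by (simp add: complex_eq_iff)
  then have "exp (- Complex (1 / l\<^sup>2) (-t) * of_real ?\<nu>) = of_real (exp (- ?\<nu> / l\<^sup>2)) * cis (t * ?\<nu>)"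
    by (simp only: exp_add cis_conv_exp exp_of_real)
  moreover have "cis (- (l\<^sup>2 * t)) * cis (t * ?\<nu>) = cis (t * (?\<nu> - l\<^sup>2))" by (simp add: cis_mult algebra_simps)
  moreover have "mode_integrand l \<tau> \<alpha> n t = exp (- Complex (1 / l\<^sup>2) (-t) * of_real ?\<nu>) * (of_real (1 - t / \<tau>) * cis (- (l\<^sup>2 * t)))"
    unfolding mode_integrand_def by (rule mult.commute)
  ultimately show ?thesis by (simp only: mult.assoc mult.left_commute[of "cis (t * ?\<nu>)"] mult.commute[of "cis (t * ?\<nu>)"])
qed

lemma mode_integrand_continuous: "\<tau> > 0 \<Longrightarrow> continuous_on A (mode_integrand l \<tau> \<alpha> n)"
  unfolding mode_integrand_eq[abs_def] by (intro continuous_intros) auto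

lemma box_integrand_expand:
  fixes \<alpha> x y :: "real ^ 'n"
  assumes \<alpha>: "\<And>j. \<alpha> $ j > 0"
  shows "box_integrand l \<tau> \<alpha> M (\<chi> j. (y $ j - x $ j) / \<alpha> $ j) t =
    (\<Sum>n\<in>freq_box M. mode_integrand l \<tau> \<alpha> n t * (torus_char \<alpha> n y * cnj (torus_char \<alpha> n x)))"
proof -
  define z where "z = Complex (1 / l\<^sup>2) (-t)"
  have "(\<Prod>j\<in>UNIV. \<Sum>m\<in>{- int M..int M}. theta_fourier (z / of_real ((\<alpha> $ j)\<^sup>2)) ((y $ j - x $ j) / \<alpha> $ j) m)
    = (\<Sum>n\<in>freq_box M. \<Prod>j\<in>UNIV. theta_fourier (z / of_real ((\<alpha> $ j)\<^sup>2)) ((y $ j - x $ j) / \<alpha> $ j) (n j))"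
    by (rule prod_sum_PiE) auto
  also have "\<dots> = (\<Sum>n\<in>freq_box M. exp (- z * of_real ((torus_freq \<alpha> n)\<^sup>2)) * (torus_char \<alpha> n y * cnj (torus_char \<alpha> n x)))"
  proof (intro sum.cong refl)
    fix n :: "'n \<Rightarrow> int"
    have "- z * of_real ((torus_freq \<alpha> n)\<^sup>2) + \<i> * of_real ((\<Sum>j\<in>UNIV. of_int (n j) * (y $ j / \<alpha> $ j)) + - (\<Sum>j\<in>UNIV. of_int (n j) * (x $ j / \<alpha> $ j)))
       = (\<Sum>j\<in>UNIV. - (z / of_real ((\<alpha> $ j)\<^sup>2)) * of_int (n j) ^ 2 + \<i> * of_int (n j) * of_real ((y $ j - x $ j) / \<alpha> $ j))"
      unfolding torus_freq_sq of_real_sum of_real_add of_real_minus sum_distrib_left sum.distrib[symmetric] sum_negf[symmetric]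
      by (intro sum.cong refl) (simp add: power_divide diff_divide_distrib algebra_simps)
    then have "exp (- z * of_real ((torus_freq \<alpha> n)\<^sup>2)) * cis ((\<Sum>j\<in>UNIV. of_int (n j) * (y $ j / \<alpha> $ j)) + - (\<Sum>j\<in>UNIV. of_int (n j) * (x $ j / \<alpha> $ j)))
      = (\<Prod>j\<in>UNIV. theta_fourier (z / of_real ((\<alpha> $ j)\<^sup>2)) ((y $ j - x $ j) / \<alpha> $ j) (n j))"
      unfolding theta_fourier_def exp_sum[OF finite, symmetric] cis_conv_exp exp_add[symmetric] by simp
    then show "(\<Prod>j\<in>UNIV. theta_fourier (z / of_real ((\<alpha> $ j)\<^sup>2)) ((y $ j - x $ j) / \<alpha> $ j) (n j)) = exp (- z * of_real ((torus_freq \<alpha> n)\<^sup>2)) * (torus_char \<alpha> n y * cnj (torus_char \<alpha> n x))"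
      unfolding torus_char_def cis_cnj cis_mult by simp
  qed
  finally show ?thesis
    unfolding box_integrand_def mode_integrand_def z_def by (simp add: sum_distrib_left mult.assoc)
qed

text \<open>
  The sum is the quadratic form of the convolution operator with multiplier \<open>b\<close>, evaluated at \<open>g\<close>; an operator whose kernel
  is bounded by \<open>Q\<close> maps \<open>L\<^sup>1\<close> to bounded functions with norm at most \<open>Q\<close>.
\<close>

lemma quadratic_form_kernel_bound:
  fixes \<alpha> :: "real ^ 'n"
  assumes K: "finite K" and g: "integrable (torus_measure \<alpha>) g"
    and Q: "\<And>x y. norm (\<Sum>n\<in>K. b n * (torus_char \<alpha> n y * cnj (torus_char \<alpha> n x))) \<le> Q"
  shows "norm (\<Sum>n\<in>K. b n * of_real ((norm (torus_inner \<alpha> g (torus_char \<alpha> n)))\<^sup>2)) \<le> Q * (LINT x|torus_measure \<alpha>. norm (g x))\<^sup>2"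
proof -
  let ?M = "torus_measure \<alpha>"
  define G where "G = (LINT x|?M. norm (g x))"
  have G: "G \<ge> 0" by (simp add: G_def)
  have Q0: "Q \<ge> 0" using Q norm_ge_zero order_trans by blast
  define c where "c n = torus_inner \<alpha> g (torus_char \<alpha> n)" for n
  have i1: "integrable ?M (\<lambda>x. g x * cnj (torus_char \<alpha> n x))" for n
    by (rule integrable_mult_bounded[where B=1, OF g borel_measurable_torus_continuous]) (auto intro!: continuous_intros)
  have cg: "integrable ?M (\<lambda>y. cnj (g y))" using integrable_bounded_linear[OF bounded_linear_cnj g] .
  have i2: "integrable ?M (\<lambda>y. cnj (g y) * torus_char \<alpha> n y)" for n
    by (rule integrable_mult_bounded[where B=1, OF cg borel_measurable_torus_continuous]) (auto intro!: continuous_intros)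
  have cc: "cnj (c n) = (LINT y|?M. cnj (g y) * torus_char \<alpha> n y)" for n
    unfolding c_def torus_inner_def using integral_bounded_linear[OF bounded_linear_cnj i1[of n]] by simp
  define H where "H x = (\<Sum>n\<in>K. b n * cnj (c n) * cnj (torus_char \<alpha> n x))" for x
  have H_cont: "continuous_on UNIV H" unfolding H_def by (intro continuous_intros)
  have H_bound: "norm (H x) \<le> Q * G" for x
  proof -
    have eq: "cnj (g y) * (\<Sum>n\<in>K. b n * (torus_char \<alpha> n y * cnj (torus_char \<alpha> n x))) = (\<Sum>n\<in>K. b n * cnj (torus_char \<alpha> n x) * (cnj (g y) * torus_char \<alpha> n y))" for y
      unfolding sum_distrib_left by (intro sum.cong refl) (simp add: mult_ac)
    have "H x = (\<Sum>n\<in>K. b n * cnj (torus_char \<alpha> n x) * (LINT y|?M. cnj (g y) * torus_char \<alpha> n y))"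
      unfolding H_def cc by (intro sum.cong refl) (simp add: mult_ac)
    also have "\<dots> = (LINT y|?M. (\<Sum>n\<in>K. b n * cnj (torus_char \<alpha> n x) * (cnj (g y) * torus_char \<alpha> n y)))"
      by (simp add: Bochner_Integration.integral_sum i2)
    also have "\<dots> = (LINT y|?M. cnj (g y) * (\<Sum>n\<in>K. b n * (torus_char \<alpha> n y * cnj (torus_char \<alpha> n x))))"
      unfolding eq ..
    also have "norm \<dots> \<le> (LINT y|?M. norm (cnj (g y) * (\<Sum>n\<in>K. b n * (torus_char \<alpha> n y * cnj (torus_char \<alpha> n x)))))"
      by (rule integral_norm_bound)
    also have "\<dots> \<le> (LINT y|?M. Q * norm (g y))"
    proof (rule integral_mono)
      show "integrable ?M (\<lambda>y. norm (cnj (g y) * (\<Sum>n\<in>K. b n * (torus_char \<alpha> n y * cnj (torus_char \<alpha> n x)))))"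
        by (intro integrable_norm integrable_mult_bounded[where B=Q, OF cg borel_measurable_torus_continuous] Q continuous_intros)
      show "norm (cnj (g y) * (\<Sum>n\<in>K. b n * (torus_char \<alpha> n y * cnj (torus_char \<alpha> n x)))) \<le> Q * norm (g y)" for y
        using mult_right_mono[OF Q[of y x] norm_ge_zero[of "g y"]] by (simp add: norm_mult mult.commute)
    qed (use g in simp)
    also have "\<dots> = Q * G" by (simp add: G_def)
    finally show ?thesis .
  qed
  have "(\<Sum>n\<in>K. b n * of_real ((norm (c n))\<^sup>2)) = (\<Sum>n\<in>K. b n * cnj (c n) * (LINT x|?M. g x * cnj (torus_char \<alpha> n x)))"
    by (intro sum.cong refl) (simp add: c_def[symmetric] torus_inner_def[symmetric] complex_norm_square mult_ac del: of_real_power)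
  also have "\<dots> = (LINT x|?M. (\<Sum>n\<in>K. b n * cnj (c n) * (g x * cnj (torus_char \<alpha> n x))))"
    by (simp add: Bochner_Integration.integral_sum i1)
  also have "\<dots> = (LINT x|?M. g x * H x)"
    unfolding H_def sum_distrib_left by (intro Bochner_Integration.integral_cong sum.cong refl) (simp add: mult_ac)
  also have "norm \<dots> \<le> (LINT x|?M. norm (g x * H x))" by (rule integral_norm_bound)
  also have "\<dots> \<le> (LINT x|?M. (Q * G) * norm (g x))"
  proof (rule integral_mono)
    show "integrable ?M (\<lambda>x. norm (g x * H x))"
      by (intro integrable_norm integrable_mult_bounded[where B="Q * G", OF g borel_measurable_torus_continuous[OF H_cont]] H_bound)
    show "norm (g x * H x) \<le> Q * G * norm (g x)" for x
      using mult_right_mono[OF H_bound[of x] norm_ge_zero[of "g x"]] by (simp add: norm_mult mult.commute)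
  qed (use g in simp)
  also have "\<dots> = Q * G\<^sup>2" by (simp add: G_def power2_eq_square)
  finally show ?thesis by (simp add: c_def G_def)
qed

text \<open>
  The integral equals \<open>(1 - cos (\<tau> v)) / (\<tau> v\<^sup>2)\<close>. This is nonnegative, and comparable to \<open>\<tau>\<close> as long as
  \<open>\<tau> |v| \<le> 3/4 < \<pi>/3\<close>, since then the cosine is at least \<open>1/2\<close> on the whole interval.
\<close>

lemma fejer_integral:
  assumes \<tau>: "\<tau> > 0"
  shows "Re (integral {0..\<tau>} (\<lambda>t. of_real (1 - t / \<tau>) * cis (t * v))) = integral {0..\<tau>} (\<lambda>t. (1 - t / \<tau>) * cos (t * v))"
    and "integral {0..\<tau>} (\<lambda>t. (1 - t / \<tau>) * cos (t * v)) \<ge> 0"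
    and "\<tau> * \<bar>v\<bar> \<le> 3 / 4 \<Longrightarrow> integral {0..\<tau>} (\<lambda>t. (1 - t / \<tau>) * cos (t * v)) \<ge> \<tau> / 4"
proof -
  have "(\<lambda>t. complex_of_real (1 - t / \<tau>) * cis (t * v)) integrable_on {0..\<tau>}"
    using \<tau> by (intro integrable_continuous_real continuous_intros) auto
  from integral_linear[OF this bounded_linear_Re]
  show "Re (integral {0..\<tau>} (\<lambda>t. of_real (1 - t / \<tau>) * cis (t * v))) = integral {0..\<tau>} (\<lambda>t. (1 - t / \<tau>) * cos (t * v))"
    by (simp add: o_def)
  have int: "(\<lambda>t. (1 - t / \<tau>) * cos (t * v)) integrable_on {0..\<tau>}"
    using \<tau> by (intro integrable_continuous_real continuous_intros) auto
  have lin: "((\<lambda>t. 1 - t / \<tau>) has_integral \<tau> / 2) {0..\<tau>}"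
  proof -
    have "((\<lambda>t. 1 - t / \<tau>) has_integral ((\<tau> - \<tau>\<^sup>2 / (2 * \<tau>)) - (0 - 0\<^sup>2 / (2 * \<tau>)))) {0..\<tau>}"
      using \<tau> by (intro fundamental_theorem_of_calculus)
        (auto intro!: derivative_eq_intros simp: has_real_derivative_iff_has_vector_derivative[symmetric])
    then show ?thesis using \<tau> by (simp add: power2_eq_square)
  qed
  show "integral {0..\<tau>} (\<lambda>t. (1 - t / \<tau>) * cos (t * v)) \<ge> 0"
  proof (cases "v = 0")
    case True then show ?thesis using lin \<tau> by (simp add: integral_unique)
  next
    case False
    define P where "P t = (1 - t / \<tau>) * sin (t * v) / v - cos (t * v) / (\<tau> * v\<^sup>2)" for t
    have "((\<lambda>t. (1 - t / \<tau>) * cos (t * v)) has_integral (P \<tau> - P 0)) {0..\<tau>}"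
    proof (rule fundamental_theorem_of_calculus)
      fix t
      have "(P has_real_derivative (1 - t / \<tau>) * cos (t * v)) (at t within {0..\<tau>})"
        unfolding P_def using \<tau> False by (auto intro!: derivative_eq_intros simp: power2_eq_square field_simps)
      then show "(P has_vector_derivative (1 - t / \<tau>) * cos (t * v)) (at t within {0..\<tau>})"
        by (simp add: has_real_derivative_iff_has_vector_derivative)
    qed (use \<tau> in simp)
    then have "integral {0..\<tau>} (\<lambda>t. (1 - t / \<tau>) * cos (t * v)) = (1 - cos (\<tau> * v)) / (\<tau> * v\<^sup>2)"
      using \<tau> by (simp add: integral_unique P_def diff_divide_distrib)
    also have "\<dots> \<ge> 0" using \<tau> by (intro divide_nonneg_nonneg) auto
    finally show ?thesis .
  qed
  assume v: "\<tau> * \<bar>v\<bar> \<le> 3 / 4"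
  have "integral {0..\<tau>} (\<lambda>t. (1 - t / \<tau>) * (1 / 2)) \<le> integral {0..\<tau>} (\<lambda>t. (1 - t / \<tau>) * cos (t * v))"
  proof (rule integral_le[OF _ int])
    show "(\<lambda>t. (1 - t / \<tau>) * (1 / 2)) integrable_on {0..\<tau>}"
      using \<tau> by (intro integrable_continuous_real continuous_intros) auto
    fix t assume t: "t \<in> {0..\<tau>}"
    have "\<bar>t * v\<bar> \<le> \<tau> * \<bar>v\<bar>" using t by (simp add: abs_mult mult_right_mono)
    then have "\<bar>t * v\<bar> \<le> pi / 3" using v pi_gt3 by simp
    then have "cos (pi / 3) \<le> cos \<bar>t * v\<bar>" using pi_gt_zero by (intro cos_monotone_0_pi_le) auto
    then have "1 / 2 \<le> cos (t * v)" by (simp add: cos_60)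
    then show "(1 - t / \<tau>) * (1 / 2) \<le> (1 - t / \<tau>) * cos (t * v)"
      using t \<tau> by (intro mult_left_mono) auto
  qed
  moreover have "integral {0..\<tau>} (\<lambda>t. (1 - t / \<tau>) * (1 / 2)) = \<tau> / 4"
    using integral_unique[OF has_integral_mult_left[OF lin, of "1/2"]] by simp
  ultimately show "integral {0..\<tau>} (\<lambda>t. (1 - t / \<tau>) * cos (t * v)) \<ge> \<tau> / 4" by simp
qed

text \<open>
  On the left, \<open>exp (-4) \<tau> / 4\<close> is a lower bound for the Fejer multiplier on the shell. Since the multiplier is nonnegative
  everywhere, the sum over the shell may be extended to a large box of frequencies. There the times before \<open>a\<close>
  contribute a multiplier bounded by \<open>a\<close>, to which Bessel's inequality applies, and the times
  after \<open>a\<close> a kernel bounded by \<open>Q\<close>, up to the truncation error \<open>\<eta>\<close>.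
\<close>

lemma window_coefficients_bound:
  fixes \<alpha> :: "real ^ 'n"
  assumes l: "l > 0" and \<alpha>: "\<And>j. \<alpha> $ j > 0" and \<tau>: "\<tau> > 0" and a: "0 \<le> a" "a \<le> \<tau>"
    and S: "finite S" "\<And>n. n \<in> S \<Longrightarrow> \<tau> * \<bar>(torus_freq \<alpha> n)\<^sup>2 - l\<^sup>2\<bar> \<le> 3 / 4" "\<And>n. n \<in> S \<Longrightarrow> torus_freq \<alpha> n \<le> 2 * l"
    and g: "integrable (torus_measure \<alpha>) g" "integrable (torus_measure \<alpha>) (\<lambda>x. (norm (g x))\<^sup>2)"
    and Q: "\<And>\<theta>. norm (integral {a..\<tau>} (kernel_integrand l \<tau> \<alpha> \<theta>)) \<le> Q"
  shows "exp (-4) * (\<tau> / 4) * (\<Sum>n\<in>S. (norm (torus_inner \<alpha> g (torus_char \<alpha> n)))\<^sup>2)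
    \<le> a * (measure lebesgue (torus_cell \<alpha>) * (LINT x|torus_measure \<alpha>. (norm (g x))\<^sup>2)) + Q * (LINT x|torus_measure \<alpha>. norm (g x))\<^sup>2"
proof -
  define c where "c n = (norm (torus_inner \<alpha> g (torus_char \<alpha> n)))\<^sup>2" for n
  have c: "c n \<ge> 0" for n by (simp add: c_def)
  define W where "W = measure lebesgue (torus_cell \<alpha>) * (LINT x|torus_measure \<alpha>. (norm (g x))\<^sup>2)"
  define G where "G = (LINT x|torus_measure \<alpha>. norm (g x))\<^sup>2"
  have G: "G \<ge> 0" by (simp add: G_def)
  let ?I = "\<lambda>n. integral {0..\<tau>} (mode_integrand l \<tau> \<alpha> n)"
  have Re_I: "Re (?I n) = exp (- (torus_freq \<alpha> n)\<^sup>2 / l\<^sup>2) * integral {0..\<tau>} (\<lambda>t. (1 - t / \<tau>) * cos (t * ((torus_freq \<alpha> n)\<^sup>2 - l\<^sup>2)))" for n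
    unfolding mode_integrand_eq[abs_def] integral_mult_right fejer_integral(1)[OF \<tau>, symmetric] by simp
  have pos: "Re (?I n) \<ge> 0" for n unfolding Re_I using fejer_integral(2)[OF \<tau>] by simp
  have low: "exp (-4) * (\<tau> / 4) \<le> Re (?I n)" if "n \<in> S" for n
    unfolding Re_I
  proof (intro mult_mono)
    have "(torus_freq \<alpha> n)\<^sup>2 \<le> (2 * l)\<^sup>2" using S(3)[OF that] torus_freq_nonneg by (intro power_mono) auto
    then show "exp (-4) \<le> exp (- (torus_freq \<alpha> n)\<^sup>2 / l\<^sup>2)" using l by (simp add: power_mult_distrib divide_le_eq)
  qed (use fejer_integral(3)[OF \<tau> S(2)[OF that]] \<tau> in auto)
  have main: "exp (-4) * (\<tau> / 4) * (\<Sum>n\<in>S. c n) \<le> a * W + (Q + \<eta>) * G" if \<eta>: "\<eta> > 0" for \<eta>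
  proof -
    obtain M0 where M0: "\<And>M \<theta>. M \<ge> M0 \<Longrightarrow> norm (integral {a..\<tau>} (box_integrand l \<tau> \<alpha> M \<theta>)) \<le> norm (integral {a..\<tau>} (kernel_integrand l \<tau> \<alpha> \<theta>)) + \<eta>"
      using box_integrand_approx[OF l \<alpha> a \<tau> \<eta>] by blast
    obtain M1 where M1: "\<And>M. M \<ge> M1 \<Longrightarrow> {n. torus_freq \<alpha> n \<le> 2 * l} \<subseteq> freq_box M"
      using torus_freq_le_box[OF \<alpha>, of "2 * l"] by blast
    define M where "M = max M0 M1"
    let ?K = "freq_box M :: ('n \<Rightarrow> int) set"
    have SK: "S \<subseteq> ?K" using M1[of M] S(3) by (auto simp: M_def)
    have K: "finite ?K" by (rule finite_freq_box)
    define b where "b n = integral {a..\<tau>} (mode_integrand l \<tau> \<alpha> n)" for n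
    have int: "mode_integrand l \<tau> \<alpha> n integrable_on {u..v}" for n u v
      by (rule integrable_continuous_real[OF mode_integrand_continuous[OF \<tau>]])
    have split: "?I n = integral {0..a} (mode_integrand l \<tau> \<alpha> n) + b n" for n
      unfolding b_def using Henstock_Kurzweil_Integration.integral_combine[OF a int] by simp
    have near: "Re (integral {0..a} (mode_integrand l \<tau> \<alpha> n)) \<le> a" for n
    proof -
      have "norm (integral {0..a} (mode_integrand l \<tau> \<alpha> n)) \<le> 1 * (a - 0)"
      proof (rule integral_bound[OF a(1) mode_integrand_continuous[OF \<tau>]])
        fix t assume t: "t \<in> {0..a}"
        have "norm (complex_of_real (1 - t / \<tau>)) \<le> 1"
          unfolding norm_of_real using t a \<tau> by (auto simp: abs_le_iff divide_simps)
        moreover have "norm (complex_of_real (exp (- (torus_freq \<alpha> n)\<^sup>2 / l\<^sup>2))) \<le> 1" by simp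
        ultimately have "norm (mode_integrand l \<tau> \<alpha> n t) \<le> 1 * (1 * 1)"
          unfolding mode_integrand_eq norm_mult by (intro mult_mono) auto
        then show "norm (mode_integrand l \<tau> \<alpha> n t) \<le> 1" by simp
      qed
      then show ?thesis using complex_Re_le_cmod[of "integral {0..a} (mode_integrand l \<tau> \<alpha> n)"] by simp
    qed
    have "norm (\<Sum>n\<in>?K. b n * (torus_char \<alpha> n y * cnj (torus_char \<alpha> n x))) \<le> Q + \<eta>" for x y
    proof -
      have "(\<Sum>n\<in>?K. b n * (torus_char \<alpha> n y * cnj (torus_char \<alpha> n x))) = integral {a..\<tau>} (box_integrand l \<tau> \<alpha> M (\<chi> j. (y $ j - x $ j) / \<alpha> $ j))"
        unfolding box_integrand_expand[OF \<alpha>] b_def using K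
        by (subst integral_sum) (auto intro!: integrable_on_mult_left int)
      also have "norm \<dots> \<le> norm (integral {a..\<tau>} (kernel_integrand l \<tau> \<alpha> (\<chi> j. (y $ j - x $ j) / \<alpha> $ j))) + \<eta>"
        by (rule M0) (simp add: M_def)
      also have "\<dots> \<le> Q + \<eta>" using Q by simp
      finally show ?thesis .
    qed
    from quadratic_form_kernel_bound[OF K g(1) this]
    have far: "norm (\<Sum>n\<in>?K. b n * of_real (c n)) \<le> (Q + \<eta>) * G" unfolding c_def G_def by simp
    have "exp (-4) * (\<tau> / 4) * (\<Sum>n\<in>S. c n) = (\<Sum>n\<in>S. exp (-4) * (\<tau> / 4) * c n)" by (simp add: sum_distrib_left)
    also have "\<dots> \<le> (\<Sum>n\<in>S. Re (?I n) * c n)" by (intro sum_mono mult_right_mono low c)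
    also have "\<dots> \<le> (\<Sum>n\<in>?K. Re (?I n) * c n)" using SK K pos c by (intro sum_mono2) auto
    also have "\<dots> = (\<Sum>n\<in>?K. Re (integral {0..a} (mode_integrand l \<tau> \<alpha> n)) * c n) + Re (\<Sum>n\<in>?K. b n * of_real (c n))"
      unfolding split by (simp add: distrib_right sum.distrib)
    also have "\<dots> \<le> (\<Sum>n\<in>?K. a * c n) + norm (\<Sum>n\<in>?K. b n * of_real (c n))"
      by (intro add_mono sum_mono mult_right_mono near c complex_Re_le_cmod)
    also have "\<dots> \<le> a * W + (Q + \<eta>) * G"
      unfolding sum_distrib_left[symmetric]
      using torus_bessel[OF \<alpha> K g] a far by (intro add_mono mult_left_mono) (auto simp: c_def W_def)
    finally show ?thesis .
  qed
  have "exp (-4) * (\<tau> / 4) * (\<Sum>n\<in>S. c n) \<le> a * W + Q * G"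
  proof (rule field_le_epsilon)
    fix e :: real assume e: "e > 0"
    define \<eta> where "\<eta> = e / (G + 1)"
    have \<eta>: "\<eta> > 0" using e G by (simp add: \<eta>_def)
    have "\<eta> * G \<le> \<eta> * (G + 1)" using \<eta> by (intro mult_left_mono) auto
    also have "\<dots> = e" using G by (simp add: \<eta>_def)
    finally show "exp (-4) * (\<tau> / 4) * (\<Sum>n\<in>S. c n) \<le> a * W + Q * G + e"
      using main[OF \<eta>] by (simp add: distrib_right)
  qed
  then show ?thesis unfolding c_def W_def G_def .
qed

section \<open>Level sets of trigonometric polynomials\<close>

definition level_set :: "real ^ 'n \<Rightarrow> (real ^ 'n \<Rightarrow> complex) \<Rightarrow> real \<Rightarrow> (real ^ 'n) set" where
  "level_set \<alpha> F h = {x \<in> torus_cell \<alpha>. h \<le> norm (F x)}"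

lemma level_set_sets:
  assumes "continuous_on UNIV F"
  shows "level_set \<alpha> F h \<in> sets (torus_measure \<alpha>)"
proof -
  have "F \<in> borel_measurable (torus_measure \<alpha>)" by (rule borel_measurable_torus_continuous[OF assms])
  then have "{x \<in> space (torus_measure \<alpha>). h \<le> norm (F x)} \<in> sets (torus_measure \<alpha>)" by measurable
  then show ?thesis by (simp add: level_set_def space_torus_measure)
qed

text \<open>
  The witness \<open>g\<close> is the phase of \<open>F\<close> on the level set. The pairing of \<open>F\<close> with \<open>g\<close> is at least \<open>h A\<close>; by the
  Cauchy-Schwarz inequality it is at most the root of the square sum of the Fourier coefficients of \<open>g\<close>.
\<close>

lemma trig_poly_level_duality:
  fixes \<alpha> :: "real ^ 'n"
  assumes \<alpha>: "\<And>j. \<alpha> $ j > 0" and h: "h > 0" and S: "finite S" and c: "(\<Sum>n\<in>S. (norm (c n))\<^sup>2) \<le> 1"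
  defines "F \<equiv> trig_poly \<alpha> S c"
  defines "A \<equiv> measure (torus_measure \<alpha>) (level_set \<alpha> F h)"
  shows "\<exists>g. integrable (torus_measure \<alpha>) g \<and> integrable (torus_measure \<alpha>) (\<lambda>x. (norm (g x))\<^sup>2) \<and>
    (LINT x|torus_measure \<alpha>. norm (g x)) = A \<and> (LINT x|torus_measure \<alpha>. (norm (g x))\<^sup>2) = A \<and>
    (h * A)\<^sup>2 \<le> (\<Sum>n\<in>S. (norm (torus_inner \<alpha> g (torus_char \<alpha> n)))\<^sup>2)"
proof -
  let ?M = "torus_measure \<alpha>"
  interpret finite_measure ?M by (rule finite_measure_torus)
  define E where "E = level_set \<alpha> F h"
  have F: "continuous_on UNIV F" unfolding F_def by (rule continuous_trig_poly)
  have Fm: "F \<in> borel_measurable ?M" by (rule borel_measurable_torus_continuous[OF F])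
  have E: "E \<in> sets ?M" unfolding E_def by (rule level_set_sets[OF F])
  define g where "g x = indicator E x * sgn (F x)" for x
  have gm: "g \<in> borel_measurable ?M"
  proof -
    have "g = (\<lambda>x. indicator E x * (inverse (norm (F x)) *\<^sub>R F x))"
      by (simp add: g_def fun_eq_iff sgn_div_norm)
    moreover have "(\<lambda>x. norm (F x)) \<in> borel_measurable ?M" using Fm by measurable
    ultimately show ?thesis
      by (simp only:) (intro borel_measurable_times borel_measurable_indicator E borel_measurable_scaleR borel_measurable_inverse Fm)
  qed
  have ng: "norm (g x) = indicator E x" for x
    using h by (auto simp: g_def E_def level_set_def norm_mult norm_sgn indicator_def)
  have ng2: "(norm (g x))\<^sup>2 = indicator E x" for x unfolding ng by (simp add: indicator_def)
  have iE: "integrable ?M (indicator E :: _ \<Rightarrow> real)" using E by (intro integrable_real_indicator) (auto simp: less_top[symmetric])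
  have ig: "integrable ?M g"
    by (rule Bochner_Integration.integrable_bound[OF iE gm]) (simp add: ng)
  have IE: "(LINT x|?M. indicator E x) = A" using E by (simp add: A_def E_def)
  have gF: "integrable ?M (\<lambda>x. g x * cnj (F x))"
  proof -
    have "integrable ?M (\<lambda>x. cnj (F x))" by (intro integrable_torus_continuous continuous_intros F)
    from integrable_mult_bounded[OF this gm, of 1] show ?thesis by (simp add: ng mult.commute indicator_def)
  qed
  have gF_eq: "g x * cnj (F x) = of_real (indicator E x * norm (F x))" for x
  proof -
    have "sgn (F x) * cnj (F x) = of_real (norm (F x))"
      by (cases "F x = 0") (simp_all add: sgn_eq complex_norm_square[symmetric] power2_eq_square)
    then show ?thesis by (simp add: g_def mult.assoc indicator_def)
  qed
  have "h * A \<le> (LINT x|?M. indicator E x * norm (F x))"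
  proof -
    have "h * A = (LINT x|?M. h * indicator E x)" by (simp only: integral_mult_right_zero IE)
    also have "\<dots> \<le> (LINT x|?M. indicator E x * norm (F x))"
    proof (rule integral_mono)
      show "integrable ?M (\<lambda>x. h * indicator E x)" using iE by simp
      have "integrable ?M (\<lambda>x. Re (g x * cnj (F x)))" by (rule integrable_bounded_linear[OF bounded_linear_Re gF])
      then show "integrable ?M (\<lambda>x. indicator E x * norm (F x))" unfolding gF_eq Re_complex_of_real .
      show "h * indicator E x \<le> indicator E x * norm (F x)" for x
        by (auto simp: indicator_def E_def level_set_def)
    qed
    finally show ?thesis .
  qed
  also have "\<dots> = norm (torus_inner \<alpha> g F)"
  proof -
    have "torus_inner \<alpha> g F = of_real (LINT x|?M. indicator E x * norm (F x))"
      unfolding torus_inner_def gF_eq by (rule integral_complex_of_real)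
    moreover have "(LINT x|?M. indicator E x * norm (F x)) \<ge> 0" by (intro Bochner_Integration.integral_nonneg) (auto simp: indicator_def)
    ultimately show ?thesis by simp
  qed
  also have "torus_inner \<alpha> g F = (\<Sum>n\<in>S. cnj (c n) * torus_inner \<alpha> g (torus_char \<alpha> n))"
    unfolding F_def by (rule torus_inner_trig_poly_right[OF ig])
  also have "norm \<dots> \<le> (\<Sum>n\<in>S. norm (c n) * norm (torus_inner \<alpha> g (torus_char \<alpha> n)))"
    by (rule sum_norm_le) (simp add: norm_mult)
  finally have 1: "h * A \<le> (\<Sum>n\<in>S. norm (c n) * norm (torus_inner \<alpha> g (torus_char \<alpha> n)))" .
  have "(h * A)\<^sup>2 \<le> (\<Sum>n\<in>S. norm (c n) * norm (torus_inner \<alpha> g (torus_char \<alpha> n)))\<^sup>2"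
    using 1 h by (intro power_mono) (auto simp: A_def)
  also have "\<dots> \<le> (\<Sum>n\<in>S. (norm (c n))\<^sup>2) * (\<Sum>n\<in>S. (norm (torus_inner \<alpha> g (torus_char \<alpha> n)))\<^sup>2)"
    by (rule Cauchy_Schwarz_ineq_sum)
  also have "\<dots> \<le> 1 * (\<Sum>n\<in>S. (norm (torus_inner \<alpha> g (torus_char \<alpha> n)))\<^sup>2)"
    using c by (intro mult_right_mono sum_nonneg) auto
  finally show ?thesis
    by (intro exI[of _ g]) (use ig iE IE in \<open>simp add: ng2, simp add: ng\<close>)
qed

lemma near_size_powr: "a > 0 \<Longrightarrow> near_size d a = a powr (- ((real d - 1) / 2))"
proof -
  assume a: "a > 0"
  have "sqrt a ^ d = a powr (real d / 2)"
    using a by (simp add: powr_half_sqrt[symmetric] powr_realpow[symmetric] powr_powr)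
  then show ?thesis using a
    by (simp add: near_size_def powr_half_sqrt[symmetric] powr_diff[symmetric] diff_divide_distrib)
qed

lemma far_size_powr: "a > 0 \<Longrightarrow> l > 0 \<Longrightarrow> far_size d l a = l powr d * a powr ((real d + 1) / 2)"
proof -
  assume a: "a > 0" and l: "l > 0"
  have "sqrt a ^ d = a powr (real d / 2)"
    using a by (simp add: powr_half_sqrt[symmetric] powr_realpow[symmetric] powr_powr)
  then show ?thesis using a l
    by (simp add: far_size_def power_mult_distrib powr_half_sqrt[symmetric] powr_realpow add_divide_distrib powr_add)
qed

text \<open>
  On the shell \<open>||n|\<^sup>2 - l\<^sup>2| \<le> 3 l \<delta>\<close>. With \<open>\<tau> = 1 / (4 l \<delta>)\<close> the phase in the Fejer multiplier therefore stays below
  \<open>3/4\<close>, and duality can be combined with the kernel bound.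
\<close>

lemma window_level_inequality:
  fixes \<alpha> :: "real ^ 'n"
  assumes \<alpha>: "\<And>j. \<alpha> $ j > 0" and d: "CARD('n) \<ge> 3"
  shows "\<exists>B>0. \<forall>l \<delta> S c h a. 4 \<le> l \<longrightarrow> 0 < \<delta> \<longrightarrow> \<delta> \<le> 1 \<longrightarrow> S \<subseteq> torus_window \<alpha> l \<delta> \<longrightarrow> (\<Sum>n\<in>S. (norm (c n))\<^sup>2) \<le> 1 \<longrightarrow> 0 < h \<longrightarrow>
    0 \<le> a \<longrightarrow> a \<le> 1 / (4 * l * \<delta>) \<longrightarrow>
    (h * measure (torus_measure \<alpha>) (level_set \<alpha> (trig_poly \<alpha> S c) h))\<^sup>2 \<le>
      B * (l * \<delta> * a * measure (torus_measure \<alpha>) (level_set \<alpha> (trig_poly \<alpha> S c) h) +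
        \<delta> * (near_size CARD('n) (max a (1 / l\<^sup>2)) + far_size CARD('n) l (1 / (4 * l * \<delta>))) * (measure (torus_measure \<alpha>) (level_set \<alpha> (trig_poly \<alpha> S c) h))\<^sup>2)"
proof -
  obtain B0 where B0: "B0 > 0" "\<And>l \<tau> a \<theta>. 1 \<le> l \<Longrightarrow> 1 / l\<^sup>2 \<le> \<tau> \<Longrightarrow> 0 \<le> a \<Longrightarrow> a \<le> \<tau> \<Longrightarrow>
     norm (integral {a..\<tau>} (kernel_integrand l \<tau> \<alpha> \<theta>)) \<le> B0 / l * (near_size CARD('n) (max a (1 / l\<^sup>2)) + far_size CARD('n) l \<tau>)"
    using kernel_bound[OF \<alpha> d] by blast
  define V where "V = measure lebesgue (torus_cell \<alpha>)"
  have V: "V > 0" unfolding V_def by (rule measure_torus_cell_pos[OF \<alpha>])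
  define B where "B = 16 * exp 4 * (V + B0)"
  show ?thesis
  proof (intro exI[of _ B] conjI allI impI)
    show "B > 0" using V B0 by (simp add: B_def)
    fix l \<delta> h a :: real and S :: "('n \<Rightarrow> int) set" and c :: "('n \<Rightarrow> int) \<Rightarrow> complex"
    assume l: "4 \<le> l" and \<delta>: "0 < \<delta>" "\<delta> \<le> 1" and S: "S \<subseteq> torus_window \<alpha> l \<delta>" and c: "(\<Sum>n\<in>S. (norm (c n))\<^sup>2) \<le> 1" and h: "0 < h"
      and a: "0 \<le> a" "a \<le> 1 / (4 * l * \<delta>)"
    define \<tau> where "\<tau> = 1 / (4 * l * \<delta>)"
    define A where "A = measure (torus_measure \<alpha>) (level_set \<alpha> (trig_poly \<alpha> S c) h)"
    define N where "N = near_size CARD('n) (max a (1 / l\<^sup>2)) + far_size CARD('n) l \<tau>"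
    have l0: "l > 0" using l by simp
    have \<tau>: "\<tau> > 0" using l0 \<delta> by (simp add: \<tau>_def)
    have N: "N \<ge> 0"
    proof -
      have "1 / l\<^sup>2 > 0" using l0 by simp
      then have "max a (1 / l\<^sup>2) > 0" by linarith
      then show ?thesis unfolding N_def using \<tau> l0 by (intro add_nonneg_nonneg near_size_nonneg) (auto simp: far_size_def)
    qed
    have A: "A \<ge> 0" by (simp add: A_def)
    have \<tau>l: "1 / l\<^sup>2 \<le> \<tau>"
    proof -
      have "4 * l * \<delta> \<le> l\<^sup>2" unfolding power2_eq_square
      proof -
        have "4 * l * \<delta> \<le> 4 * l * 1" using l0 \<delta> by (intro mult_left_mono) auto
        also have "\<dots> \<le> l * l" using l by simp
        finally show "4 * l * \<delta> \<le> l * l" .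
      qed
      then show ?thesis unfolding \<tau>_def using l0 \<delta> by (intro divide_left_mono) auto
    qed
    have fin: "finite S" by (rule finite_subset[OF S finite_torus_window[OF \<alpha>]])
    have S1: "\<tau> * \<bar>(torus_freq \<alpha> n)\<^sup>2 - l\<^sup>2\<bar> \<le> 3 / 4" and S2: "torus_freq \<alpha> n \<le> 2 * l" if "n \<in> S" for n
    proof -
      have f: "\<bar>torus_freq \<alpha> n - l\<bar> \<le> \<delta>" using S that by (auto simp: torus_window_def abs_le_iff)
      then show f2: "torus_freq \<alpha> n \<le> 2 * l" using l \<delta> by linarith
      have "\<bar>(torus_freq \<alpha> n)\<^sup>2 - l\<^sup>2\<bar> = \<bar>torus_freq \<alpha> n - l\<bar> * (torus_freq \<alpha> n + l)"
        using torus_freq_nonneg[of \<alpha> n] l0 by (simp add: power2_eq_square square_diff_square_factored abs_mult mult.commute)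
      also have "\<dots> \<le> \<delta> * (3 * l)" using f f2 \<delta> torus_freq_nonneg[of \<alpha> n] l0 by (intro mult_mono) auto
      finally have "\<tau> * \<bar>(torus_freq \<alpha> n)\<^sup>2 - l\<^sup>2\<bar> \<le> \<tau> * (\<delta> * (3 * l))" using \<tau> by (intro mult_left_mono) auto
      also have "\<dots> = 3 / 4" using l0 \<delta> by (simp add: \<tau>_def)
      finally show "\<tau> * \<bar>(torus_freq \<alpha> n)\<^sup>2 - l\<^sup>2\<bar> \<le> 3 / 4" .
    qed
    obtain g where g: "integrable (torus_measure \<alpha>) g" "integrable (torus_measure \<alpha>) (\<lambda>x. (norm (g x))\<^sup>2)"
      "(LINT x|torus_measure \<alpha>. norm (g x)) = A" "(LINT x|torus_measure \<alpha>. (norm (g x))\<^sup>2) = A"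
      "(h * A)\<^sup>2 \<le> (\<Sum>n\<in>S. (norm (torus_inner \<alpha> g (torus_char \<alpha> n)))\<^sup>2)"
      using trig_poly_level_duality[OF \<alpha> h fin c] unfolding A_def by blast
    have "exp (-4) * (\<tau> / 4) * (h * A)\<^sup>2 \<le> exp (-4) * (\<tau> / 4) * (\<Sum>n\<in>S. (norm (torus_inner \<alpha> g (torus_char \<alpha> n)))\<^sup>2)"
      using g(5) \<tau> by (intro mult_left_mono) auto
    also have "\<dots> \<le> a * (V * A) + (B0 / l * N) * A\<^sup>2"
    proof -
      have "norm (integral {a..\<tau>} (kernel_integrand l \<tau> \<alpha> \<theta>)) \<le> B0 / l * N" for \<theta>
        unfolding N_def using B0(2)[of l \<tau> a \<theta>] l \<tau>l a by (simp add: \<tau>_def)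
      from window_coefficients_bound[OF l0 \<alpha> \<tau> a[folded \<tau>_def] fin S1 S2 g(1,2) this]
      show ?thesis unfolding g(3,4) V_def .
    qed
    finally have "exp (-4) * (\<tau> / 4) * (h * A)\<^sup>2 \<le> a * (V * A) + (B0 / l * N) * A\<^sup>2" .
    then have "(16 * l * \<delta> * exp 4) * (exp (-4) * (\<tau> / 4) * (h * A)\<^sup>2) \<le> (16 * l * \<delta> * exp 4) * (a * (V * A) + (B0 / l * N) * A\<^sup>2)"
      using l0 \<delta> by (intro mult_left_mono) auto
    moreover have "(16 * l * \<delta> * exp 4) * (exp (-4) * (\<tau> / 4) * (h * A)\<^sup>2) = (h * A)\<^sup>2"
    proof -
      have "exp 4 * exp (-4) = (1::real)" by (simp add: exp_add[symmetric])
      moreover have "16 * l * \<delta> * (\<tau> / 4) = 1" using l0 \<delta> by (simp add: \<tau>_def)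
      ultimately have "(16 * l * \<delta> * (\<tau> / 4)) * (exp 4 * exp (-4)) * (h * A)\<^sup>2 = (h * A)\<^sup>2" by simp
      then show ?thesis by (simp only: mult_ac)
    qed
    moreover have "(16 * l * \<delta> * exp 4) * (a * (V * A) + (B0 / l * N) * A\<^sup>2) = 16 * exp 4 * V * (l * \<delta> * a * A) + 16 * exp 4 * B0 * (\<delta> * N * A\<^sup>2)"
      using l0 by (simp add: field_simps)
    moreover have "\<dots> \<le> B * (l * \<delta> * a * A) + B * (\<delta> * N * A\<^sup>2)"
      using V B0 l0 \<delta> a A N by (intro add_mono mult_right_mono) (auto simp: B_def)
    ultimately have "(h * A)\<^sup>2 \<le> B * (l * \<delta> * a * A + \<delta> * N * A\<^sup>2)" by (simp only: distrib_left[of B])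
    then show "(h * measure (torus_measure \<alpha>) (level_set \<alpha> (trig_poly \<alpha> S c) h))\<^sup>2 \<le>
      B * (l * \<delta> * a * measure (torus_measure \<alpha>) (level_set \<alpha> (trig_poly \<alpha> S c) h) +
        \<delta> * (near_size CARD('n) (max a (1 / l\<^sup>2)) + far_size CARD('n) l (1 / (4 * l * \<delta>))) * (measure (torus_measure \<alpha>) (level_set \<alpha> (trig_poly \<alpha> S c) h))\<^sup>2)"
      unfolding A_def N_def \<tau>_def .
  qed
qed

text \<open>
  The height is large enough for the part of the kernel bound coming from \<open>far_size\<close> to be absorbed into the left-hand side. The
  free time is chosen as the \<open>t\<close> at which \<open>near_size\<close> can be absorbed as well, \<open>t powr b = 4 B \<delta> / h\<^sup>2\<close>, and what
  remains is linear in the measure. If \<open>t < 1 / l\<^sup>2\<close>, the time 0 can be used instead; then nothing remains and the level set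
  is null.
\<close>

lemma level_set_bound:
  fixes \<alpha> :: "real ^ 'n"
  assumes \<alpha>: "\<And>j. \<alpha> $ j > 0" and d: "CARD('n) \<ge> 3"
  defines "b \<equiv> (real CARD('n) - 1) / 2"
  shows "\<exists>C\<ge>1. \<forall>l \<delta> S c h. 4 \<le> l \<longrightarrow> 0 < \<delta> \<longrightarrow> \<delta> \<le> 1 \<longrightarrow> S \<subseteq> torus_window \<alpha> l \<delta> \<longrightarrow> (\<Sum>n\<in>S. (norm (c n))\<^sup>2) \<le> 1 \<longrightarrow> 0 < h \<longrightarrow>
    C * (l / \<delta>) powr b \<le> h\<^sup>2 \<longrightarrow>
    (C * \<delta> * l powr (2 * b) < h\<^sup>2 \<longrightarrow> measure (torus_measure \<alpha>) (level_set \<alpha> (trig_poly \<alpha> S c) h) = 0) \<and>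
    measure (torus_measure \<alpha>) (level_set \<alpha> (trig_poly \<alpha> S c) h) \<le> C * (l * \<delta> powr (1 + 1 / b)) * h powr (- (2 + 2 / b))"
proof -
  obtain B where B: "B > 0" and ineq: "\<And>l \<delta> S c h a. 4 \<le> l \<Longrightarrow> 0 < \<delta> \<Longrightarrow> \<delta> \<le> 1 \<Longrightarrow> S \<subseteq> torus_window \<alpha> l \<delta> \<Longrightarrow> (\<Sum>n\<in>S. (norm (c n))\<^sup>2) \<le> 1 \<Longrightarrow> 0 < h \<Longrightarrow>
    0 \<le> a \<Longrightarrow> a \<le> 1 / (4 * l * \<delta>) \<Longrightarrow>
    (h * measure (torus_measure \<alpha>) (level_set \<alpha> (trig_poly \<alpha> S c) h))\<^sup>2 \<le>
      B * (l * \<delta> * a * measure (torus_measure \<alpha>) (level_set \<alpha> (trig_poly \<alpha> S c) h) +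
        \<delta> * (near_size CARD('n) (max a (1 / l\<^sup>2)) + far_size CARD('n) l (1 / (4 * l * \<delta>))) * (measure (torus_measure \<alpha>) (level_set \<alpha> (trig_poly \<alpha> S c) h))\<^sup>2)"
    using window_level_inequality[OF \<alpha> d] by blast
  have b: "b \<ge> 1" using d by (simp add: b_def)
  define C where "C = 1 + 4 * B * 4 powr b + 2 * B * (4 * B) powr (1 / b)"
  have p4: "4 powr b \<ge> 1" using b by (simp add: ge_one_powr_ge_zero)
  have "4 * B * 1 \<le> 4 * B * 4 powr b" using p4 B by (intro mult_left_mono) auto
  moreover have "0 \<le> 2 * B * (4 * B) powr (1 / b)" using B by simp
  ultimately have C: "C \<ge> 1" "4 * B \<le> C" "4 * B * 4 powr b \<le> C" "2 * B * (4 * B) powr (1 / b) \<le> C"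
    using B unfolding C_def by linarith+
  show ?thesis
  proof (intro exI[of _ C] conjI C(1) allI impI)
    fix l \<delta> h :: real and S :: "('n \<Rightarrow> int) set" and c :: "('n \<Rightarrow> int) \<Rightarrow> complex"
    assume l: "4 \<le> l" and \<delta>: "0 < \<delta>" "\<delta> \<le> 1" and S: "S \<subseteq> torus_window \<alpha> l \<delta>" and c: "(\<Sum>n\<in>S. (norm (c n))\<^sup>2) \<le> 1" and h: "0 < h"
      and hC: "C * (l / \<delta>) powr b \<le> h\<^sup>2"
    define X where "X = measure (torus_measure \<alpha>) (level_set \<alpha> (trig_poly \<alpha> S c) h)"
    have X: "X \<ge> 0" by (simp add: X_def)
    have l0: "l > 0" using l by simp
    define \<tau> where "\<tau> = 1 / (4 * l * \<delta>)"
    have \<tau>: "\<tau> > 0" using l0 \<delta> by (simp add: \<tau>_def)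
    have q0: "(l / \<delta>) powr b > 0" using l0 \<delta> by simp
    have far: "B * \<delta> * far_size CARD('n) l \<tau> \<le> h\<^sup>2 / 4"
    proof -
      have e1: "(real CARD('n) + 1) / 2 = b + 1" "real CARD('n) = 2 * b + 1" by (simp_all add: b_def field_simps)
      have "\<delta> * far_size CARD('n) l \<tau> \<le> \<delta> * (l powr (2 * b + 1) * (1 / (l * \<delta>)) powr (b + 1))"
        unfolding far_size_powr[OF \<tau> l0] unfolding e1(1) unfolding e1(2) using l0 \<delta> b
        by (intro mult_left_mono powr_mono2) (auto simp: \<tau>_def intro!: divide_left_mono)
      also have "\<dots> = (l / \<delta>) powr b"
        using l0 \<delta> by (simp add: powr_divide powr_mult powr_add powr_minus field_simps) (simp add: powr_add[symmetric] field_simps)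
      finally have "B * (\<delta> * far_size CARD('n) l \<tau>) \<le> B * (l / \<delta>) powr b" using B by (intro mult_left_mono) auto
      also have "\<dots> \<le> (C / 4) * (l / \<delta>) powr b" using C(2) q0 by (intro mult_right_mono) auto
      also have "\<dots> \<le> h\<^sup>2 / 4" using hC by simp
      finally show ?thesis by (simp add: mult.assoc)
    qed
    have inv_sq: "1 / l\<^sup>2 = l powr (-2)" using l0 by (simp add: powr_minus_divide)
    define u where "u = 4 * B * \<delta> / h\<^sup>2"
    have u: "u > 0" using B \<delta> h by (simp add: u_def)
    have uh: "u * h\<^sup>2 = 4 * B * \<delta>" using h by (simp add: u_def)
    define t where "t = u powr (1 / b)"
    have t: "t > 0" using u by (simp add: t_def)
    have tb: "t powr b = u" using u b by (simp add: t_def powr_powr)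
    have nt: "near_size CARD('n) x = x powr (- b)" if "x > 0" for x
      using near_size_powr[OF that, of "CARD('n)"] by (simp add: b_def)
    \<comment> \<open>The factor \<open>4 powr b\<close> in the constant is there to make the time \<open>t\<close> admissible.\<close>
    have "t \<le> \<tau>"
    proof (rule ccontr)
      assume "\<not> t \<le> \<tau>"
      then have "\<tau> powr b < t powr b" using \<tau> b by (intro powr_less_mono2) auto
      then have "h\<^sup>2 * \<tau> powr b < h\<^sup>2 * u" unfolding tb using h by simp
      then have 1: "h\<^sup>2 * \<tau> powr b < 4 * B * \<delta>" using uh by (simp only: mult.commute)
      have "4 * B * 4 powr b * (l / \<delta>) powr b \<le> h\<^sup>2" using C(3) q0 hC by (meson mult_right_mono less_imp_le order_trans)
      then have "4 * B * 4 powr b * (l / \<delta>) powr b * \<tau> powr b \<le> h\<^sup>2 * \<tau> powr b" by (intro mult_right_mono) auto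
      moreover have "4 powr b * (l / \<delta>) powr b * \<tau> powr b = (1 / \<delta>\<^sup>2) powr b"
      proof -
        have "4 powr b * (l / \<delta>) powr b * \<tau> powr b = (4 * (l / \<delta>) * \<tau>) powr b"
          by (simp only: powr_mult)
        also have "4 * (l / \<delta>) * \<tau> = 1 / \<delta>\<^sup>2" using l0 \<delta> by (simp add: \<tau>_def power2_eq_square)
        finally show ?thesis .
      qed
      moreover have "1 \<le> (1 / \<delta>\<^sup>2) powr b" using \<delta> b by (intro ge_one_powr_ge_zero) (auto simp: power_le_one)
      then have "4 * B * 1 \<le> 4 * B * (1 / \<delta>\<^sup>2) powr b" using B by (intro mult_left_mono) auto
      ultimately have "4 * B \<le> h\<^sup>2 * \<tau> powr b" by (simp add: mult.assoc)
      moreover have "4 * B * \<delta> \<le> 4 * B * 1" using B \<delta> by (intro mult_left_mono) auto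
      ultimately show False using 1 by linarith
    qed
    have split: "(h * X)\<^sup>2 \<le> B * l * \<delta> * a * X + (B * \<delta> * near_size CARD('n) (max a (1 / l\<^sup>2))) * X\<^sup>2 + h\<^sup>2 / 4 * X\<^sup>2" if "0 \<le> a" "a \<le> \<tau>" for a
    proof -
      have "(h * X)\<^sup>2 \<le> B * (l * \<delta> * a * X + \<delta> * (near_size CARD('n) (max a (1 / l\<^sup>2)) + far_size CARD('n) l \<tau>) * X\<^sup>2)"
        unfolding X_def \<tau>_def by (rule ineq[OF l \<delta> S c h]) (use that in \<open>auto simp: \<tau>_def\<close>)
      also have "\<dots> = B * l * \<delta> * a * X + (B * \<delta> * near_size CARD('n) (max a (1 / l\<^sup>2))) * X\<^sup>2 + (B * \<delta> * far_size CARD('n) l \<tau>) * X\<^sup>2"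
        by (simp add: algebra_simps)
      also have "\<dots> \<le> B * l * \<delta> * a * X + (B * \<delta> * near_size CARD('n) (max a (1 / l\<^sup>2))) * X\<^sup>2 + h\<^sup>2 / 4 * X\<^sup>2"
        by (intro add_left_mono mult_right_mono far) auto
      finally show ?thesis .
    qed
    have zero: "X = 0" if small: "4 * B * \<delta> * l powr (2 * b) < h\<^sup>2"
    proof -
      have "max 0 (1 / l\<^sup>2) = 1 / l\<^sup>2" by simp
      moreover have "1 / l\<^sup>2 > 0" using l0 by simp
      moreover have "(1 / l\<^sup>2) powr (- b) = l powr (2 * b)" unfolding inv_sq powr_powr by simp
      ultimately have "near_size CARD('n) (max 0 (1 / l\<^sup>2)) = l powr (2 * b)" using nt[of "1 / l\<^sup>2"] by metis
      moreover have "(h * X)\<^sup>2 \<le> B * l * \<delta> * 0 * X + (B * \<delta> * near_size CARD('n) (max 0 (1 / l\<^sup>2))) * X\<^sup>2 + h\<^sup>2 / 4 * X\<^sup>2"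
        by (rule split) (use \<tau> in auto)
      ultimately have "(h * X)\<^sup>2 \<le> (B * \<delta> * l powr (2 * b)) * X\<^sup>2 + h\<^sup>2 / 4 * X\<^sup>2" by (simp only: mult_zero_right mult_zero_left add_0)
      also have "\<dots> \<le> (h\<^sup>2 / 4) * X\<^sup>2 + h\<^sup>2 / 4 * X\<^sup>2" using small by (intro add_right_mono mult_right_mono) auto
      finally have "h\<^sup>2 * X\<^sup>2 \<le> 0" unfolding power_mult_distrib by linarith
      moreover have "0 < h\<^sup>2" using h by simp
      ultimately have "X\<^sup>2 \<le> 0" by (simp only: mult_le_0_iff) linarith
      then show ?thesis by simp
    qed
    show "measure (torus_measure \<alpha>) (level_set \<alpha> (trig_poly \<alpha> S c) h) = 0" if "C * \<delta> * l powr (2 * b) < h\<^sup>2"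
    proof -
      have "4 * B * (\<delta> * l powr (2 * b)) \<le> C * (\<delta> * l powr (2 * b))" using C(2) \<delta> by (intro mult_right_mono) auto
      then show ?thesis using zero that unfolding X_def[symmetric] by (simp add: mult.assoc)
    qed
    show "measure (torus_measure \<alpha>) (level_set \<alpha> (trig_poly \<alpha> S c) h) \<le> C * (l * \<delta> powr (1 + 1 / b)) * h powr (- (2 + 2 / b))"
      unfolding X_def[symmetric]
    proof (cases "4 * B * \<delta> * l powr (2 * b) < h\<^sup>2")
      case True
      then show "X \<le> C * (l * \<delta> powr (1 + 1 / b)) * h powr (- (2 + 2 / b))" using zero C(1) l0 by simp
    next
      case False
      have "1 / l\<^sup>2 \<le> t"
      proof (rule ccontr)
        assume "\<not> 1 / l\<^sup>2 \<le> t"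
        then have "t powr b < (1 / l\<^sup>2) powr b" using t b by (intro powr_less_mono2) auto
        also have "(1 / l\<^sup>2) powr b = 1 / l powr (2 * b)"
          unfolding inv_sq powr_powr by (simp add: powr_minus_divide)
        finally have "u < 1 / l powr (2 * b)" unfolding tb .
        then have "u * l powr (2 * b) < 1" using l0 by (simp add: field_simps)
        then have "(u * l powr (2 * b)) * h\<^sup>2 < 1 * h\<^sup>2" using h by (intro mult_strict_right_mono) auto
        moreover have "(u * l powr (2 * b)) * h\<^sup>2 = (u * h\<^sup>2) * l powr (2 * b)" by (simp only: mult_ac)
        ultimately show False using False unfolding uh by simp
      qed
      then have m: "max t (1 / l\<^sup>2) = t" by simp
      have "t powr (- b) = h\<^sup>2 / (4 * B * \<delta>)" unfolding powr_minus tb u_def by simp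
      then have n: "B * \<delta> * near_size CARD('n) (max t (1 / l\<^sup>2)) = h\<^sup>2 / 4"
        unfolding m nt[OF t] using B \<delta> by simp
      have "(h * X)\<^sup>2 \<le> B * l * \<delta> * t * X + h\<^sup>2 / 4 * X\<^sup>2 + h\<^sup>2 / 4 * X\<^sup>2"
        using split[of t] t \<open>t \<le> \<tau>\<close> unfolding n by simp
      then have 1: "h\<^sup>2 * X * X \<le> 2 * B * l * \<delta> * t * X" by (simp add: power2_eq_square algebra_simps)
      have "h\<^sup>2 * X \<le> 2 * B * l * \<delta> * t"
      proof (cases "X = 0")
        case True then show ?thesis using B l0 \<delta> t by simp
      next
        case False then show ?thesis using 1 X mult_right_le_imp_le[of "h\<^sup>2 * X" X "2 * B * l * \<delta> * t"] by simp
      qed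
      then have "X \<le> 2 * B * l * \<delta> * t / h\<^sup>2" using h by (simp add: field_simps)
      also have "\<dots> = 2 * B * (4 * B) powr (1 / b) * (l * \<delta> powr (1 + 1 / b)) * h powr (- (2 + 2 / b))"
      proof -
        have "t = (4 * B) powr (1 / b) * \<delta> powr (1 / b) / (h powr (2 / b))"
        proof -
          have "t = (4 * B * \<delta>) powr (1 / b) / (h\<^sup>2) powr (1 / b)" unfolding t_def u_def using B \<delta> h by (subst powr_divide) auto
          also have "(4 * B * \<delta>) powr (1 / b) = (4 * B) powr (1 / b) * \<delta> powr (1 / b)" using B \<delta> by (subst powr_mult) auto
          also have "(h\<^sup>2) powr (1 / b) = h powr (2 / b)"
          proof -
            have "h\<^sup>2 = h powr 2" using h by (simp add: powr_numeral)
            then show ?thesis by (simp only: powr_powr) simp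
          qed
          finally show ?thesis .
        qed
        moreover have "h powr (- (2 + 2 / b)) = 1 / (h\<^sup>2 * h powr (2 / b))"
          unfolding powr_minus_divide powr_add using h by (simp add: powr_numeral)
        moreover have "\<delta> powr (1 + 1 / b) = \<delta> * \<delta> powr (1 / b)" using \<delta> by (simp add: powr_add)
        ultimately show ?thesis by (simp add: mult_ac)
      qed
      also have "\<dots> \<le> C * (l * \<delta> powr (1 + 1 / b)) * h powr (- (2 + 2 / b))"
        using C(4) l0 by (intro mult_right_mono) auto
      finally show "X \<le> C * (l * \<delta> powr (1 + 1 / b)) * h powr (- (2 + 2 / b))" .
    qed
  qed
qed

section \<open>From level sets to Lebesgue norms\<close>

text \<open>
  A geometric sum is at most \<open>1 / (1 - 2 powr (-s))\<close> times its largest term. In the induction this term is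
  \<open>min H (2 ^ J * h / 2)\<close> to the power \<open>s\<close>, an upper bound for the last height used so far.
\<close>

lemma dyadic_geometric_sum:
  fixes s H h :: real
  assumes s: "s > 0" and H: "H > 0" and h: "h > 0"
  shows "(\<Sum>j<J. if 2 ^ j * h \<le> H then (2 ^ j * h) powr s else 0) \<le> (1 / (1 - 2 powr (- s))) * H powr s"
proof -
  define K where "K = 1 / (1 - 2 powr (- s))"
  have "2 powr (- s) < 2 powr (0::real)" using s by (intro powr_less_mono) auto
  then have q: "0 < 1 - 2 powr (- s)" by simp
  have K: "K > 0" "K * 2 powr (- s) + 1 = K"
  proof -
    show "K > 0" using q by (simp add: K_def)
    have "1 / (1 - x) * x + 1 = 1 / (1 - x)" if "0 < 1 - x" for x :: real using that by (simp add: field_simps)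
    from this[OF q] show "K * 2 powr (- s) + 1 = K" unfolding K_def .
  qed
  have "(\<Sum>j<J. if 2 ^ j * h \<le> H then (2 ^ j * h) powr s else 0) \<le> K * (min H (2 ^ J * h / 2)) powr s"
  proof (induction J)
    case 0 then show ?case using K H h by simp
  next
    case (Suc J)
    show ?case
    proof (cases "2 ^ J * h \<le> H")
      case True
      have "(\<Sum>j<Suc J. if 2 ^ j * h \<le> H then (2 ^ j * h) powr s else 0) \<le> K * (min H (2 ^ J * h / 2)) powr s + (2 ^ J * h) powr s"
        using Suc.IH True by simp
      also have "\<dots> \<le> K * (2 ^ J * h / 2) powr s + (2 ^ J * h) powr s"
        using K H h s by (intro add_right_mono mult_left_mono powr_mono2) auto
      also have "(2 ^ J * h / 2) powr s = (2 ^ J * h) powr s * 2 powr (- s)"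
        using h by (subst powr_divide) (simp_all add: powr_minus_divide)
      also have "K * ((2 ^ J * h) powr s * 2 powr (- s)) + (2 ^ J * h) powr s = (K * 2 powr (- s) + 1) * (2 ^ J * h) powr s"
        by (simp add: algebra_simps)
      also have "\<dots> = K * (min H (2 ^ Suc J * h / 2)) powr s" unfolding K(2) using True by (simp add: min_def)
      finally show ?thesis .
    next
      case False
      have "(\<Sum>j<Suc J. if 2 ^ j * h \<le> H then (2 ^ j * h) powr s else 0) \<le> K * (min H (2 ^ J * h / 2)) powr s"
        using Suc.IH False by simp
      also have "\<dots> \<le> K * (min H (2 ^ Suc J * h / 2)) powr s"
        using K H h s by (intro mult_left_mono powr_mono2) (auto intro: min.coboundedI2)
      finally show ?thesis .
    qed
  qed
  also have "\<dots> \<le> K * H powr s" using K H h s by (intro mult_left_mono powr_mono2) auto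
  finally show ?thesis unfolding K_def .
qed

lemma trig_poly_L2:
  fixes \<alpha> :: "real ^ 'n"
  assumes \<alpha>: "\<And>j. \<alpha> $ j > 0" and S: "finite S"
  shows "(LINT x|torus_measure \<alpha>. (norm (trig_poly \<alpha> S c x))\<^sup>2) = measure lebesgue (torus_cell \<alpha>) * (\<Sum>n\<in>S. (norm (c n))\<^sup>2)"
proof -
  let ?F = "trig_poly \<alpha> S c" and ?V = "measure lebesgue (torus_cell \<alpha>)"
  have "of_real (LINT x|torus_measure \<alpha>. (norm (?F x))\<^sup>2) = torus_inner \<alpha> ?F ?F"
    by (simp only: torus_inner_def complex_norm_square[symmetric] integral_complex_of_real)
  also have "\<dots> = (\<Sum>n\<in>S. cnj (c n) * (c n * of_real ?V))"
    by (subst torus_inner_trig_poly_right) (auto intro!: integrable_torus_continuous continuous_intros simp: torus_inner_trig_poly_char[OF \<alpha> S])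
  also have "\<dots> = of_real (?V * (\<Sum>n\<in>S. (norm (c n))\<^sup>2))"
    unfolding of_real_mult of_real_sum sum_distrib_left complex_norm_square by (intro sum.cong refl) (simp only: mult_ac)
  finally show ?thesis by (simp only: of_real_eq_iff)
qed

text \<open>
  Pointwise, either \<open>|F| < H\<close>, and \<open>|F| powr q \<le> H powr (q-2) * |F|\<^sup>2\<close>, or \<open>|F|\<close> lies between two consecutive dyadic heights.
\<close>

lemma dyadic_layer_cake:
  fixes \<alpha> :: "real ^ 'n" and q H :: real
  assumes F: "continuous_on UNIV F" and q: "q \<ge> 2" and H: "H > 0"
    and bd: "\<And>x. norm (F x) < 2 ^ J * H"
  shows "(LINT x|torus_measure \<alpha>. norm (F x) powr q) \<le> H powr (q - 2) * (LINT x|torus_measure \<alpha>. (norm (F x))\<^sup>2)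
    + (\<Sum>j<J. (2 * (2 ^ j * H)) powr q * measure (torus_measure \<alpha>) (level_set \<alpha> F (2 ^ j * H)))"
proof -
  let ?M = "torus_measure \<alpha>"
  interpret finite_measure ?M by (rule finite_measure_torus)
  let ?E = "\<lambda>j. level_set \<alpha> F (2 ^ j * H)"
  have E: "?E j \<in> sets ?M" for j by (rule level_set_sets[OF F])
  have iE: "integrable ?M (indicator (?E j) :: _ \<Rightarrow> real)" for j
    using E by (intro integrable_real_indicator) (auto simp: less_top[symmetric])
  have IE: "(LINT x|?M. indicator (?E j) x) = measure ?M (?E j)" for j using E[of j] by simp
  have i2: "integrable ?M (\<lambda>x. (norm (F x))\<^sup>2)" by (intro integrable_torus_continuous continuous_intros F)
  have "(LINT x|?M. norm (F x) powr q) \<le> (LINT x|?M. H powr (q - 2) * (norm (F x))\<^sup>2 + (\<Sum>j<J. (2 * (2 ^ j * H)) powr q * indicator (?E j) x))"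
  proof (rule integral_mono)
    show "integrable ?M (\<lambda>x. norm (F x) powr q)"
      using q by (intro integrable_torus_continuous continuous_on_powr' continuous_intros F) auto
    show "integrable ?M (\<lambda>x. H powr (q - 2) * (norm (F x))\<^sup>2 + (\<Sum>j<J. (2 * (2 ^ j * H)) powr q * indicator (?E j) x))"
      by (intro Bochner_Integration.integrable_add Bochner_Integration.integrable_sum integrable_mult_right i2 iE)
    fix x assume "x \<in> space ?M"
    then have x: "x \<in> torus_cell \<alpha>" by (simp add: space_torus_measure)
    let ?y = "norm (F x)"
    have S0: "(\<Sum>j<J. (2 * (2 ^ j * H)) powr q * indicator (?E j) x) \<ge> (0::real)" by (intro sum_nonneg) auto
    show "?y powr q \<le> H powr (q - 2) * ?y\<^sup>2 + (\<Sum>j<J. (2 * (2 ^ j * H)) powr q * indicator (?E j) x)"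
    proof (cases "?y < H")
      case True
      have "?y powr q = ?y powr (q - 2) * ?y\<^sup>2"
        by (cases "F x = 0") (use q in \<open>simp_all add: powr_diff powr_numeral\<close>)
      also have "\<dots> \<le> H powr (q - 2) * ?y\<^sup>2" using True q by (intro mult_right_mono powr_mono2) auto
      finally show ?thesis using S0 by linarith
    next
      case False
      have "\<exists>j<J. 2 ^ j * H \<le> ?y \<and> ?y < 2 ^ Suc j * H"
        using bd[of x]
      proof (induction J)
        case 0 then show ?case using False by simp
      next
        case (Suc J) then show ?case by (cases "?y < 2 ^ J * H") (auto intro: less_SucI)
      qed
      then obtain j where j: "j < J" "2 ^ j * H \<le> ?y" "?y < 2 ^ Suc j * H" by blast
      have "?y powr q \<le> (2 * (2 ^ j * H)) powr q" using j q by (intro powr_mono2) auto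
      also have "\<dots> = (2 * (2 ^ j * H)) powr q * indicator (?E j) x" using j x by (simp add: level_set_def)
      also have "\<dots> \<le> (\<Sum>j<J. (2 * (2 ^ j * H)) powr q * indicator (?E j) x)"
        using j(1) by (intro member_le_sum) auto
      finally show ?thesis by (simp add: add_increasing)
    qed
  qed
  also have "\<dots> = H powr (q - 2) * (LINT x|?M. (norm (F x))\<^sup>2) + (\<Sum>j<J. (2 * (2 ^ j * H)) powr q * measure ?M (?E j))"
  proof -
    have "(LINT x|?M. H powr (q - 2) * (norm (F x))\<^sup>2 + (\<Sum>j<J. (2 * (2 ^ j * H)) powr q * indicator (?E j) x))
      = (LINT x|?M. H powr (q - 2) * (norm (F x))\<^sup>2) + (LINT x|?M. (\<Sum>j<J. (2 * (2 ^ j * H)) powr q * indicator (?E j) x))"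
      by (intro Bochner_Integration.integral_add Bochner_Integration.integrable_sum integrable_mult_right i2 iE)
    also have "(LINT x|?M. (\<Sum>j<J. (2 * (2 ^ j * H)) powr q * indicator (?E j) x)) = (\<Sum>j<J. (LINT x|?M. (2 * (2 ^ j * H)) powr q * indicator (?E j) x))"
      by (intro Bochner_Integration.integral_sum integrable_mult_right iE)
    finally show ?thesis by (simp only: integral_mult_right_zero IE)
  qed
  finally show ?thesis .
qed

text \<open>
  The three ranges of heights are separated by \<open>H1\<close>, \<open>H2\<close> and \<open>H3\<close>: below \<open>H1\<close> the \<open>L\<^sup>2\<close> norm is used, between
  \<open>H1\<close> and \<open>H2\<close> the level set bound for the shell of width 1, between \<open>H2\<close> and \<open>H3\<close> the bound for the actual
  shell, and above \<open>H3\<close> the level sets are null. The exponents satisfy \<open>q - p = 2 \<gamma>\<close> and \<open>b \<gamma> = e\<close> with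
  \<open>e = 1 / (d - 2)\<close>. With them the third range gives \<open>(l \<delta>) powr (q/2)\<close> exactly, the second gives it up to the factor
  \<open>(l \<delta> powr (d+1)) powr (-e)\<close>, and the first up to \<open>(l \<delta> powr d) powr (-e)\<close>.
\<close>

lemma trig_poly_window_Lq:
  fixes \<alpha> :: "real ^ 'n"
  assumes \<alpha>: "\<And>j. \<alpha> $ j > 0" and d: "CARD('n) \<ge> 3"
  defines "q \<equiv> 2 * real CARD('n) / (real CARD('n) - 2)"
  shows "\<exists>C>0. \<forall>l \<delta> c. 4 \<le> l \<longrightarrow> 0 < \<delta> \<longrightarrow> \<delta> \<le> 1 \<longrightarrow> 1 \<le> l * \<delta> powr (real CARD('n) + 1) \<longrightarrow>
    (\<Sum>n\<in>torus_window \<alpha> l \<delta>. (norm (c n))\<^sup>2) \<le> 1 \<longrightarrow>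
    (LINT x|torus_measure \<alpha>. norm (trig_poly \<alpha> (torus_window \<alpha> l \<delta>) c x) powr q) \<le> C * (l * \<delta>) powr (q / 2)"
proof -
  define D where "D = real CARD('n)"
  have D: "D \<ge> 3" using d by (simp add: D_def)
  define b where "b = (D - 1) / 2"
  define e where "e = 1 / (D - 2)"
  define p where "p = 2 + 2 / b"
  define s where "s = q - p"
  define \<gamma> where "\<gamma> = e / b"
  have b: "b \<ge> 1" using D by (simp add: b_def)
  have e: "e > 0" using D by (simp add: e_def)
  have q_eq: "q = 2 * D * e" by (simp add: q_def D_def e_def)
  have q2: "q - 2 = 4 * e"
  proof -
    have "2 * D * e - 2 = (2 * D - 2 * (D - 2)) * e" using D by (simp add: e_def field_simps)
    then show ?thesis unfolding q_eq by (simp add: algebra_simps)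
  qed
  have s_eq: "s = 2 * \<gamma>"
  proof -
    have "2 * D / (D - 2) - (2 + 2 / ((D - 1) / 2)) = 2 * ((1 / (D - 2)) / ((D - 1) / 2))"
      using D by (simp add: divide_simps) (simp add: algebra_simps)
    then show ?thesis by (simp add: s_def p_def \<gamma>_def q_def D_def[symmetric] b_def e_def)
  qed
  have \<gamma>: "\<gamma> > 0" using b e by (simp add: \<gamma>_def)
  have s: "s > 0" using \<gamma> s_eq by simp
  have q: "q \<ge> 2" using q2 e by simp
  obtain C where C: "C \<ge> 1" and level: "\<And>l \<delta> S c h. 4 \<le> l \<Longrightarrow> 0 < \<delta> \<Longrightarrow> \<delta> \<le> 1 \<Longrightarrow> S \<subseteq> torus_window \<alpha> l \<delta> \<Longrightarrow> (\<Sum>n\<in>S. (norm (c n))\<^sup>2) \<le> 1 \<Longrightarrow> 0 < h \<Longrightarrow>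
    C * (l / \<delta>) powr b \<le> h\<^sup>2 \<Longrightarrow>
    (C * \<delta> * l powr (2 * b) < h\<^sup>2 \<longrightarrow> measure (torus_measure \<alpha>) (level_set \<alpha> (trig_poly \<alpha> S c) h) = 0) \<and>
    measure (torus_measure \<alpha>) (level_set \<alpha> (trig_poly \<alpha> S c) h) \<le> C * (l * \<delta> powr (1 + 1 / b)) * h powr (- p)"
    using level_set_bound[OF \<alpha> d] unfolding b_def D_def p_def by blast
  define V where "V = measure lebesgue (torus_cell \<alpha>)"
  have V: "V > 0" unfolding V_def by (rule measure_torus_cell_pos[OF \<alpha>])
  define K where "K = 1 / (1 - 2 powr (- s))"
  have "2 powr (- s) < 2 powr (0::real)" using s by (intro powr_less_mono) auto
  then have K: "K > 0" by (simp add: K_def)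
  define R where "R = V * C powr (2 * e) + 2 powr q * (C * (K * C powr \<gamma>)) + 2 powr q * (C * (K * C powr \<gamma>))"
  show ?thesis
  proof (intro exI[of _ R] conjI allI impI)
    show "R > 0" using V C K unfolding R_def by (intro add_pos_pos mult_pos_pos) auto
    fix l \<delta> :: real and c :: "('n \<Rightarrow> int) \<Rightarrow> complex"
    assume l: "4 \<le> l" and \<delta>: "0 < \<delta>" "\<delta> \<le> 1" and l\<delta>: "1 \<le> l * \<delta> powr (real CARD('n) + 1)"
      and c: "(\<Sum>n\<in>torus_window \<alpha> l \<delta>. (norm (c n))\<^sup>2) \<le> 1"
    let ?S = "torus_window \<alpha> l \<delta>"
    let ?F = "trig_poly \<alpha> ?S c"
    have l0: "l > 0" using l by simp
    have fin: "finite ?S" by (rule finite_torus_window[OF \<alpha>])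
    have F: "continuous_on UNIV ?F" by (rule continuous_trig_poly)
    define H1 where "H1 = sqrt (C * l powr b)"
    define H2 where "H2 = sqrt (C * (l / \<delta>) powr b)"
    define H3 where "H3 = sqrt (C * \<delta> * l powr (2 * b))"
    have H: "H1 > 0" "H2 > 0" "H3 > 0" using C l0 \<delta> by (simp_all add: H1_def H2_def H3_def)
    have Hsq: "H1\<^sup>2 = C * l powr b" "H2\<^sup>2 = C * (l / \<delta>) powr b" "H3\<^sup>2 = C * \<delta> * l powr (2 * b)"
      using C l0 \<delta> by (simp_all add: H1_def H2_def H3_def)
    have sqrt_powr: "sqrt x powr y = x powr (y / 2)" if "x \<ge> 0" for x y :: real
      using that by (simp add: powr_half_sqrt[symmetric] powr_powr)
    obtain J where J: "norm (?F x) < 2 ^ J * H1" for x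
    proof -
      have "norm (?F x) \<le> (\<Sum>n\<in>?S. norm (c n))" for x
        unfolding trig_poly_def by (rule sum_norm_le) (simp add: norm_mult)
      moreover obtain J where "(\<Sum>n\<in>?S. norm (c n)) / H1 < 2 ^ J" using real_arch_pow[of 2 "(\<Sum>n\<in>?S. norm (c n)) / H1"] by auto
      then have "(\<Sum>n\<in>?S. norm (c n)) < 2 ^ J * H1" using H by (simp add: field_simps)
      ultimately show ?thesis using that order_le_less_trans by blast
    qed
    let ?X = "\<lambda>j. measure (torus_measure \<alpha>) (level_set \<alpha> ?F (2 ^ j * H1))"
    define T where "T = C * (l * \<delta> powr (1 + 1 / b))"
    have T: "T \<ge> 0" using C l0 by (simp add: T_def)
    have level_term: "(2 * (2 ^ j * H1)) powr q * ?X j \<le>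
       2 powr q * (C * l) * (if 2 ^ j * H1 \<le> H2 then (2 ^ j * H1) powr s else 0) + 2 powr q * T * (if 2 ^ j * H1 \<le> H3 then (2 ^ j * H1) powr s else 0)" for j
    proof -
      define h where "h = 2 ^ j * H1"
      have h: "h > 0" using H by (simp add: h_def)
      have hH1: "H1\<^sup>2 \<le> h\<^sup>2"
      proof (intro power_mono)
        have "1 * H1 \<le> 2 ^ j * H1" using H by (intro mult_right_mono) auto
        then show "H1 \<le> h" by (simp add: h_def)
      qed (use H in simp)
      have hs: "h powr q * h powr (- p) = h powr s" by (simp add: powr_add[symmetric] s_def)
      have g1: "h powr q * ?X j \<le> C * l * (if h \<le> H2 then h powr s else 0) + T * (if h \<le> H3 then h powr s else 0)"
      proof (cases "h \<le> H2")
        case True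
        have "?S \<subseteq> torus_window \<alpha> l 1" using \<delta> by (auto simp: torus_window_def)
        from level[OF l _ _ this c h] have "?X j \<le> C * l * h powr (- p)"
          using hH1 unfolding Hsq by (simp add: h_def)
        then have "h powr q * ?X j \<le> h powr q * (C * l * h powr (- p))" by (intro mult_left_mono) auto
        also have "\<dots> = C * l * (h powr q * h powr (- p))" by simp
        also have "\<dots> = C * l * h powr s" unfolding hs ..
        also have "\<dots> \<le> C * l * h powr s + T * (if h \<le> H3 then h powr s else 0)" using T by simp
        finally show ?thesis using True by simp
      next
        case False
        then have "H2\<^sup>2 \<le> h\<^sup>2" using H by (intro power_mono) auto
        then have lv: "(C * \<delta> * l powr (2 * b) < h\<^sup>2 \<longrightarrow> ?X j = 0) \<and> ?X j \<le> T * h powr (- p)"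
          using level[OF l \<delta> order_refl c h] unfolding Hsq T_def by (simp add: h_def)
        show ?thesis
        proof (cases "h \<le> H3")
          case True
          have "h powr q * ?X j \<le> h powr q * (T * h powr (- p))" using lv by (intro mult_left_mono) auto
          also have "\<dots> = T * (h powr q * h powr (- p))" by simp
          also have "\<dots> = T * h powr s" unfolding hs ..
          finally show ?thesis using True False by simp
        next
          case h3: False
          then have "H3\<^sup>2 < h\<^sup>2" using H by (intro power_strict_mono) auto
          then have "?X j = 0" using lv unfolding Hsq by simp
          then show ?thesis using h3 False by simp
        qed
      qed
      have "(2 * h) powr q * ?X j = 2 powr q * (h powr q * ?X j)" by (simp add: powr_mult)
      also have "\<dots> \<le> 2 powr q * (C * l * (if h \<le> H2 then h powr s else 0) + T * (if h \<le> H3 then h powr s else 0))"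
        by (intro mult_left_mono g1) simp
      finally show ?thesis unfolding h_def[symmetric] by (simp only: distrib_left mult.assoc)
    qed
    define E where "E = (l * \<delta>) powr (D * e)"
    have E_split: "E = l powr (D * e) * \<delta> powr (D * e)" by (simp add: E_def powr_mult)
    have ld: "1 \<le> l * \<delta> powr (D + 1)" using l\<delta> by (simp add: D_def)
    have De: "D * e = 1 + 2 * e" using q2 q_eq by simp
    have b_eq: "2 * b * e = 1 + e"
      using D by (simp add: b_def e_def field_simps)
    have b\<gamma>: "b * \<gamma> = e" using b by (simp add: \<gamma>_def)
    have P1: "H1 powr (q - 2) \<le> C powr (2 * e) * E"
    proof -
      have "H1 powr (q - 2) = (C * l powr b) powr (2 * e)"
        unfolding H1_def q2 by (subst sqrt_powr) (use C in auto)
      also have "\<dots> = C powr (2 * e) * l powr (1 + e)"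
        unfolding powr_mult powr_powr using b_eq by (simp add: mult_ac)
      also have "l powr (1 + e) \<le> E"
      proof -
        have "1 \<le> (l * \<delta> powr D)"
        proof -
          have "\<delta> powr (D + 1) \<le> \<delta> powr D" using \<delta> by (intro powr_mono') auto
          then have "l * \<delta> powr (D + 1) \<le> l * \<delta> powr D" using l0 by (intro mult_left_mono) auto
          then show ?thesis using ld by simp
        qed
        then have "1 \<le> (l * \<delta> powr D) powr e" using e by (intro ge_one_powr_ge_zero) auto
        then have "l powr (1 + e) * 1 \<le> l powr (1 + e) * (l * \<delta> powr D) powr e" by (intro mult_left_mono) auto
        also have "\<dots> = (l powr (1 + e) * l powr e) * \<delta> powr (D * e)" by (simp add: powr_mult powr_powr)
        also have "l powr (1 + e) * l powr e = l powr (D * e)" unfolding De powr_add[symmetric] by (simp add: algebra_simps)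
        finally show ?thesis unfolding E_split by simp
      qed
      finally show ?thesis using C by (simp add: mult_left_mono)
    qed
    have P2: "l * H2 powr s \<le> C powr \<gamma> * E"
    proof -
      have "H2 powr s = (C * (l / \<delta>) powr b) powr \<gamma>"
        unfolding H2_def s_eq by (subst sqrt_powr) (use C in auto)
      also have "\<dots> = C powr \<gamma> * (l / \<delta>) powr e"
        unfolding powr_mult powr_powr b\<gamma> ..
      finally have h2: "l * H2 powr s = C powr \<gamma> * (l * (l / \<delta>) powr e)" by simp
      have "1 \<le> (l * \<delta> powr (D + 1)) powr e" using ld e by (intro ge_one_powr_ge_zero) auto
      then have "(l * (l / \<delta>) powr e) * 1 \<le> (l * (l / \<delta>) powr e) * (l * \<delta> powr (D + 1)) powr e" using l0 by (intro mult_left_mono) auto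
      also have "\<dots> = (l powr 1 * l powr e * l powr e) * (\<delta> powr (- e) * \<delta> powr ((D + 1) * e))"
        using l0 by (simp add: powr_mult powr_powr powr_divide powr_minus_divide)
      also have "l powr 1 * l powr e * l powr e = l powr (D * e)" unfolding De powr_add[symmetric] by (simp add: algebra_simps)
      also have "\<delta> powr (- e) * \<delta> powr ((D + 1) * e) = \<delta> powr (D * e)" unfolding powr_add[symmetric] by (simp add: algebra_simps)
      finally have "l * (l / \<delta>) powr e \<le> E" unfolding E_split by simp
      then show ?thesis unfolding h2 by (intro mult_left_mono) auto
    qed
    have P3: "T * H3 powr s = C * (C powr \<gamma> * E)"
    proof -
      have "H3 powr s = (C * \<delta> * l powr (2 * b)) powr \<gamma>"
        unfolding H3_def s_eq by (subst sqrt_powr) (use C \<delta> in auto)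
      also have "\<dots> = C powr \<gamma> * \<delta> powr \<gamma> * l powr (2 * e)"
        unfolding powr_mult powr_powr mult.assoc b\<gamma> ..
      finally have "T * H3 powr s = C * (C powr \<gamma> * ((l powr 1 * l powr (2 * e)) * (\<delta> powr (1 + 1 / b) * \<delta> powr \<gamma>)))"
        using l0 by (simp add: T_def)
      also have "l powr 1 * l powr (2 * e) = l powr (D * e)" unfolding De powr_add[symmetric] ..
      also have "\<delta> powr (1 + 1 / b) * \<delta> powr \<gamma> = \<delta> powr (D * e)"
      proof -
        have "(1 + e) / b = 2 * e" using b b_eq by (simp add: divide_eq_eq mult_ac)
        then have "1 + 1 / b + \<gamma> = D * e" unfolding De \<gamma>_def by (simp add: add_divide_distrib)
        then show ?thesis unfolding powr_add[symmetric] by simp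
      qed
      finally show ?thesis unfolding E_split .
    qed
    have "(LINT x|torus_measure \<alpha>. norm (?F x) powr q) \<le> H1 powr (q - 2) * (LINT x|torus_measure \<alpha>. (norm (?F x))\<^sup>2)
      + (\<Sum>j<J. (2 * (2 ^ j * H1)) powr q * ?X j)"
      by (rule dyadic_layer_cake[OF F q H(1) J])
    also have "\<dots> \<le> H1 powr (q - 2) * V + (\<Sum>j<J. 2 powr q * (C * l) * (if 2 ^ j * H1 \<le> H2 then (2 ^ j * H1) powr s else 0) + 2 powr q * T * (if 2 ^ j * H1 \<le> H3 then (2 ^ j * H1) powr s else 0))"
    proof (intro add_mono sum_mono level_term mult_left_mono)
      show "(LINT x|torus_measure \<alpha>. (norm (?F x))\<^sup>2) \<le> V"
        unfolding trig_poly_L2[OF \<alpha> fin] V_def[symmetric] using mult_left_mono[OF c, of V] V by simp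
    qed simp
    also have "\<dots> \<le> H1 powr (q - 2) * V + (2 powr q * (C * l) * (K * H2 powr s) + 2 powr q * T * (K * H3 powr s))"
      unfolding sum.distrib sum_distrib_left[symmetric] K_def
      using C l0 T by (intro add_left_mono add_mono mult_left_mono dyadic_geometric_sum s H) auto
    also have "\<dots> = V * H1 powr (q - 2) + 2 powr q * (C * K) * (l * H2 powr s) + 2 powr q * K * (T * H3 powr s)"
      by (simp add: mult_ac)
    also have "\<dots> \<le> V * (C powr (2 * e) * E) + 2 powr q * (C * K) * (C powr \<gamma> * E) + 2 powr q * K * (C * (C powr \<gamma> * E))"
      unfolding P3 using V C K by (intro add_mono mult_left_mono P1 P2) auto
    also have "\<dots> = R * E" unfolding R_def by (simp add: algebra_simps)
    also have "E = (l * \<delta>) powr (q / 2)" unfolding E_def q_eq by simp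
    finally show "(LINT x|torus_measure \<alpha>. norm (?F x) powr q) \<le> R * (l * \<delta>) powr (q / 2)" .
  qed
qed

text \<open>
  The exponent in the hypothesis is at least \<open>- 1 / (d+1)\<close>, because \<open>(d-2) (d+1) \<le> d (d+4)\<close>.
\<close>

lemma window_scale_condition:
  fixes d l \<delta> \<epsilon> :: real
  assumes d: "d \<ge> 3" and l: "l \<ge> 1" and \<epsilon>: "\<epsilon> > 0" and \<delta>: "\<delta> \<ge> l powr (- ((d - 2) / (d * (d + 4))) + \<epsilon>)"
  shows "1 \<le> l * \<delta> powr (d + 1)"
proof -
  have "(d - 2) * (d + 1) \<le> d * (d + 4)" using d by (simp add: algebra_simps)
  then have "(d - 2) / (d * (d + 4)) \<le> 1 / (d + 1)" using d by (simp add: divide_simps)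
  then have "l powr (- (1 / (d + 1))) \<le> l powr (- ((d - 2) / (d * (d + 4))) + \<epsilon>)"
    using l \<epsilon> by (intro powr_mono) auto
  then have "l powr (- (1 / (d + 1))) \<le> \<delta>" using \<delta> by linarith
  then have "(l powr (- (1 / (d + 1)))) powr (d + 1) \<le> \<delta> powr (d + 1)" using d by (intro powr_mono2) auto
  moreover have "(l powr (- (1 / (d + 1)))) powr (d + 1) = l powr (-1)" unfolding powr_powr using d by simp
  ultimately have "l * l powr (-1) \<le> l * \<delta> powr (d + 1)" using l by (intro mult_left_mono) auto
  then show ?thesis using l by (simp add: powr_minus)
qed

theorem corollary1p2p1:
  fixes \<alpha> :: "real ^ 'n" and d q\<^sub>e \<epsilon> :: real
  assumes "CARD('n) \<ge> 3"
    and "\<And>i. \<alpha> $ i > 0"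
    and "d = real CARD('n)"
    and "q\<^sub>e = 2 * d / (d - 2)"
    and "\<epsilon> > 0"
  shows "\<exists>C l\<^sub>0::real. l\<^sub>0 \<ge> 1 \<and>
    (\<forall>l \<delta>. l \<ge> l\<^sub>0 \<longrightarrow> \<delta> \<le> 1 \<longrightarrow> \<delta> \<ge> l powr (- ((d - 2) / (d * (d + 4))) + \<epsilon>) \<longrightarrow>
      (\<forall>f \<in> torus_Lp \<alpha> 2.
         spectral_projection \<alpha> l \<delta> f \<in> torus_Lp \<alpha> q\<^sub>e \<and>
         torus_Lp_norm \<alpha> q\<^sub>e (spectral_projection \<alpha> l \<delta> f)
           \<le> C * (l * \<delta>) powr (1 / 2) * torus_Lp_norm \<alpha> 2 f))"
proof -
  note \<alpha> = assms(2)
  have d: "d \<ge> 3" using assms by simp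
  have q: "q\<^sub>e > 0" using d by (simp add: assms(4))
  obtain C where C: "C > 0" and bound: "\<And>l \<delta> c. 4 \<le> l \<Longrightarrow> 0 < \<delta> \<Longrightarrow> \<delta> \<le> 1 \<Longrightarrow> 1 \<le> l * \<delta> powr (d + 1) \<Longrightarrow>
    (\<Sum>n\<in>torus_window \<alpha> l \<delta>. (norm (c n))\<^sup>2) \<le> 1 \<Longrightarrow>
    (LINT x|torus_measure \<alpha>. norm (trig_poly \<alpha> (torus_window \<alpha> l \<delta>) c x) powr q\<^sub>e) \<le> C * (l * \<delta>) powr (q\<^sub>e / 2)"
    using trig_poly_window_Lq[OF \<alpha> assms(1)] unfolding assms(3,4) by blast
  define V where "V = measure lebesgue (torus_cell \<alpha>)"
  have V: "V > 0" unfolding V_def by (rule measure_torus_cell_pos[OF \<alpha>])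
  define C' where "C' = C powr (1 / q\<^sub>e) / sqrt V"
  show ?thesis
  proof (rule exI[of _ C'], rule exI[of _ 4], intro conjI allI impI ballI)
    fix l \<delta> :: real and f
    assume l: "l \<ge> 4" and \<delta>1: "\<delta> \<le> 1" and \<delta>l: "\<delta> \<ge> l powr (- ((d - 2) / (d * (d + 4))) + \<epsilon>)" and f: "f \<in> torus_Lp \<alpha> 2"
    have "l powr (- ((d - 2) / (d * (d + 4))) + \<epsilon>) > 0" using l by simp
    then have \<delta>: "\<delta> > 0" using \<delta>l by linarith
    have ld: "1 \<le> l * \<delta> powr (d + 1)" using window_scale_condition[OF d _ assms(5) \<delta>l] l by simp
    let ?S = "torus_window \<alpha> l \<delta>"
    define c where "c n = torus_inner \<alpha> f (torus_char \<alpha> n) / of_real V" for n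
    have P: "spectral_projection \<alpha> l \<delta> f = trig_poly \<alpha> ?S c"
      unfolding c_def V_def using l \<delta>1 by (intro spectral_projection_eq[OF \<alpha> _ f]) simp
    have contF: "continuous_on UNIV (trig_poly \<alpha> ?S b)" for b by (rule continuous_trig_poly)
    have fin: "finite ?S" by (rule finite_torus_window[OF \<alpha>])
    show "spectral_projection \<alpha> l \<delta> f \<in> torus_Lp \<alpha> q\<^sub>e"
    proof -
      have "continuous_on UNIV (\<lambda>x. norm (trig_poly \<alpha> ?S c x) powr q\<^sub>e)"
        using q by (intro continuous_on_powr' continuous_on_norm contF continuous_on_const) auto
      then show ?thesis
        unfolding P torus_Lp_def using torus_periodic_trig_poly[OF \<alpha>] borel_measurable_torus_continuous[OF contF]
        by (simp add: integrable_torus_continuous)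
    qed
    define \<sigma> where "\<sigma> = sqrt (\<Sum>n\<in>?S. (norm (c n))\<^sup>2)"
    have \<sigma>2: "\<sigma>\<^sup>2 = (\<Sum>n\<in>?S. (norm (c n))\<^sup>2)" by (simp add: \<sigma>_def sum_nonneg)
    have \<sigma>0: "\<sigma> \<ge> 0" by (simp add: \<sigma>_def sum_nonneg)
    define N where "N = torus_Lp_norm \<alpha> 2 f"
    have N: "N = sqrt (LINT x|torus_measure \<alpha>. (norm (f x))\<^sup>2)"
      by (simp add: N_def torus_Lp_norm_def powr_half_sqrt)
    have \<sigma>N: "\<sigma> \<le> N / sqrt V"
    proof -
      have "V * (V * \<sigma>\<^sup>2) = (\<Sum>n\<in>?S. (norm (torus_inner \<alpha> f (torus_char \<alpha> n)))\<^sup>2)"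
        unfolding \<sigma>2 sum_distrib_left c_def using V by (intro sum.cong refl) (simp add: norm_divide power_divide power2_eq_square)
      also have "\<dots> \<le> V * (LINT x|torus_measure \<alpha>. (norm (f x))\<^sup>2)"
        unfolding V_def by (rule torus_bessel[OF \<alpha> fin torus_L2_integrable(3,2)[OF f]])
      finally have "V * \<sigma>\<^sup>2 \<le> (LINT x|torus_measure \<alpha>. (norm (f x))\<^sup>2)" using V by simp
      then have "sqrt (V * \<sigma>\<^sup>2) \<le> N" unfolding N by simp
      then have "sqrt V * \<sigma> \<le> N" using \<sigma>0 by (simp add: real_sqrt_mult)
      then show ?thesis using V by (simp add: field_simps)
    qed
    have "torus_Lp_norm \<alpha> q\<^sub>e (trig_poly \<alpha> ?S c) \<le> C powr (1 / q\<^sub>e) * (l * \<delta>) powr (1 / 2) * \<sigma>"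
    proof (cases "\<sigma> = 0")
      case True
      then have "(\<Sum>n\<in>?S. (norm (c n))\<^sup>2) = 0" using \<sigma>2 by simp
      then have "\<And>n. n \<in> ?S \<Longrightarrow> c n = 0" using fin by (subst (asm) sum_nonneg_eq_0_iff) auto
      then have "trig_poly \<alpha> ?S c x = 0" for x by (simp add: trig_poly_def)
      then show ?thesis using True q by (simp add: torus_Lp_norm_def)
    next
      case False
      then have \<sigma>: "\<sigma> > 0" using \<sigma>0 by simp
      define b where "b n = c n / of_real \<sigma>" for n
      have "(\<Sum>n\<in>?S. (norm (b n))\<^sup>2) = \<sigma>\<^sup>2 / \<sigma>\<^sup>2"
        unfolding \<sigma>2 sum_divide_distrib b_def by (simp add: norm_divide power_divide \<sigma>2)
      then have b1: "(\<Sum>n\<in>?S. (norm (b n))\<^sup>2) \<le> 1" using \<sigma> by simp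
      have scale: "norm (trig_poly \<alpha> ?S c x) = \<sigma> * norm (trig_poly \<alpha> ?S b x)" for x
      proof -
        have "trig_poly \<alpha> ?S c x = of_real \<sigma> * trig_poly \<alpha> ?S b x"
          unfolding trig_poly_def sum_distrib_left b_def using \<sigma> by (intro sum.cong) auto
        then show ?thesis using \<sigma> by (simp add: norm_mult)
      qed
      have "(LINT x|torus_measure \<alpha>. norm (trig_poly \<alpha> ?S c x) powr q\<^sub>e) = \<sigma> powr q\<^sub>e * (LINT x|torus_measure \<alpha>. norm (trig_poly \<alpha> ?S b x) powr q\<^sub>e)"
        unfolding scale powr_mult by simp
      also have "\<dots> \<le> \<sigma> powr q\<^sub>e * (C * (l * \<delta>) powr (q\<^sub>e / 2))"
        by (intro mult_left_mono bound l \<delta> \<delta>1 ld b1) simp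
      finally have "torus_Lp_norm \<alpha> q\<^sub>e (trig_poly \<alpha> ?S c) \<le> (\<sigma> powr q\<^sub>e * (C * (l * \<delta>) powr (q\<^sub>e / 2))) powr (1 / q\<^sub>e)"
        unfolding torus_Lp_norm_def using q by (intro powr_mono2) auto
      also have "\<dots> = C powr (1 / q\<^sub>e) * (l * \<delta>) powr (1 / 2) * \<sigma>"
        unfolding powr_mult powr_powr using q \<sigma> by simp
      finally show ?thesis .
    qed
    also have "\<dots> \<le> C powr (1 / q\<^sub>e) * (l * \<delta>) powr (1 / 2) * (N / sqrt V)"
      using \<sigma>N by (intro mult_left_mono) auto
    also have "\<dots> = C' * (l * \<delta>) powr (1 / 2) * torus_Lp_norm \<alpha> 2 f" by (simp add: C'_def N_def)
    finally show "torus_Lp_norm \<alpha> q\<^sub>e (spectral_projection \<alpha> l \<delta> f) \<le> C' * (l * \<delta>) powr (1 / 2) * torus_Lp_norm \<alpha> 2 f"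
      unfolding P .
  qed simp
qed

end
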